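(* Let $\Omega\subset\mathbb{R}^d$ be a (Lebesgue measurable) set of positive and finite measure. (i) If $1<p\leq 2$, then there exists an unconditional Schauder frame $\{(g_n,g_n^* )\}_{n=1}^\infty$ in the space $L^p(\Omega)$ such that the functions $g_n$ are unimodular (i.e. $|g_n(x)|=1$ for almost every $x\in\Omega$, for every $n$) and the coefficient functionals $\{g_n^*\}$ are seminormalized in $(L^p(\Omega))^*$. (ii) If $2<p<+\infty$, then there is no unconditional Schauder frame $\{(g_n,g_n^* )\}_{n=1}^\infty$ in $L^p(\Omega)$ such that the functions $\{g_n\}$ are uniformly bounded and both systems $\{g_n\}$ and $\{g_n^*\}$ are seminormalized (in $L^p(\Omega)$ and in $(L^p(\Omega))^*$, respectively).
   Context: $L^p(\Omega)$ is the space of complex-valued $p$-integrable functions on $\Omega$ with respect to Lebesgue measure. If $X$ is a separable Banach space with dual space $X^*$, a system $\{(u_n,u_n^* )\}_{n=1}^\infty\subset X\times X^*$ is called an unconditional Schauder frame if for every $x\in X$ the series $\sum_{n=1}^\infty u_n^*(x)u_n$ converges unconditionally (i.e. for every rearrangement of its terms) in the norm of $X$ and its sum is $x$. A system $\{u_n\}$ in a Banach space is seminormalized if there are positive constants $A,B$ such that $A\leq\|u_n\|\leq B$ for every $n$. A system of functions $\{g_n\}\subset L^p(\Omega)$ is uniformly bounded if there is a constant $M$ such that for every $n$ we have $|g_n(x)|\leq M$ for almost every $x\in\Omega$. *)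

theory Defs
  imports "HOL-Analysis.Analysis"
begin

text \<open>
  Elements of \<open>L\<^sup>p\<close> are represented by functions rather than by classes modulo almost everywhere
  equality, so that \<open>Lp_norm\<close> is a seminorm on \<open>Lp_space\<close>.  Banach space notions below are
  accordingly stated for a complex vector space \<open>X\<close> of functions (with pointwise operations) and a
  seminorm \<open>N\<close> on it; they are to be read in the quotient of \<open>X\<close> by the null space of \<open>N\<close>.
\<close>

definition Lp_space :: "'a measure \<Rightarrow> real \<Rightarrow> ('a \<Rightarrow> complex) set" where
  "Lp_space M p = {f \<in> borel_measurable M. integrable M (\<lambda>x. norm (f x) powr p)}"

definition Lp_norm :: "'a measure \<Rightarrow> real \<Rightarrow> ('a \<Rightarrow> complex) \<Rightarrow> real" where
  "Lp_norm M p f = (LINT x|M. norm (f x) powr p) powr (1 / p)"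

text \<open>
  The boundedness condition makes a functional constant on classes modulo \<open>N\<close>
  (lemma \<open>dual_space_cong\<close>), so these are the functionals on the quotient space.
\<close>

definition dual_space ::
  "('a \<Rightarrow> complex) set \<Rightarrow> (('a \<Rightarrow> complex) \<Rightarrow> real) \<Rightarrow> (('a \<Rightarrow> complex) \<Rightarrow> complex) set" where
  "dual_space X N = {\<phi>.
     (\<forall>f\<in>X. \<forall>g\<in>X. \<phi> (\<lambda>x. f x + g x) = \<phi> f + \<phi> g) \<and>
     (\<forall>c. \<forall>f\<in>X. \<phi> (\<lambda>x. c * f x) = c * \<phi> f) \<and>
     (\<exists>C. \<forall>f\<in>X. norm (\<phi> f) \<le> C * N f)}"

definition dual_norm ::
  "('a \<Rightarrow> complex) set \<Rightarrow> (('a \<Rightarrow> complex) \<Rightarrow> real) \<Rightarrow> (('a \<Rightarrow> complex) \<Rightarrow> complex) \<Rightarrow> real" where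
  "dual_norm X N \<phi> = (SUP f\<in>{f\<in>X. N f \<le> 1}. norm (\<phi> f))"

definition sums_in ::
  "(('a \<Rightarrow> complex) \<Rightarrow> real) \<Rightarrow> (nat \<Rightarrow> 'a \<Rightarrow> complex) \<Rightarrow> ('a \<Rightarrow> complex) \<Rightarrow> bool" where
  "sums_in N v s \<longleftrightarrow> (\<lambda>k. N (\<lambda>x. (\<Sum>n<k. v n x) - s x)) \<longlonglongrightarrow> 0"

definition converges_unconditionally ::
  "('a \<Rightarrow> complex) set \<Rightarrow> (('a \<Rightarrow> complex) \<Rightarrow> real) \<Rightarrow> (nat \<Rightarrow> 'a \<Rightarrow> complex) \<Rightarrow> bool" where
  "converges_unconditionally X N v \<longleftrightarrow>
     (\<forall>\<pi>::nat \<Rightarrow> nat. bij \<pi> \<longrightarrow> (\<exists>s\<in>X. sums_in N (\<lambda>n. v (\<pi> n)) s))"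

definition unconditional_Schauder_frame ::
  "('a \<Rightarrow> complex) set \<Rightarrow> (('a \<Rightarrow> complex) \<Rightarrow> real) \<Rightarrow>
   (nat \<Rightarrow> 'a \<Rightarrow> complex) \<Rightarrow> (nat \<Rightarrow> ('a \<Rightarrow> complex) \<Rightarrow> complex) \<Rightarrow> bool" where
  "unconditional_Schauder_frame X N u u' \<longleftrightarrow>
     (\<forall>n. u n \<in> X) \<and> (\<forall>n. u' n \<in> dual_space X N) \<and>
     (\<forall>f\<in>X. converges_unconditionally X N (\<lambda>n x. u' n f * u n x) \<and>
             sums_in N (\<lambda>n x. u' n f * u n x) f)"

definition seminormalized :: "('b \<Rightarrow> real) \<Rightarrow> (nat \<Rightarrow> 'b) \<Rightarrow> bool" where
  "seminormalized N u \<longleftrightarrow> (\<exists>A>0. \<exists>B>0. \<forall>n. A \<le> N (u n) \<and> N (u n) \<le> B)"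

definition unimodular :: "'a measure \<Rightarrow> ('a \<Rightarrow> complex) \<Rightarrow> bool" where
  "unimodular M f \<longleftrightarrow> (AE x in M. norm (f x) = 1)"

definition uniformly_bounded :: "'a measure \<Rightarrow> (nat \<Rightarrow> 'a \<Rightarrow> complex) \<Rightarrow> bool" where
  "uniformly_bounded M g \<longleftrightarrow> (\<exists>C. \<forall>n. AE x in M. norm (g n x) \<le> C)"

lemma dual_space_cong:
  assumes \<phi>: "\<phi> \<in> dual_space X N" and X: "f \<in> X" "g \<in> X" "(\<lambda>x. f x - g x) \<in> X"
    and eq: "N (\<lambda>x. f x - g x) = 0"
  shows "\<phi> f = \<phi> g"
proof -
  have add: "\<phi> (\<lambda>x. a x + b x) = \<phi> a + \<phi> b" if "a \<in> X" "b \<in> X" for a b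
    using \<phi> that unfolding dual_space_def by blast
  have "\<phi> f = \<phi> g + \<phi> (\<lambda>x. f x - g x)"
    using add[OF X(2,3)] by simp
  moreover obtain C where "norm (\<phi> (\<lambda>x. f x - g x)) \<le> C * N (\<lambda>x. f x - g x)"
    using \<phi> X unfolding dual_space_def by blast
  ultimately show ?thesis
    using eq by simp
qed

end

theory Submission
  imports Defs
begin

text \<open>
  \<^bold>\<open>Exponents above 2.\<close>  By uniform boundedness the signed partial sums of the frame expansion are bounded
  operators.  Uniformly bounded, seminormalized \<open>g\<^sub>n\<close> are bounded below in \<open>L\<^sup>2\<close>, so a suitable choice of
  signs gives \<open>\<Sum> \<bar>g\<^sub>n\<^sup>*(f)\<bar>\<^sup>2 \<le> C \<parallel>f\<parallel>\<^sup>2\<close>; as \<open>L\<^sup>p\<close> has type 2, its dual has cotype 2, which bounds these sums from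
  below for normalized indicator functions.  Thus signed sums of \<open>N\<close> disjoint such functions would have norm at
  least \<open>c N\<^sup>1\<^sup>/\<^sup>2\<close>, while their norm is \<open>N\<^sup>1\<^sup>/\<^sup>p\<close>.

  \<^bold>\<open>Exponents at most 2.\<close>  Let \<open>h\<^sub>j\<close> be the normalized Haar functions of a generating sequence of splittings of \<open>\<Omega>\<close>; they
  are unconditional because \<open>(\<bar>x\<bar>\<^sup>2 + \<bar>y\<bar>\<^sup>2)\<^sup>p\<^sup>/\<^sup>2 - B \<bar>x\<bar>\<^sup>p\<close> is concave along the lines on which martingale transforms
  move.  Write \<open>h\<^sub>j = H u\<close> with \<open>H\<close> large and average over the unimodular functions
  \<open>u \<plusminus> i s\<^sub>n (1 - u\<^sup>2)\<^sup>1\<^sup>/\<^sup>2\<close>, \<open>n < H\<^sup>2\<close>, with orthogonal signs \<open>s\<^sub>n\<close>: the imaginary parts of signed sums are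
  controlled in \<open>L\<^sup>2\<close> by the \<open>l\<^sup>2\<close> norm of the coefficients, so this is an unconditional frame with functionals \<open>\<alpha>\<close> of small norm.  Its coefficients may be
  perturbed by any sequence in \<open>l\<^sup>p\<close>, for instance by the normalized integrals \<open>\<rho>\<close> over disjoint sets.  Listing every
  function twice, with the functionals \<open>(\<alpha> + \<rho>) / 2\<close> and \<open>(\<alpha> - \<rho>) / 2\<close>, keeps the frame property and makes the
  functionals seminormalized.
\<close>

text \<open>The use of H^2 sign functions rests on one calculation. A Haar function h = H u enters
  an expansion with a coefficient c, and each of its 2 H^2 unimodular copies receives c / (2 H).
  Their common part u adds up to c h, while the square sum of the new coefficients is |c|^2 / 2,
  whatever H is. So H can be raised at will, which makes the functionals small and the weights sqrt
  (1 - u^2) almost constant. The range p <= 2 enters in three ways: on finite measure the L^2 norm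
  controls the L^p norm, so the sign parts are harmless; the l^p norm controls the l^2 norm, so
  coefficients in l^p can be synthesized; and the L^p norm of the square function controls the l^2
  norm of normalized Haar coefficients. Unconditional convergence is proved as convergence along the
  finite subsets of an index set. Such a subset may contain only some copies of a Haar function,
  hence the arbitrary bounded multipliers in the estimates. For p > 2 the passage goes the other
  way: bounds for finite subset sums are extracted from convergence of all rearrangements.\<close>

section \<open>Convexity and concavity of powers\<close>

lemma powr_tangent:
  fixes r t m :: real
  assumes "1 \<le> r" "0 \<le> t" "0 < m"
  shows "m powr r + r * m powr (r - 1) * (t - m) \<le> t powr r"
proof (cases "t = 0")
  case True
  have "m powr (r - 1) * m = m powr r"
    using assms by (simp add: powr_diff)
  then have "m powr r + r * m powr (r - 1) * (t - m) = (1 - r) * m powr r"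
    using True by (simp add: algebra_simps)
  also have "\<dots> \<le> 0"
    using assms by (simp add: mult_nonpos_nonneg)
  finally show ?thesis using True by simp
next
  case False
  \<comment> \<open>Young's inequality with weights 1 / r and 1 - 1 / r is the tangent inequality
    divided by r.\<close>
  have "(t powr r) powr (1 / r) * (m powr r) powr (1 - 1 / r) \<le> 1 / r * t powr r + (1 - 1 / r) * m powr r"
    using assms False by (intro Youngs_inequality_0) auto
  moreover have "(t powr r) powr (1 / r) = t" "(m powr r) powr (1 - 1 / r) = m powr (r - 1)"
    using assms False by (simp_all add: powr_powr right_diff_distrib)
  ultimately have "r * (t * m powr (r - 1)) \<le> r * (1 / r * t powr r + (1 - 1 / r) * m powr r)"
    using assms by (simp add: mult_left_mono)
  also have "\<dots> = t powr r + (r - 1) * m powr r"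
    using assms by (simp add: field_simps)
  finally have "r * (t * m powr (r - 1)) \<le> t powr r + (r - 1) * m powr r" .
  moreover have "m powr (r - 1) * m = m powr r"
    using assms by (simp add: powr_diff)
  ultimately show ?thesis
    by (simp add: algebra_simps)
qed

text \<open>The tangent at the convex combination lies below both end values, and its linear part
  cancels on averaging. The tangent exists only at positive points, hence the separate case of a
  vanishing combination.\<close>

lemma convex_on_powr_nonneg:
  fixes r :: real
  assumes "1 \<le> r"
  shows "convex_on {0..} (\<lambda>x. x powr r)"
proof (rule convex_onI)
  fix t x y :: real
  assume t: "0 < t" "t < 1" and xy: "x \<in> {0..}" "y \<in> {0..}"
  let ?m = "(1 - t) * x + t * y"
  show "((1 - t) *\<^sub>R x + t *\<^sub>R y) powr r \<le> (1 - t) * x powr r + t * y powr r"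
  proof (cases "?m > 0")
    case True
    have "(1 - t) * (?m powr r + r * ?m powr (r - 1) * (x - ?m)) + t * (?m powr r + r * ?m powr (r - 1) * (y - ?m))
        \<le> (1 - t) * x powr r + t * y powr r"
      using t xy True assms by (intro add_mono mult_left_mono powr_tangent) auto
    moreover have "(1 - t) * (A + c * (x - m)) + t * (A + c * (y - m)) = A + c * ((1 - t) * x + t * y - m)"
      for A c m :: real
      by (simp add: algebra_simps)
    ultimately have "?m powr r \<le> (1 - t) * x powr r + t * y powr r" by simp
    then show ?thesis by simp
  next
    case False
    then have "?m = 0" using t xy by (smt (verit) atLeast_iff mult_nonneg_nonneg)
    then show ?thesis using t by simp
  qed
qed simp

text \<open>Jensen for the convex inverse power 1 / s, applied to the numbers
  \<open>y i powr s\<close>, then raised to the power s.\<close>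

lemma sum_powr_concave:
  fixes s :: real
  assumes "finite F" "0 < s" "s \<le> 1" "\<And>i. i \<in> F \<Longrightarrow> 0 \<le> l i" "sum l F = 1" "\<And>i. i \<in> F \<Longrightarrow> 0 \<le> y i"
  shows "(\<Sum>i\<in>F. l i * y i powr s) \<le> (\<Sum>i\<in>F. l i * y i) powr s"
proof -
  have ne: "F \<noteq> {}" using assms(5) by auto
  have "(\<Sum>i\<in>F. l i *\<^sub>R y i powr s) powr (1 / s) \<le> (\<Sum>i\<in>F. l i * (y i powr s) powr (1 / s))"
    using assms ne convex_on_powr_nonneg[of "1 / s"]
    by (intro convex_on_sum[of F "{0..}" "\<lambda>x. x powr (1 / s)"]) auto
  also have "\<dots> = (\<Sum>i\<in>F. l i * y i)"
    using assms by (intro sum.cong) (auto simp: powr_powr)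
  finally have "((\<Sum>i\<in>F. l i * y i powr s) powr (1 / s)) powr s \<le> (\<Sum>i\<in>F. l i * y i) powr s"
    using assms by (intro powr_mono2) auto
  moreover have "(\<Sum>i\<in>F. l i * y i powr s) \<ge> 0"
    using assms by (auto intro!: sum_nonneg)
  ultimately show ?thesis
    using assms by (simp add: powr_powr)
qed

text \<open>The exponent s - 1 is at most 0, so u^(s-1) >= (a + b)^(s-1) for nonzero u = a and u =
  b; multiply by u and add.\<close>

lemma powr_add_le_sum:
  fixes a b s :: real
  assumes "0 \<le> a" "0 \<le> b" "0 < s" "s \<le> 1"
  shows "(a + b) powr s \<le> a powr s + b powr s"
proof (cases "a + b = 0")
  case False
  then have pos: "a + b > 0" using assms by simp
  have *: "u * (a + b) powr (s - 1) \<le> u powr s" if "0 \<le> u" "u \<le> a + b" for u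
  proof (cases "u = 0")
    case False
    then have "u * (a + b) powr (s - 1) \<le> u * u powr (s - 1)"
      using that assms by (intro mult_left_mono powr_mono2') auto
    also have "\<dots> = u powr s" using that False by (simp add: powr_diff)
    finally show ?thesis .
  qed simp
  have "(a + b) powr s = (a + b) * (a + b) powr (s - 1)"
    using pos by (simp add: powr_diff)
  also have "\<dots> \<le> a powr s + b powr s"
    using *[of a] *[of b] assms by (simp add: distrib_right)
  finally show ?thesis .
qed (use assms in auto)

lemma sum_powr_le:
  fixes s :: real
  assumes "finite F" "0 < s" "s \<le> 1" "\<And>i. i \<in> F \<Longrightarrow> 0 \<le> y i"
  shows "(\<Sum>i\<in>F. y i) powr s \<le> (\<Sum>i\<in>F. y i powr s)"
  using assms
proof (induction F)
  case (insert i F)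
  have "(\<Sum>i\<in>insert i F. y i) powr s = (y i + (\<Sum>i\<in>F. y i)) powr s"
    using insert by simp
  also have "\<dots> \<le> y i powr s + (\<Sum>i\<in>F. y i) powr s"
    using insert by (intro powr_add_le_sum) (auto intro: sum_nonneg)
  also have "\<dots> \<le> y i powr s + (\<Sum>i\<in>F. y i powr s)" using insert by simp
  finally show ?case using insert by simp
qed simp

subsection \<open>The spaces \<open>L\<^sup>p\<close>\<close>

lemma Lp_spaceD:
  assumes "f \<in> Lp_space M p"
  shows "f \<in> borel_measurable M" "integrable M (\<lambda>x. norm (f x) powr p)"
  using assms unfolding Lp_space_def by auto

lemma Lp_spaceI:
  assumes "f \<in> borel_measurable M" "integrable M (\<lambda>x. norm (f x) powr p)"
  shows "f \<in> Lp_space M p"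
  using assms unfolding Lp_space_def by auto

lemma Lp_norm_nonneg [simp]: "0 \<le> Lp_norm M p f"
  unfolding Lp_norm_def by simp

lemma Lp_norm_powr:
  assumes "p > 0"
  shows "Lp_norm M p f powr p = (LINT x|M. norm (f x) powr p)"
  using assms unfolding Lp_norm_def by (simp add: powr_powr)

lemma Lp_norm_le_iff:
  assumes "p > 0" "c \<ge> 0"
  shows "Lp_norm M p f \<le> c \<longleftrightarrow> (LINT x|M. norm (f x) powr p) \<le> c powr p"
proof -
  have "Lp_norm M p f \<le> c \<longleftrightarrow> Lp_norm M p f powr p \<le> c powr p"
    using assms powr_mono2[of p "Lp_norm M p f" c] powr_less_mono2[of p c "Lp_norm M p f"] by fastforce
  then show ?thesis using assms Lp_norm_powr by metis
qed

lemma norm_add_powr_le: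
  fixes a b :: "'a::real_normed_vector"
  assumes "p \<ge> 0"
  shows "norm (a + b) powr p \<le> 2 powr p * (norm a powr p + norm b powr p)"
proof -
  have "norm (a + b) powr p \<le> (2 * max (norm a) (norm b)) powr p"
    using assms by (intro powr_mono2 order_trans[OF norm_triangle_ineq]) auto
  also have "\<dots> = 2 powr p * max (norm a) (norm b) powr p"
    by (simp add: powr_mult)
  also have "max (norm a) (norm b) powr p \<le> norm a powr p + norm b powr p"
    by (simp add: max_def)
  finally show ?thesis by simp
qed

lemma Lp_space_add:
  assumes "p \<ge> 0" "f \<in> Lp_space M p" "g \<in> Lp_space M p"
  shows "(\<lambda>x. f x + g x) \<in> Lp_space M p"
proof (rule Lp_spaceI)
  note [measurable] = Lp_spaceD(1)[OF assms(2)] Lp_spaceD(1)[OF assms(3)]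
  show "(\<lambda>x. f x + g x) \<in> borel_measurable M" by simp
  have "integrable M (\<lambda>x. 2 powr p * (norm (f x) powr p + norm (g x) powr p))"
    using Lp_spaceD(2)[OF assms(2)] Lp_spaceD(2)[OF assms(3)] by simp
  then show "integrable M (\<lambda>x. norm (f x + g x) powr p)"
    by (rule Bochner_Integration.integrable_bound) (use norm_add_powr_le[OF assms(1)] in auto)
qed

lemma Lp_space_scale:
  assumes "f \<in> Lp_space M p"
  shows "(\<lambda>x. c * f x) \<in> Lp_space M p"
  using Lp_spaceD[OF assms] by (intro Lp_spaceI) (auto simp: norm_mult powr_mult)

lemma Lp_space_zero [simp]: "(\<lambda>x. 0) \<in> Lp_space M p"
  by (rule Lp_spaceI) auto

lemma Lp_space_uminus:
  assumes "f \<in> Lp_space M p" shows "(\<lambda>x. - f x) \<in> Lp_space M p"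
  using Lp_space_scale[OF assms, of "-1"] by simp

lemma Lp_space_diff:
  assumes "p \<ge> 0" "f \<in> Lp_space M p" "g \<in> Lp_space M p"
  shows "(\<lambda>x. f x - g x) \<in> Lp_space M p"
  using Lp_space_add[OF assms(1,2) Lp_space_uminus[OF assms(3)]] by simp

lemma Lp_space_sum:
  assumes "p \<ge> 0" "\<And>i. i \<in> F \<Longrightarrow> f i \<in> Lp_space M p"
  shows "(\<lambda>x. \<Sum>i\<in>F. f i x) \<in> Lp_space M p"
  using assms(2)
proof (induction F rule: infinite_finite_induct)
  case (insert i F)
  then show ?case using Lp_space_add[OF assms(1), of "f i" M "\<lambda>x. \<Sum>i\<in>F. f i x"] by simp
qed auto

lemma Lp_norm_zero [simp]: "Lp_norm M p (\<lambda>x. 0) = 0"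
  unfolding Lp_norm_def by simp

lemma Lp_norm_scale:
  assumes "p > 0"
  shows "Lp_norm M p (\<lambda>x. c * f x) = norm c * Lp_norm M p f"
  using assms unfolding Lp_norm_def by (simp add: norm_mult powr_mult powr_powr)

lemma Lp_norm_uminus: "Lp_norm M p (\<lambda>x. - f x) = Lp_norm M p f"
  unfolding Lp_norm_def by simp

lemma Lp_norm_minus_commute: "Lp_norm M p (\<lambda>x. f x - g x) = Lp_norm M p (\<lambda>x. g x - f x)"
  unfolding Lp_norm_def by (simp add: norm_minus_commute)

lemma Lp_norm_mono:
  assumes "p > 0" "g \<in> Lp_space M p" "f \<in> borel_measurable M" "AE x in M. norm (f x) \<le> norm (g x)"
  shows "f \<in> Lp_space M p" "Lp_norm M p f \<le> Lp_norm M p g"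
proof -
  have le: "AE x in M. norm (f x) powr p \<le> norm (g x) powr p"
    using assms(4) by eventually_elim (use assms in \<open>auto intro: powr_mono2\<close>)
  note [measurable] = assms(3)
  have int: "integrable M (\<lambda>x. norm (f x) powr p)"
    by (rule Bochner_Integration.integrable_bound[OF Lp_spaceD(2)[OF assms(2)]]) (use le in auto)
  then show "f \<in> Lp_space M p" using assms(3) by (rule Lp_spaceI[rotated])
  show "Lp_norm M p f \<le> Lp_norm M p g"
    unfolding Lp_norm_def using assms le int Lp_spaceD(2)[OF assms(2)]
    by (intro powr_mono2 integral_mono_AE) auto
qed

lemma Lp_norm_triangle:
  assumes "p \<ge> 1" "f \<in> Lp_space M p" "g \<in> Lp_space M p"
  shows "Lp_norm M p (\<lambda>x. f x + g x) \<le> Lp_norm M p f + Lp_norm M p g"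
proof (rule field_le_epsilon)
  fix e :: real assume "0 < e"
  \<comment> \<open>The slack e / 2 keeps both scales positive, so functions of norm zero need no
    case of their own. Convexity is used with the weights a / (a + b) and b / (a + b).\<close>
  define a where "a = Lp_norm M p f + e / 2"
  define b where "b = Lp_norm M p g + e / 2"
  have pos: "a > 0" "b > 0" using \<open>e > 0\<close> by (auto simp: a_def b_def add_nonneg_pos)
  have fa: "(LINT x|M. norm (f x) powr p) \<le> a powr p" and gb: "(LINT x|M. norm (g x) powr p) \<le> b powr p"
    using Lp_norm_le_iff[of p a M f] Lp_norm_le_iff[of p b M g] assms pos \<open>e > 0\<close> by (auto simp: a_def b_def)
  have pw: "norm (f x + g x) powr p \<le> (a + b) powr p *
      (a / (a + b) * (norm (f x) powr p / a powr p) + b / (a + b) * (norm (g x) powr p / b powr p))" for x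
  proof -
    have c: "((1 - b / (a + b)) *\<^sub>R (norm (f x) / a) + (b / (a + b)) *\<^sub>R (norm (g x) / b)) powr p
       \<le> (1 - b / (a + b)) * (norm (f x) / a) powr p + (b / (a + b)) * (norm (g x) / b) powr p"
      using pos assms by (intro convex_onD[OF convex_on_powr_nonneg]) auto
    have 1: "1 - b / (a + b) = a / (a + b)" using pos by (simp add: field_simps)
    have 2: "(a / (a + b)) *\<^sub>R (norm (f x) / a) + (b / (a + b)) *\<^sub>R (norm (g x) / b) = (norm (f x) + norm (g x)) / (a + b)"
      by (subst add_divide_distrib) (use pos in simp)
    have "norm (f x + g x) powr p \<le> (norm (f x) + norm (g x)) powr p"
      using assms by (intro powr_mono2 norm_triangle_ineq) auto
    also have "\<dots> = (a + b) powr p * ((norm (f x) + norm (g x)) / (a + b)) powr p"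
      using pos by (simp add: powr_divide)
    also have "\<dots> \<le> (a + b) powr p * (a / (a + b) * (norm (f x) / a) powr p + b / (a + b) * (norm (g x) / b) powr p)"
      using c unfolding 1 2 by (intro mult_left_mono) auto
    finally show ?thesis using pos by (simp add: powr_divide)
  qed
  have intf: "integrable M (\<lambda>x. norm (f x) powr p)" and intg: "integrable M (\<lambda>x. norm (g x) powr p)"
    using assms by (auto dest: Lp_spaceD)
  have "(LINT x|M. norm (f x + g x) powr p) \<le> (LINT x|M. (a + b) powr p *
      (a / (a + b) * (norm (f x) powr p / a powr p) + b / (a + b) * (norm (g x) powr p / b powr p)))"
    using pw intf intg assms Lp_spaceD(2)[OF Lp_space_add[of p f M g]] by (intro integral_mono) auto
  also have "\<dots> = (a + b) powr p * (a / (a + b) * ((LINT x|M. norm (f x) powr p) / a powr p)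
                  + b / (a + b) * ((LINT x|M. norm (g x) powr p) / b powr p))"
    using intf intg by simp
  also have "\<dots> \<le> (a + b) powr p * (a / (a + b) * 1 + b / (a + b) * 1)"
    using pos fa gb by (intro mult_left_mono add_mono) (auto simp: divide_simps)
  also have "\<dots> = (a + b) powr p" using pos by (simp add: add_divide_distrib[symmetric])
  finally have "Lp_norm M p (\<lambda>x. f x + g x) \<le> a + b"
    using Lp_norm_le_iff[of p "a + b" M] pos assms by auto
  then show "Lp_norm M p (\<lambda>x. f x + g x) \<le> Lp_norm M p f + Lp_norm M p g + e"
    by (simp add: a_def b_def)
qed

lemma Lp_norm_triangle_diff:
  assumes "p \<ge> 1" "f \<in> Lp_space M p" "g \<in> Lp_space M p"
  shows "Lp_norm M p (\<lambda>x. f x - g x) \<le> Lp_norm M p f + Lp_norm M p g"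
  using Lp_norm_triangle[OF assms(1,2) Lp_space_uminus[OF assms(3)]] by (simp add: Lp_norm_uminus)

lemma Lp_norm_sum:
  assumes "p \<ge> 1" "\<And>i. i \<in> F \<Longrightarrow> f i \<in> Lp_space M p"
  shows "Lp_norm M p (\<lambda>x. \<Sum>i\<in>F. f i x) \<le> (\<Sum>i\<in>F. Lp_norm M p (f i))"
  using assms(2)
proof (induction F rule: infinite_finite_induct)
  case (insert i F)
  have "Lp_norm M p (\<lambda>x. f i x + (\<Sum>i\<in>F. f i x)) \<le> Lp_norm M p (f i) + Lp_norm M p (\<lambda>x. \<Sum>i\<in>F. f i x)"
    using assms(1) insert by (intro Lp_norm_triangle Lp_space_sum) auto
  then show ?case using insert by simp
qed auto

lemma integrable_powr_mono:
  fixes g :: "'a \<Rightarrow> real"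
  assumes "finite_measure M" "integrable M (\<lambda>x. g x powr r)" "g \<in> borel_measurable M"
    "\<And>x. x \<in> space M \<Longrightarrow> 0 \<le> g x" "0 < s" "s \<le> r"
  shows "integrable M (\<lambda>x. g x powr s)"
proof (rule Bochner_Integration.integrable_bound)
  interpret finite_measure M by fact
  show "integrable M (\<lambda>x. 1 + g x powr r)" using assms by simp
  show "(\<lambda>x. g x powr s) \<in> borel_measurable M" using assms by simp
  show "AE x in M. norm (g x powr s) \<le> norm (1 + g x powr r)"
  proof (rule AE_I2)
    fix x assume "x \<in> space M"
    then have g: "0 \<le> g x" using assms by auto
    show "norm (g x powr s) \<le> norm (1 + g x powr r)"
    proof (cases "g x \<le> 1")
      case True
      then have "g x powr s \<le> 1" using g assms by (intro powr_le1) auto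
      then show ?thesis by (simp add: add_increasing2)
    next
      case False
      then have "g x powr s \<le> g x powr r" using assms by (intro powr_mono) auto
      then show ?thesis by simp
    qed
  qed
qed

text \<open>Jensen's inequality on E, with a power of the measure of E in place of normalization:
  the tangent of t^r at the mean of g over E is integrated over E, where its linear part gives
  zero.\<close>

lemma set_integral_powr_le:
  fixes g :: "'a \<Rightarrow> real"
  assumes "finite_measure M" "E \<in> sets M" "integrable M (\<lambda>x. g x powr r)" "g \<in> borel_measurable M"
    "\<And>x. x \<in> space M \<Longrightarrow> 0 \<le> g x" "r \<ge> 1"
  shows "(LINT x|M. indicator E x * g x) powr r \<le> measure M E powr (r - 1) * (LINT x|M. indicator E x * g x powr r)"
proof -
  interpret finite_measure M by fact
  have ig: "integrable M g"
  proof -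
    have "integrable M (\<lambda>x. g x powr 1)"
      by (rule integrable_powr_mono[OF assms(1,3,4)]) (use assms in auto)
    then show ?thesis
      by (rule Bochner_Integration.integrable_cong[THEN iffD1, rotated 2]) (use assms in auto)
  qed
  let ?I = "LINT x|M. indicator E x * g x"
  have iE: "integrable M (\<lambda>x. indicator E x * g x)" "integrable M (\<lambda>x. indicator E x * g x powr r)"
    using integrable_mult_indicator[OF assms(2) ig] integrable_mult_indicator[OF assms(2,3)] by simp_all
  have I0: "?I \<ge> 0" using assms(5) by (intro integral_nonneg_AE AE_I2) (auto simp: indicator_def)
  have J0: "(LINT x|M. indicator E x * g x powr r) \<ge> 0" by (intro integral_nonneg_AE AE_I2) (auto simp: indicator_def)
  show ?thesis
  proof (cases "?I = 0")
    case True
    then show ?thesis using J0 assms by simp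
  next
    case False
    then have Ip: "?I > 0" using I0 by simp
    have mp: "measure M E > 0"
    proof (rule ccontr)
      assume "\<not> measure M E > 0"
      then have "measure M E = 0" using measure_nonneg[of M E] by linarith
      then have "E \<in> null_sets M" using assms(2) by (auto simp: emeasure_eq_measure intro!: null_setsI)
      then have "AE x in M. indicator E x * g x = 0"
        using AE_not_in[of E M] by (auto elim!: eventually_mono)
      then show False using False integral_eq_zero_AE[of "\<lambda>x. indicator E x * g x" M] by simp
    qed
    define m where "m = ?I / measure M E"
    have m: "m > 0" using Ip mp by (simp add: m_def)
    have "(LINT x|M. indicator E x * (m powr r + r * m powr (r - 1) * (g x - m))) \<le> (LINT x|M. indicator E x * g x powr r)"
    proof (rule integral_mono)
      have "integrable M (\<lambda>x. indicat_real E x *\<^sub>R (m powr r + r * m powr (r - 1) * (g x - m)))"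
        using ig by (intro integrable_mult_indicator[OF assms(2)]) auto
      then show "integrable M (\<lambda>x. indicat_real E x * (m powr r + r * m powr (r - 1) * (g x - m)))" by simp
    qed (use iE powr_tangent[OF assms(6) _ m] assms(5) in \<open>auto simp: indicator_def\<close>)
    also have "(LINT x|M. indicator E x * (m powr r + r * m powr (r - 1) * (g x - m)))
      = (LINT x|M. (m powr r - r * m powr (r - 1) * m) * indicator E x + r * m powr (r - 1) * (indicator E x * g x))"
      by (intro Bochner_Integration.integral_cong) (auto simp: algebra_simps)
    also have "\<dots> = (m powr r - r * m powr (r - 1) * m) * measure M E + r * m powr (r - 1) * ?I"
      using iE assms(2) by (simp add: emeasure_eq_measure)
    also have "\<dots> = m powr r * measure M E"
      using mp by (simp add: m_def algebra_simps)
    finally have "m powr r * measure M E \<le> (LINT x|M. indicator E x * g x powr r)" .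
    moreover have "?I powr r = measure M E powr (r - 1) * (m powr r * measure M E)"
      using mp I0 by (simp add: m_def powr_divide powr_diff)
    ultimately show ?thesis by (simp add: mult_left_mono)
  qed
qed

lemma Lp_norm_exponent_mono:
  assumes "finite_measure M" "f \<in> Lp_space M r" "0 < s" "s \<le> r"
  shows "f \<in> Lp_space M s" "Lp_norm M s f \<le> measure M (space M) powr (1 / s - 1 / r) * Lp_norm M r f"
proof -
  interpret finite_measure M by fact
  note [measurable] = Lp_spaceD(1)[OF assms(2)]
  have "integrable M (\<lambda>x. norm (f x) powr s)"
    by (rule integrable_powr_mono[OF assms(1) Lp_spaceD(2)[OF assms(2)]]) (use assms in auto)
  then show "f \<in> Lp_space M s" by (intro Lp_spaceI) auto
  let ?mu = "measure M (space M)"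
  have pp: "(norm (f x) powr s) powr (r / s) = norm (f x) powr r" for x
    using assms by (simp add: powr_powr)
  have "(LINT x|M. indicator (space M) x * norm (f x) powr s) powr (r / s)
     \<le> ?mu powr (r / s - 1) * (LINT x|M. indicator (space M) x * (norm (f x) powr s) powr (r / s))"
    by (rule set_integral_powr_le) (use assms Lp_spaceD(2)[OF assms(2)] pp in auto)
  also have "(LINT x|M. indicator (space M) x * (norm (f x) powr s) powr (r / s)) = (LINT x|M. norm (f x) powr r)"
    unfolding pp by (intro Bochner_Integration.integral_cong) auto
  also have "(LINT x|M. indicator (space M) x * norm (f x) powr s) = (LINT x|M. norm (f x) powr s)"
    by (intro Bochner_Integration.integral_cong) auto
  finally have "((LINT x|M. norm (f x) powr s) powr (r / s)) powr (1 / r)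
      \<le> (?mu powr (r / s - 1) * (LINT x|M. norm (f x) powr r)) powr (1 / r)"
    using assms by (intro powr_mono2) auto
  then show "Lp_norm M s f \<le> ?mu powr (1 / s - 1 / r) * Lp_norm M r f"
    using assms unfolding Lp_norm_def by (simp add: powr_powr powr_mult diff_divide_distrib)
qed

lemma norm_integral_indicator_le:
  assumes "finite_measure M" "E \<in> sets M" "f \<in> Lp_space M p" "p \<ge> 1"
  shows "integrable M f"
    "norm (LINT x|M. indicator E x * f x) powr p \<le> measure M E powr (p - 1) * (LINT x|M. indicator E x * norm (f x) powr p)"
proof -
  interpret finite_measure M by fact
  note [measurable] = Lp_spaceD(1)[OF assms(3)]
  have "integrable M (\<lambda>x. norm (f x) powr 1)"
    by (rule integrable_powr_mono[OF assms(1) Lp_spaceD(2)[OF assms(3)]]) (use assms in auto)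
  then have ni: "integrable M (\<lambda>x. norm (f x))" by simp
  then show "integrable M f" using integrable_norm_cancel Lp_spaceD(1)[OF assms(3)] by blast
  have "norm (LINT x|M. indicator E x * f x) \<le> (LINT x|M. norm (indicator E x * f x))"
    by simp
  also have "\<dots> = (LINT x|M. indicator E x * norm (f x))"
    by (intro Bochner_Integration.integral_cong) (auto simp: norm_mult indicator_def)
  finally have "norm (LINT x|M. indicator E x * f x) powr p \<le> (LINT x|M. indicator E x * norm (f x)) powr p"
    using assms by (intro powr_mono2) auto
  also have "\<dots> \<le> measure M E powr (p - 1) * (LINT x|M. indicator E x * norm (f x) powr p)"
    by (rule set_integral_powr_le) (use assms Lp_spaceD(2)[OF assms(3)] in auto)
  finally show "norm (LINT x|M. indicator E x * f x) powr p \<le> measure M E powr (p - 1) * (LINT x|M. indicator E x * norm (f x) powr p)" .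
qed

lemma Lp_space_bounded:
  assumes "finite_measure M" "f \<in> borel_measurable M" "AE x in M. norm (f x) \<le> C" "p > 0"
  shows "f \<in> Lp_space M p"
proof (rule Lp_spaceI[OF assms(2)])
  interpret finite_measure M by fact
  show "integrable M (\<lambda>x. norm (f x) powr p)"
  proof (rule integrable_const_bound)
    show "AE x in M. norm (norm (f x) powr p) \<le> (max C 0) powr p"
      using assms(3) by eventually_elim (use assms in \<open>auto intro!: powr_mono2\<close>)
  qed (use assms in simp)
qed

subsection \<open>Completeness and uniform boundedness\<close>

lemma Lp_nn_integral_le:
  assumes "p > 0" "f \<in> Lp_space M p" "Lp_norm M p f \<le> C"
  shows "(\<integral>\<^sup>+x. ennreal (norm (f x) powr p) \<partial>M) \<le> ennreal (C powr p)"
proof -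
  have C: "C \<ge> 0" using assms(3) Lp_norm_nonneg[of M p f] by linarith
  have "(\<integral>\<^sup>+x. ennreal (norm (f x) powr p) \<partial>M) = ennreal (LINT x|M. norm (f x) powr p)"
    using Lp_spaceD[OF assms(2)] by (intro nn_integral_eq_integral) auto
  also have "\<dots> \<le> ennreal (C powr p)"
    using assms C Lp_norm_le_iff[of p C M f] by (intro ennreal_leI) auto
  finally show ?thesis .
qed

lemma Lp_nn_integralI:
  assumes "p > 0" "C \<ge> 0" "f \<in> borel_measurable M"
    "(\<integral>\<^sup>+x. ennreal (norm (f x) powr p) \<partial>M) \<le> ennreal (C powr p)"
  shows "f \<in> Lp_space M p" "Lp_norm M p f \<le> C"
proof -
  note [measurable] = assms(3)
  have int: "integrable M (\<lambda>x. norm (f x) powr p)"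
    using le_less_trans[OF assms(4)] by (intro integrableI_nonneg) auto
  then show "f \<in> Lp_space M p" using assms by (intro Lp_spaceI)
  have "ennreal (LINT x|M. norm (f x) powr p) \<le> ennreal (C powr p)"
    using assms(4) nn_integral_eq_integral[OF int] by simp
  then show "Lp_norm M p f \<le> C"
    using assms by (simp add: Lp_norm_le_iff)
qed

lemma Lp_Fatou:
  assumes "p > 0" "\<And>n. f n \<in> Lp_space M p" "\<And>n. Lp_norm M p (f n) \<le> C"
    and g: "g \<in> borel_measurable M" and lim: "AE x in M. (\<lambda>n. f n x) \<longlonglongrightarrow> g x"
  shows "g \<in> Lp_space M p" "Lp_norm M p g \<le> C"
proof -
  have C: "C \<ge> 0" using assms(3)[of 0] Lp_norm_nonneg[of M p "f 0"] by linarith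
  have [measurable]: "f n \<in> borel_measurable M" for n using Lp_spaceD[OF assms(2)] by auto
  have "(\<integral>\<^sup>+x. ennreal (norm (g x) powr p) \<partial>M) = (\<integral>\<^sup>+x. liminf (\<lambda>n. ennreal (norm (f n x) powr p)) \<partial>M)"
  proof (rule nn_integral_cong_AE)
    show "AE x in M. ennreal (norm (g x) powr p) = liminf (\<lambda>n. ennreal (norm (f n x) powr p))"
      using lim
    proof eventually_elim
      case (elim x)
      have "(\<lambda>n. ennreal (norm (f n x) powr p)) \<longlonglongrightarrow> ennreal (norm (g x) powr p)"
        using assms(1) by (intro tendsto_ennrealI tendsto_powr' tendsto_norm elim tendsto_const) auto
      then show ?case by (intro lim_imp_Liminf[symmetric]) auto
    qed
  qed
  also have "\<dots> \<le> liminf (\<lambda>n. \<integral>\<^sup>+x. ennreal (norm (f n x) powr p) \<partial>M)"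
    by (rule nn_integral_liminf) auto
  also have "\<dots> \<le> ennreal (C powr p)"
    using Lp_nn_integral_le[OF assms(1-3)] by (intro Liminf_le) auto
  finally show "g \<in> Lp_space M p" "Lp_norm M p g \<le> C"
    using Lp_nn_integralI[OF assms(1) C g] by auto
qed

text \<open>The partial sums of the pointwise norms are bounded in L^p by \<open>suminf c\<close>;
  monotone convergence makes the supremum of their p-th powers integrable, hence finite almost
  everywhere.\<close>

lemma AE_summable_Lp:
  assumes "p \<ge> 1" "\<And>n. f n \<in> Lp_space M p" "\<And>n. Lp_norm M p (f n) \<le> c n" "summable c"
  shows "AE x in M. summable (\<lambda>n. norm (f n x))"
proof -
  have [measurable]: "f n \<in> borel_measurable M" for n using Lp_spaceD[OF assms(2)] by auto
  have c0: "c n \<ge> 0" for n using assms(3)[of n] Lp_norm_nonneg[of M p "f n"] by linarith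
  define G where "G k x = (\<Sum>n<k. norm (f n x))" for k x
  have G0: "G k x \<ge> 0" for k x unfolding G_def by (auto intro: sum_nonneg)
  have Gm: "G k x \<le> G l x" if "k \<le> l" for k l x
    unfolding G_def using that by (intro sum_mono2) auto
  have [measurable]: "G k \<in> borel_measurable M" for k unfolding G_def by measurable
  have absf: "(\<lambda>x. complex_of_real (norm (f n x))) \<in> Lp_space M p"
    "Lp_norm M p (\<lambda>x. complex_of_real (norm (f n x))) \<le> c n" for n
    using assms(2,3)[of n] unfolding Lp_space_def Lp_norm_def by auto
  have GLp: "(\<lambda>x. complex_of_real (G k x)) \<in> Lp_space M p" for k
    unfolding G_def of_real_sum using assms absf by (intro Lp_space_sum) auto
  have GN: "Lp_norm M p (\<lambda>x. complex_of_real (G k x)) \<le> suminf c" for k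
  proof -
    have "Lp_norm M p (\<lambda>x. complex_of_real (G k x)) \<le> (\<Sum>n<k. Lp_norm M p (\<lambda>x. complex_of_real (norm (f n x))))"
      unfolding G_def of_real_sum using assms absf by (intro Lp_norm_sum) auto
    also have "\<dots> \<le> (\<Sum>n<k. c n)" using absf by (intro sum_mono)
    also have "\<dots> \<le> suminf c" using assms c0 by (intro sum_le_suminf) auto
    finally show ?thesis .
  qed
  have "(\<integral>\<^sup>+x. (SUP k. ennreal (G k x powr p)) \<partial>M) = (SUP k. \<integral>\<^sup>+x. ennreal (G k x powr p) \<partial>M)"
  proof (rule nn_integral_monotone_convergence_SUP)
    show "incseq (\<lambda>k x. ennreal (G k x powr p))"
      using assms Gm G0 by (intro incseq_SucI le_funI ennreal_leI powr_mono2) auto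
  qed simp
  also have "\<dots> \<le> ennreal (suminf c powr p)"
    using Lp_nn_integral_le[of p "\<lambda>x. complex_of_real (G _ x)" M "suminf c"] GLp GN assms G0
    by (intro SUP_least) auto
  finally have "(\<integral>\<^sup>+x. (SUP k. ennreal (G k x powr p)) \<partial>M) \<noteq> \<infinity>"
    using ennreal_less_top[of "suminf c powr p"] by (auto simp: top_unique)
  then have "AE x in M. (SUP k. ennreal (G k x powr p)) \<noteq> \<infinity>"
    by (intro nn_integral_PInf_AE) auto
  then show ?thesis
  proof eventually_elim
    case (elim x)
    then obtain r where r: "(SUP k. ennreal (G k x powr p)) = ennreal r" "r \<ge> 0"
      by (cases "SUP k. ennreal (G k x powr p)") auto
    have "G k x \<le> r powr (1 / p)" for k
    proof -
      have "ennreal (G k x powr p) \<le> ennreal r" unfolding r(1)[symmetric] by (rule SUP_upper) simp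
      then have "(G k x powr p) powr (1 / p) \<le> r powr (1 / p)"
        using assms r by (intro powr_mono2) auto
      then show ?thesis using assms G0 by (simp add: powr_powr)
    qed
    from this[of "Suc _"] have "sum (\<lambda>n. norm (f n x)) {..k} \<le> r powr (1 / p)" for k
      unfolding G_def lessThan_Suc_atMost .
    then show ?case by (intro bounded_imp_summable) auto
  qed
qed

text \<open>Fatou's lemma, applied to the finite blocks after the first k terms, bounds the
  remainder. This quantitative remainder, beyond mere completeness, is what the uniform boundedness
  argument consumes.\<close>

lemma Lp_complete_series:
  assumes "p \<ge> 1" "\<And>n. f n \<in> Lp_space M p" "\<And>n. Lp_norm M p (f n) \<le> c n" "summable c"
  obtains g where "g \<in> Lp_space M p"
    "\<And>k. Lp_norm M p (\<lambda>x. g x - (\<Sum>n<k. f n x)) \<le> (\<Sum>n. c (n + k))"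
proof -
  define g where "g x = (\<Sum>n. f n x)" for x
  have fm [measurable]: "f n \<in> borel_measurable M" for n using Lp_spaceD[OF assms(2)] by auto
  have c0: "c n \<ge> 0" for n using assms(3)[of n] Lp_norm_nonneg[of M p "f n"] by linarith
  have [measurable]: "g \<in> borel_measurable M" unfolding g_def by measurable
  have AE: "AE x in M. (\<lambda>n. \<Sum>i<n. f i x) \<longlonglongrightarrow> g x"
    using AE_summable_Lp[OF assms]
    by eventually_elim (auto simp: g_def intro!: summable_LIMSEQ summable_norm_cancel)
  have fatou: "(\<lambda>x. g x - (\<Sum>n<k. f n x)) \<in> Lp_space M p \<and>
     Lp_norm M p (\<lambda>x. g x - (\<Sum>n<k. f n x)) \<le> (\<Sum>n. c (n + k))" for k
  proof -
    let ?h = "\<lambda>m x. (\<Sum>n<m. f (n + k) x)"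
    have h: "?h m \<in> Lp_space M p" for m using assms by (intro Lp_space_sum) auto
    have hN: "Lp_norm M p (?h m) \<le> (\<Sum>n. c (n + k))" for m
    proof -
      have "Lp_norm M p (?h m) \<le> (\<Sum>n<m. Lp_norm M p (f (n + k)))"
        using assms by (intro Lp_norm_sum) auto
      also have "\<dots> \<le> (\<Sum>n<m. c (n + k))" using assms by (intro sum_mono)
      also have "\<dots> \<le> (\<Sum>n. c (n + k))"
        using assms(4) c0 by (intro sum_le_suminf summable_ignore_initial_segment) auto
      finally show ?thesis .
    qed
    have lim: "AE x in M. (\<lambda>m. ?h m x) \<longlonglongrightarrow> g x - (\<Sum>n<k. f n x)"
      using AE
    proof eventually_elim
      case (elim x)
      have "(\<lambda>m. (\<Sum>i<m + k. f i x) - (\<Sum>n<k. f n x)) \<longlonglongrightarrow> g x - (\<Sum>n<k. f n x)"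
        using LIMSEQ_ignore_initial_segment[OF elim, of k] by (intro tendsto_diff) auto
      moreover have "(\<Sum>i<m + k. f i x) - (\<Sum>n<k. f n x) = ?h m x" for m
        by (induction m) (auto simp: algebra_simps)
      ultimately show ?case by simp
    qed
    show ?thesis
      using Lp_Fatou[OF _ h hN _ lim] assms(1) by simp
  qed
  show thesis
  proof (rule that[of g])
    show "g \<in> Lp_space M p" using fatou[of 0] by simp
  qed (use fatou in simp)
qed

lemma inverse_power_tail: "(\<Sum>n. (1/3::real) ^ (n + k)) = 3 / 2 * (1/3) ^ k"
  using suminf_mult2[of "\<lambda>n. (1/3::real) ^ n" "(1/3) ^ k"] by (simp add: power_add suminf_geometric)

text \<open>Q stands for the operator norm of the seminorm q: it is the infimum of the admissible
  constants that are at least K, and h nearly attains it at the prescribed norm r.\<close>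

lemma almost_optimal_bound:
  fixes q :: "('a \<Rightarrow> complex) \<Rightarrow> real"
  assumes "p \<ge> 1"
    and bnd: "\<And>f. f \<in> Lp_space M p \<Longrightarrow> q f \<le> B * Lp_norm M p f"
    and unb: "f0 \<in> Lp_space M p" "q f0 > K * Lp_norm M p f0" and "K > 0"
    and scale: "\<And>c f. f \<in> Lp_space M p \<Longrightarrow> q (\<lambda>x. complex_of_real c * f x) = \<bar>c\<bar> * q f"
    and "r > 0"
  obtains Q h where "Q \<ge> K" "\<And>f. f \<in> Lp_space M p \<Longrightarrow> q f \<le> Q * Lp_norm M p f"
    "h \<in> Lp_space M p" "Lp_norm M p h = r" "q h \<ge> 9/10 * Q * r"
proof -
  define S where "S = {C. C \<ge> K \<and> (\<forall>f\<in>Lp_space M p. q f \<le> C * Lp_norm M p f)}"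
  define Q where "Q = Inf S"
  have "max B K \<in> S"
    unfolding S_def using bnd mult_right_mono[of B "max B K" "Lp_norm M p _"] by (fastforce intro: order_trans)
  then have ne: "S \<noteq> {}" by auto
  have bdd: "bdd_below S" unfolding S_def by (auto intro: bdd_belowI[of _ K])
  have QK: "Q \<ge> K" unfolding Q_def using ne by (intro cInf_greatest) (auto simp: S_def)
  have Qb: "q f \<le> Q * Lp_norm M p f" if f: "f \<in> Lp_space M p" for f
  proof (cases "Lp_norm M p f = 0")
    case True
    then show ?thesis using bnd[OF f] by simp
  next
    case False
    then have pos: "Lp_norm M p f > 0" using Lp_norm_nonneg[of M p f] by linarith
    have "q f / Lp_norm M p f \<le> Q"
      unfolding Q_def using ne f pos by (intro cInf_greatest) (auto simp: S_def pos_divide_le_eq)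
    then show ?thesis using pos by (simp add: pos_divide_le_eq)
  qed
  have "\<exists>f\<in>Lp_space M p. q f > 9/10 * Q * Lp_norm M p f"
  \<comment> \<open>Either 9/10 Q is still at least K and violates the minimality of Q, or it lies
    below K and \<open>f0\<close> is the witness.\<close>
  proof (cases "9/10 * Q \<ge> K")
    case True
    have "9/10 * Q \<notin> S"
      using cInf_lower[OF _ bdd, of "9/10 * Q"] QK \<open>K > 0\<close> by (auto simp: Q_def[symmetric])
    then show ?thesis using True by (auto simp: S_def not_le)
  next
    case False
    then have "9/10 * Q * Lp_norm M p f0 \<le> K * Lp_norm M p f0" by (intro mult_right_mono) auto
    then show ?thesis using unb by force
  qed
  then obtain f where f: "f \<in> Lp_space M p" "q f > 9/10 * Q * Lp_norm M p f" by blast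
  have pos: "Lp_norm M p f > 0"
  proof (rule ccontr)
    assume "\<not> ?thesis"
    then have "Lp_norm M p f = 0" using Lp_norm_nonneg[of M p f] by linarith
    then show False using f bnd[OF f(1)] by simp
  qed
  define c where "c = r / Lp_norm M p f"
  have c: "c > 0" using pos \<open>r > 0\<close> by (simp add: c_def)
  show thesis
  proof (rule that[OF QK Qb])
    show "(\<lambda>x. complex_of_real c * f x) \<in> Lp_space M p" using f by (intro Lp_space_scale)
    show "Lp_norm M p (\<lambda>x. complex_of_real c * f x) = r"
      using assms(1) c pos by (subst Lp_norm_scale) (auto simp: c_def norm_divide norm_of_real abs_of_pos[OF \<open>r > 0\<close>])
    have "9/10 * Q * r = c * (9/10 * Q * Lp_norm M p f)" using pos by (simp add: c_def)
    also have "\<dots> \<le> c * q f" using f c by (intro mult_left_mono) auto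
    finally show "9/10 * Q * r \<le> q (\<lambda>x. complex_of_real c * f x)"
      using scale[OF f(1), of c] c by simp
  qed
qed

text \<open>Sokal's proof: no Baire category, only the summation of a geometrically decaying series.\<close>

lemma Lp_uniform_boundedness:
  fixes q :: "'i \<Rightarrow> ('a \<Rightarrow> complex) \<Rightarrow> real"
  assumes "p \<ge> 1"
    and tri: "\<And>i f g. f \<in> Lp_space M p \<Longrightarrow> g \<in> Lp_space M p \<Longrightarrow> q i (\<lambda>x. f x + g x) \<le> q i f + q i g"
    and scale: "\<And>i c f. f \<in> Lp_space M p \<Longrightarrow> q i (\<lambda>x. complex_of_real c * f x) = \<bar>c\<bar> * q i f"
    and bnd: "\<And>i f. f \<in> Lp_space M p \<Longrightarrow> q i f \<le> B i * Lp_norm M p f"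
    and ptw: "\<And>f. f \<in> Lp_space M p \<Longrightarrow> \<exists>C. \<forall>i. q i f \<le> C"
  shows "\<exists>K>0. \<forall>i. \<forall>f\<in>Lp_space M p. q i f \<le> K * Lp_norm M p f"
proof (rule ccontr)
  assume neg0: "\<not> ?thesis"
  have neg: "\<exists>i f. f \<in> Lp_space M p \<and> q i f > K * Lp_norm M p f" if "K > 0" for K
  proof (rule ccontr)
    assume "\<not> ?thesis"
    then have "\<forall>i. \<forall>f\<in>Lp_space M p. q i f \<le> K * Lp_norm M p f" by (metis not_le)
    then show False using neg0 that by blast
  qed
  \<comment> \<open>The terms h have norm 3^-n, so the threshold 3^n (n + 1) makes Q 3^-n at least n
    + 1, the quantity that becomes unbounded.\<close>
  have "\<exists>i Q h. Q \<ge> 3 ^ n * real (n + 1) \<and> (\<forall>f\<in>Lp_space M p. q i f \<le> Q * Lp_norm M p f) \<and>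
     h \<in> Lp_space M p \<and> Lp_norm M p h = (1/3)^n \<and> q i h \<ge> 9/10 * Q * (1/3)^n" for n :: nat
  proof -
    have K: "0 < 3 ^ n * real (n + 1)" by (intro mult_pos_pos) auto
    from neg[OF K] obtain i f where if_: "f \<in> Lp_space M p" "q i f > 3 ^ n * real (n + 1) * Lp_norm M p f"
      by blast
    obtain Q h where "Q \<ge> 3 ^ n * real (n + 1)" "\<And>f. f \<in> Lp_space M p \<Longrightarrow> q i f \<le> Q * Lp_norm M p f"
      "h \<in> Lp_space M p" "Lp_norm M p h = (1/3)^n" "q i h \<ge> 9/10 * Q * (1/3)^n"
      by (rule almost_optimal_bound[OF assms(1) bnd if_ K scale, where r = "(1/3)^n"]) auto
    then show ?thesis by blast
  qed
  then obtain i Q h where Q: "\<And>n. Q n \<ge> 3 ^ n * real (n + 1)"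
    "\<And>n f. f \<in> Lp_space M p \<Longrightarrow> q (i n) f \<le> Q n * Lp_norm M p f"
    and h: "\<And>n. h n \<in> Lp_space M p" "\<And>n. Lp_norm M p (h n) = (1/3)^n" "\<And>n. q (i n) (h n) \<ge> 9/10 * Q n * (1/3)^n"
    by metis
  \<comment> \<open>The sign of \<open>h n\<close> is chosen once \<open>S n\<close> is known: by
    the triangle inequality the values of the seminorm at S + h and S - h have an average no smaller
    than its value at h.\<close>
  define S where "S = rec_nat (\<lambda>x. 0)
     (\<lambda>n f. if q (i n) (\<lambda>x. f x + h n x) \<ge> q (i n) (h n) then (\<lambda>x. f x + h n x) else (\<lambda>x. f x - h n x))"
  define d where "d n = (if q (i n) (\<lambda>x. S n x + h n x) \<ge> q (i n) (h n) then h n else (\<lambda>x. - h n x))" for n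
  have S0: "S 0 = (\<lambda>x. 0)" and SSuc: "S (Suc n) = (\<lambda>x. S n x + d n x)" for n
    by (auto simp: S_def d_def)
  have d: "d n \<in> Lp_space M p" "Lp_norm M p (d n) = (1/3)^n" for n
    using h by (auto simp: d_def Lp_space_uminus Lp_norm_uminus)
  have S: "S n \<in> Lp_space M p" for n
    using d assms(1) by (induction n) (auto simp: S0 SSuc intro: Lp_space_add)
  have Ssum: "S n x = (\<Sum>k<n. d k x)" for n x by (induction n) (auto simp: S0 SSuc)
  have big: "q (i n) (S (Suc n)) \<ge> q (i n) (h n)" for n
  proof (cases "q (i n) (\<lambda>x. S n x + h n x) \<ge> q (i n) (h n)")
    case True
    then show ?thesis by (simp add: SSuc d_def)
  next
    case False
    have "2 * q (i n) (h n) = q (i n) (\<lambda>x. complex_of_real 2 * h n x)" using scale[OF h(1), of "i n" 2] by simp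
    also have "(\<lambda>x. complex_of_real 2 * h n x) = (\<lambda>x. (S n x + h n x) + complex_of_real (-1) * (S n x - h n x))"
      by auto
    also have "q (i n) \<dots> \<le> q (i n) (\<lambda>x. S n x + h n x) + q (i n) (\<lambda>x. complex_of_real (-1) * (S n x - h n x))"
      using S h assms(1) by (intro tri Lp_space_add Lp_space_scale Lp_space_diff) auto
    also have "q (i n) (\<lambda>x. complex_of_real (-1) * (S n x - h n x)) = q (i n) (\<lambda>x. S n x - h n x)"
      using scale[OF Lp_space_diff[OF _ S h(1)], of "i n" "-1"] assms(1) by simp
    finally show ?thesis using False by (simp add: SSuc d_def)
  qed
  obtain g where g: "g \<in> Lp_space M p"
    "\<And>k. Lp_norm M p (\<lambda>x. g x - (\<Sum>n<k. d n x)) \<le> (\<Sum>n. (1/3::real) ^ (n + k))"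
    by (rule Lp_complete_series[OF assms(1) d(1), where c = "\<lambda>n. (1/3)^n"]) (use d(2) in \<open>auto simp: summable_geometric\<close>)
  have gS: "Lp_norm M p (\<lambda>x. S (Suc n) x - g x) \<le> 1/2 * (1/3)^n" for n
    using g(2)[of "Suc n"] unfolding inverse_power_tail Ssum[symmetric]
    by (subst Lp_norm_minus_commute) simp
  obtain C where C: "\<And>j. q j g \<le> C" using ptw[OF g(1)] by blast
  \<comment> \<open>The gain 9/10 Q 3^-n outweighs the loss from the remainder, whose norm is at
    most 1/2 3^-n; the difference of the factors is 2/5.\<close>
  have "2/5 * real (n + 1) \<le> C" for n
  proof -
    have "9/10 * Q n * (1/3)^n \<le> q (i n) (S (Suc n))" using big h(3) order_trans by blast
    also have "S (Suc n) = (\<lambda>x. g x + (S (Suc n) x - g x))" by auto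
    also have "q (i n) \<dots> \<le> q (i n) g + q (i n) (\<lambda>x. S (Suc n) x - g x)"
      using g S assms(1) by (intro tri Lp_space_diff) auto
    also have "\<dots> \<le> C + Q n * Lp_norm M p (\<lambda>x. S (Suc n) x - g x)"
      using g S assms(1) by (intro add_mono C Q Lp_space_diff) auto
    also have "\<dots> \<le> C + Q n * (1/2 * (1/3)^n)"
      using gS Q(1)[of n] by (intro add_left_mono mult_left_mono) (auto intro: order_trans[rotated])
    finally have "2/5 * (Q n * (1/3)^n) \<le> C" by simp
    moreover have "3 ^ n * real (n + 1) * (1/3)^n \<le> Q n * (1/3)^n"
      using Q(1) by (intro mult_right_mono) auto
    moreover have "3 ^ n * real (n + 1) * (1/3)^n = real (n + 1)" by (simp add: power_divide)
    ultimately have "real (n + 1) \<le> Q n * (1/3)^n" by metis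
    then show ?thesis using \<open>2/5 * (Q n * (1/3)^n) \<le> C\<close> by argo
  qed
  from this[of "nat \<lceil>5/2 * C\<rceil>"] show False by (simp add: field_simps) linarith
qed

subsection \<open>Unconditional convergence bounds the finite partial sums\<close>

text \<open>Each interval is permuted within itself so that its chosen subset comes to the front. A
  rearranged series then has every \<open>E i\<close> as a block of consecutive terms.\<close>

lemma permute_blocks:
  fixes a :: "nat \<Rightarrow> nat" and E :: "nat \<Rightarrow> nat set"
  assumes "strict_mono a" "a 0 = 0" "\<And>i. E i \<subseteq> {a i..<a (Suc i)}"
  obtains \<pi> where "bij \<pi>" "\<And>i. \<pi> ` {a i..<a i + card (E i)} = E i"
proof -
  have fin: "finite (E i)" for i using assms(3) finite_subset by blast
  have aS: "a i < a (Suc i)" for i using assms(1) by (simp add: strict_mono_Suc_iff)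
  have cardE: "card (E i) \<le> a (Suc i) - a i" for i
    using card_mono[OF _ assms(3)[of i]] by simp
  have "\<exists>s. bij_betw s {a i..<a (Suc i)} {a i..<a (Suc i)} \<and> s ` {a i..<a i + card (E i)} = E i" for i
  proof -
    let ?I = "{a i..<a (Suc i)}" and ?A = "{a i..<a i + card (E i)}"
    have sub: "?A \<subseteq> ?I" using cardE[of i] aS[of i] by auto
    obtain s1 where s1: "bij_betw s1 ?A (E i)"
      using finite_same_card_bij[of ?A "E i"] fin by auto
    have "card (?I - ?A) = card (?I - E i)"
      using sub assms(3)[of i] fin by (simp add: card_Diff_subset)
    then obtain s2 where s2: "bij_betw s2 (?I - ?A) (?I - E i)"
      using finite_same_card_bij[of "?I - ?A" "?I - E i"] by auto
    define s where "s x = (if x \<in> ?A then s1 x else s2 x)" for x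
    have "bij_betw s ?A (E i)" using s1 by (rule bij_betw_cong[THEN iffD1, rotated]) (simp add: s_def)
    moreover have "bij_betw s (?I - ?A) (?I - E i)"
      using s2 by (rule bij_betw_cong[THEN iffD1, rotated]) (simp add: s_def)
    ultimately have "bij_betw s (?A \<union> (?I - ?A)) (E i \<union> (?I - E i))"
      by (rule bij_betw_combine) auto
    moreover have "?A \<union> (?I - ?A) = ?I" "E i \<union> (?I - E i) = ?I" using sub assms(3)[of i] by auto
    moreover have "s ` ?A = E i" using \<open>bij_betw s ?A (E i)\<close> by (simp add: bij_betw_def)
    ultimately show ?thesis by metis
  qed
  then obtain s where s: "\<And>i. bij_betw (s i) {a i..<a (Suc i)} {a i..<a (Suc i)}"
    "\<And>i. s i ` {a i..<a i + card (E i)} = E i" by metis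
  have disj: "i = j" if "x \<in> {a i..<a (Suc i)}" "x \<in> {a j..<a (Suc j)}" for i j x
  proof (rule ccontr)
    assume "i \<noteq> j"
    then consider "Suc i \<le> j" | "Suc j \<le> i" by linarith
    then show False
      using that strict_mono_less_eq[OF assms(1), of "Suc i" j] strict_mono_less_eq[OF assms(1), of "Suc j" i]
      by cases auto
  qed
  have cover: "\<exists>i. x \<in> {a i..<a (Suc i)}" for x
  proof (induction x)
    case 0
    then show ?case using aS[of 0] assms(2) by (intro exI[of _ 0]) auto
  next
    case (Suc x)
    then obtain i where "x \<in> {a i..<a (Suc i)}" by blast
    then show ?case
      using aS[of "Suc i"] by (cases "Suc x < a (Suc i)") (auto intro: exI[of _ i] exI[of _ "Suc i"])
  qed
  define \<pi> where "\<pi> x = s (THE i. x \<in> {a i..<a (Suc i)}) x" for x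
  have pi: "\<pi> x = s i x" if "x \<in> {a i..<a (Suc i)}" for x i
    unfolding \<pi>_def using the_equality[of "\<lambda>i. x \<in> {a i..<a (Suc i)}", OF that] disj[OF _ that] by metis
  have "bij_betw \<pi> (\<Union>i\<in>UNIV. {a i..<a (Suc i)}) (\<Union>i\<in>UNIV. {a i..<a (Suc i)})"
  proof (rule bij_betw_UNION_disjoint)
    show "disjoint_family_on (\<lambda>i. {a i..<a (Suc i)}) UNIV"
      unfolding disjoint_family_on_def using disj by blast
    show "bij_betw \<pi> {a i..<a (Suc i)} {a i..<a (Suc i)}" for i
      using s(1)[of i] by (rule bij_betw_cong[THEN iffD1, rotated]) (simp add: pi)
  qed
  moreover have "(\<Union>i\<in>UNIV. {a i..<a (Suc i)}) = UNIV" using cover by blast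
  ultimately have "bij \<pi>" by simp
  moreover have "\<pi> ` {a i..<a i + card (E i)} = E i" for i
  proof -
    have "\<pi> ` {a i..<a i + card (E i)} = s i ` {a i..<a i + card (E i)}"
      using cardE[of i] aS[of i] by (intro image_cong pi) auto
    then show ?thesis using s(2) by simp
  qed
  ultimately show thesis by (rule that)
qed

text \<open>The first m terms contribute a bounded amount to any finite sum. If finite sums were
  unbounded, finite sets of indices beyond any m would still give norm at least 1; a rearrangement
  that makes infinitely many of them consecutive is not Cauchy.\<close>

lemma converges_unconditionally_bounded:
  assumes "p \<ge> 1" "\<And>n. v n \<in> Lp_space M p"
    "converges_unconditionally (Lp_space M p) (Lp_norm M p) v"
  shows "\<exists>C. \<forall>F. finite F \<longrightarrow> Lp_norm M p (\<lambda>x. \<Sum>n\<in>F. v n x) \<le> C"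
proof (rule ccontr)
  assume neg: "\<not> ?thesis"
  have "\<exists>F. finite F \<and> F \<subseteq> {m..} \<and> Lp_norm M p (\<lambda>x. \<Sum>n\<in>F. v n x) \<ge> 1" for m :: nat
  proof -
    obtain F where F: "finite F" "Lp_norm M p (\<lambda>x. \<Sum>n\<in>F. v n x) > (\<Sum>n<m. Lp_norm M p (v n)) + 1"
      using neg by (metis not_le)
    have "(\<lambda>x. \<Sum>n\<in>F. v n x) = (\<lambda>x. (\<Sum>n\<in>F \<inter> {..<m}. v n x) + (\<Sum>n\<in>F - {..<m}. v n x))"
      using F(1) by (auto simp: sum.Int_Diff[of F _ "{..<m}"])
    then have "Lp_norm M p (\<lambda>x. \<Sum>n\<in>F. v n x) \<le> Lp_norm M p (\<lambda>x. \<Sum>n\<in>F \<inter> {..<m}. v n x)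
        + Lp_norm M p (\<lambda>x. \<Sum>n\<in>F - {..<m}. v n x)"
      using assms by (auto intro!: Lp_norm_triangle Lp_space_sum)
    also have "Lp_norm M p (\<lambda>x. \<Sum>n\<in>F \<inter> {..<m}. v n x) \<le> (\<Sum>n\<in>F \<inter> {..<m}. Lp_norm M p (v n))"
      using assms by (intro Lp_norm_sum) auto
    also have "\<dots> \<le> (\<Sum>n<m. Lp_norm M p (v n))" by (intro sum_mono2) auto
    finally show ?thesis using F by (intro exI[of _ "F - {..<m}"]) auto
  qed
  then obtain F where F: "\<And>m. finite (F m)" "\<And>m. F m \<subseteq> {m..}"
    "\<And>m. Lp_norm M p (\<lambda>x. \<Sum>n\<in>F m. v n x) \<ge> 1" by metis
  \<comment> \<open>The next interval starts beyond everything used by the set chosen at the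
    previous start.\<close>
  define a where "a = rec_nat 0 (\<lambda>_ m. Suc (Max (insert m (F m))))"
  have a: "a 0 = 0" "a (Suc i) = Suc (Max (insert (a i) (F (a i))))" for i by (auto simp: a_def)
  have "strict_mono a"
    unfolding strict_mono_Suc_iff a(2) using F(1) by (simp add: le_imp_less_Suc)
  moreover have "F (a i) \<subseteq> {a i..<a (Suc i)}" for i
    unfolding a(2) using F(1) F(2)[of "a i"] by (auto simp: subset_iff le_imp_less_Suc max.coboundedI2)
  ultimately obtain \<pi> where \<pi>: "bij \<pi>" "\<And>i. \<pi> ` {a i..<a i + card (F (a i))} = F (a i)"
    using permute_blocks[of a "\<lambda>i. F (a i)"] a(1) by blast
  obtain s where s: "s \<in> Lp_space M p" "sums_in (Lp_norm M p) (\<lambda>n. v (\<pi> n)) s"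
    using assms(3) \<pi>(1) unfolding converges_unconditionally_def by blast
  let ?S = "\<lambda>k x. (\<Sum>n<k. v (\<pi> n) x)"
  have "(\<lambda>k. Lp_norm M p (\<lambda>x. ?S k x - s x)) \<longlonglongrightarrow> 0"
    using s(2) unfolding sums_in_def .
  then have "eventually (\<lambda>k. Lp_norm M p (\<lambda>x. ?S k x - s x) < 1/2) sequentially"
    by (rule order_tendstoD) simp
  then obtain k0 where k0: "\<And>k. k \<ge> k0 \<Longrightarrow> Lp_norm M p (\<lambda>x. ?S k x - s x) < 1/2"
    unfolding eventually_sequentially by blast
  let ?b = "a k0" and ?c = "a k0 + card (F (a k0))"
  have bk: "?b \<ge> k0" using \<open>strict_mono a\<close> by (rule strict_mono_imp_increasing)
  have "(\<Sum>n\<in>F (a k0). v n x) = (?S ?c x - s x) - (?S ?b x - s x)" for x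
  proof -
    have "(\<Sum>n\<in>F (a k0). v n x) = (\<Sum>n\<in>\<pi> ` {?b..<?c}. v n x)" using \<pi>(2) by simp
    also have "\<dots> = (\<Sum>n\<in>{?b..<?c}. v (\<pi> n) x)"
      using bij_is_inj[OF \<pi>(1)] by (subst sum.reindex) (auto intro: inj_on_subset)
    also have "{?b..<?c} = {..<?c} - {..<?b}" by auto
    also have "(\<Sum>n\<in>{..<?c} - {..<?b}. v (\<pi> n) x) = ?S ?c x - ?S ?b x" by (subst sum_diff) auto
    finally show ?thesis by simp
  qed
  then have "Lp_norm M p (\<lambda>x. \<Sum>n\<in>F (a k0). v n x) \<le>
      Lp_norm M p (\<lambda>x. ?S ?c x - s x) + Lp_norm M p (\<lambda>x. ?S ?b x - s x)"
    using assms s(1) by (simp only:) (intro Lp_norm_triangle_diff Lp_space_diff Lp_space_sum; simp)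
  also have "\<dots> < 1" using k0[of ?c] k0[of ?b] bk by linarith
  finally show False using F(3)[of "a k0"] by linarith
qed

text \<open>Uniform boundedness for the seminorms that send f to the norm of a finite subset sum of
  its expansion; convergence of all rearrangements supplies the pointwise bounds.\<close>

lemma unconditional_Schauder_frame_bound:
  assumes "p \<ge> 1" "unconditional_Schauder_frame (Lp_space M p) (Lp_norm M p) g g'"
  shows "\<exists>K>0. \<forall>F f. finite F \<longrightarrow> f \<in> Lp_space M p \<longrightarrow>
    Lp_norm M p (\<lambda>x. \<Sum>n\<in>F. g' n f * g n x) \<le> K * Lp_norm M p f"
proof -
  have g: "g n \<in> Lp_space M p" "g' n \<in> dual_space (Lp_space M p) (Lp_norm M p)" for n
    using assms(2) unfolding unconditional_Schauder_frame_def by auto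
  have "\<exists>C. \<forall>f\<in>Lp_space M p. norm (g' n f) \<le> C * Lp_norm M p f" for n
    using g(2)[of n] unfolding dual_space_def by auto
  then obtain D where D: "\<And>n f. f \<in> Lp_space M p \<Longrightarrow> norm (g' n f) \<le> D n * Lp_norm M p f" by metis
  have add: "g' n (\<lambda>x. f x + h x) = g' n f + g' n h" if "f \<in> Lp_space M p" "h \<in> Lp_space M p" for n f h
    using g(2)[of n] that unfolding dual_space_def by auto
  have mult: "g' n (\<lambda>x. c * f x) = c * g' n f" if "f \<in> Lp_space M p" for n f c
    using g(2)[of n] that unfolding dual_space_def by auto
  define q where "q F f = Lp_norm M p (\<lambda>x. \<Sum>n\<in>F. g' n f * g n x)" for F f
  have mem: "(\<lambda>x. \<Sum>n\<in>F. g' n f * g n x) \<in> Lp_space M p" for F f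
    using assms g by (intro Lp_space_sum Lp_space_scale) auto
  have "\<exists>K>0. \<forall>F\<in>Collect finite. \<forall>f\<in>Lp_space M p. q F f \<le> K * Lp_norm M p f"
  proof -
    \<comment> \<open>The index of the uniform boundedness principle runs over a whole type, so
      infinite sets receive the zero seminorm.\<close>
    define Q where "Q F f = (if finite F then q F f else 0)" for F :: "nat set" and f
    have "\<exists>K>0. \<forall>F. \<forall>f\<in>Lp_space M p. Q F f \<le> K * Lp_norm M p f"
    proof (rule Lp_uniform_boundedness[OF assms(1), where B = "\<lambda>F. \<Sum>n\<in>F. D n * Lp_norm M p (g n)"])
      fix F and f h assume fh: "f \<in> Lp_space M p" "h \<in> Lp_space M p"
      have "(\<lambda>x. \<Sum>n\<in>F. g' n (\<lambda>x. f x + h x) * g n x)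
          = (\<lambda>x. (\<Sum>n\<in>F. g' n f * g n x) + (\<Sum>n\<in>F. g' n h * g n x))"
        using fh by (simp add: add sum.distrib distrib_right)
      then show "Q F (\<lambda>x. f x + h x) \<le> Q F f + Q F h"
        using Lp_norm_triangle[OF assms(1) mem mem, of f F h F] by (simp add: Q_def q_def)
    next
      fix F and f and c :: real assume f: "f \<in> Lp_space M p"
      have "(\<lambda>x. \<Sum>n\<in>F. g' n (\<lambda>x. complex_of_real c * f x) * g n x)
          = (\<lambda>x. complex_of_real c * (\<Sum>n\<in>F. g' n f * g n x))"
        using f by (simp add: mult sum_distrib_left mult.assoc)
      then show "Q F (\<lambda>x. complex_of_real c * f x) = \<bar>c\<bar> * Q F f"
        using assms(1) by (simp add: Q_def q_def Lp_norm_scale)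
    next
      fix F and f assume f: "f \<in> Lp_space M p"
      have "q F f \<le> (\<Sum>n\<in>F. Lp_norm M p (\<lambda>x. g' n f * g n x))"
        unfolding q_def using assms g by (intro Lp_norm_sum Lp_space_scale) auto
      also have "\<dots> = (\<Sum>n\<in>F. norm (g' n f) * Lp_norm M p (g n))"
        using assms(1) by (simp add: Lp_norm_scale)
      also have "\<dots> \<le> (\<Sum>n\<in>F. D n * Lp_norm M p f * Lp_norm M p (g n))"
        using D[OF f] by (intro sum_mono mult_right_mono) auto
      also have "\<dots> = (\<Sum>n\<in>F. D n * Lp_norm M p (g n)) * Lp_norm M p f"
        by (simp add: sum_distrib_right sum_distrib_left mult_ac)
      finally show "Q F f \<le> (\<Sum>n\<in>F. D n * Lp_norm M p (g n)) * Lp_norm M p f"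
        by (simp add: Q_def)
    next
      fix f assume f: "f \<in> Lp_space M p"
      have "converges_unconditionally (Lp_space M p) (Lp_norm M p) (\<lambda>n x. g' n f * g n x)"
        using assms(2) f unfolding unconditional_Schauder_frame_def by auto
      then obtain C where "\<forall>F. finite F \<longrightarrow> q F f \<le> C"
        unfolding q_def using converges_unconditionally_bounded[OF assms(1), of "\<lambda>n x. g' n f * g n x" M] g
        by (metis Lp_space_scale)
      then show "\<exists>C. \<forall>F. Q F f \<le> C" by (intro exI[of _ "max C 0"]) (auto simp: Q_def max.coboundedI1)
    qed
    then show ?thesis unfolding Q_def by (metis mem_Collect_eq)
  qed
  then show ?thesis unfolding q_def by auto
qed

subsection \<open>Type and cotype two by greedy choice of signs\<close>

text \<open>The linear term is exact because it has to cancel when t and -t are averaged. The factor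
  of t^2 is crude, but it is independent of t and survives the induction.\<close>

lemma power_one_plus_le:
  fixes t :: real
  assumes "\<bar>t\<bar> \<le> 1"
  shows "(1 + t) ^ k \<le> 1 + k * t + 4 ^ k * t\<^sup>2"
proof (induction k)
  case (Suc k)
  have t: "t * t\<^sup>2 \<le> t\<^sup>2" "-1 \<le> t" using assms mult_right_mono[of t 1 "t\<^sup>2"] by auto
  have "(1 + t) ^ Suc k \<le> (1 + t) * (1 + k * t + 4 ^ k * t\<^sup>2)"
    using Suc t by (simp add: mult_left_mono)
  also have "\<dots> = 1 + (k + 1) * t + (k + 4 ^ k) * t\<^sup>2 + 4 ^ k * (t * t\<^sup>2)"
    by (simp add: algebra_simps power2_eq_square)
  also have "\<dots> \<le> 1 + (k + 1) * t + (k + 4 ^ k) * t\<^sup>2 + 4 ^ k * t\<^sup>2"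
    using t by simp
  also have "\<dots> = 1 + (k + 1) * t + (k + 2 * 4 ^ k) * t\<^sup>2"
    by (simp add: algebra_simps)
  also have "\<dots> \<le> 1 + (k + 1) * t + 4 ^ Suc k * t\<^sup>2"
  proof -
    have "real k \<le> 2 ^ k" using of_nat_mono[OF less_imp_le[OF less_exp[of k]], where 'a = real] by simp
    also have "\<dots> \<le> 4 ^ k" by (intro power_mono) auto
    finally have "real k \<le> 2 * 4 ^ k" using zero_le_power[of "4::real" k] by linarith
    then show ?thesis by (intro add_left_mono mult_right_mono) auto
  qed
  finally show ?case by simp
qed simp

text \<open>Concavity of the power r / k replaces r by an integer k >= r, for which the linear terms
  of the two expansions cancel.\<close>

lemma two_point_powr_le:
  fixes r t :: real
  assumes "r \<ge> 1" "\<bar>t\<bar> \<le> 1" "r \<le> real k"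
  shows "((1 + t) powr r + (1 - t) powr r) / 2 \<le> (1 + 4 ^ k * t\<^sup>2) powr r"
proof -
  have k: "real k > 0" using assms by linarith
  define z :: "bool \<Rightarrow> real" where "z b = (if b then 1 + t else 1 - t)" for b
  have z0: "z b \<ge> 0" for b using assms by (auto simp: z_def)
  have zz: "(z b ^ k) powr (r / k) = z b powr r" for b
    using z0[of b] k assms by (cases "z b = 0") (auto simp: powr_powr powr_realpow[symmetric])
  have "(\<Sum>b\<in>UNIV. 1/2 * (z b ^ k) powr (r / k)) \<le> (\<Sum>b\<in>UNIV. 1/2 * z b ^ k) powr (r / k)"
    using assms k z0 by (intro sum_powr_concave) (auto simp: UNIV_bool)
  then have "((1 + t) powr r + (1 - t) powr r) / 2 \<le> (((1 + t) ^ k + (1 - t) ^ k) / 2) powr (r / k)"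
    unfolding zz by (simp add: UNIV_bool z_def add_divide_distrib add.commute)
  also have "\<dots> \<le> (1 + 4 ^ k * t\<^sup>2) powr (r / k)"
    using power_one_plus_le[of t k] power_one_plus_le[of "-t" k] assms k
    by (intro powr_mono2) auto
  also have "\<dots> \<le> (1 + 4 ^ k * t\<^sup>2) powr r"
    using assms k by (intro powr_mono) (auto simp: divide_le_eq intro: order_trans[of _ "r * 1"])
  finally show ?thesis .
qed

text \<open>With s = |x|^2 + |y|^2 and t = 2 <x, y> / s the squared norms of x + y and x - y are s
  (1 + t) and s (1 - t), and s t^2 <= 4 |y|^2 by Cauchy-Schwarz.\<close>

lemma complex_two_point:
  fixes x y :: complex
  assumes "r \<ge> 1" "r \<le> real k"
  shows "((norm (x + y))\<^sup>2 powr r + (norm (x - y))\<^sup>2 powr r) / 2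
     \<le> ((norm x)\<^sup>2 + (1 + 4 ^ (k + 1)) * (norm y)\<^sup>2) powr r"
proof (cases "x = 0 \<and> y = 0")
  case False
  define s where "s = (norm x)\<^sup>2 + (norm y)\<^sup>2"
  define w where "w = 2 * (x \<bullet> y)"
  define t where "t = w / s"
  have s: "s > 0" using False by (auto simp: s_def sum_power2_gt_zero_iff)
  have ws: "\<bar>w\<bar> \<le> 2 * (norm x * norm y)" unfolding w_def using Cauchy_Schwarz_ineq2[of x y] by simp
  also have "\<dots> \<le> s" unfolding s_def using sum_squares_bound[of "norm x" "norm y"] by simp
  finally have t: "\<bar>t\<bar> \<le> 1" using s by (simp add: t_def)
  have st0: "s * t = w" using s by (simp add: t_def)
  have p: "(norm (x + y))\<^sup>2 = s * (1 + t)" "(norm (x - y))\<^sup>2 = s * (1 - t)"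
    using st0 by (auto simp: distrib_left right_diff_distrib s_def w_def power2_norm_eq_inner
        inner_add_left inner_add_right inner_diff_left inner_diff_right inner_commute)
  have "s * t\<^sup>2 * s = w\<^sup>2" using s by (simp add: t_def power2_eq_square)
  also have "w\<^sup>2 \<le> (2 * (norm x * norm y))\<^sup>2" using ws by (metis abs_ge_zero power2_abs power_mono)
  also have "\<dots> = 4 * (norm x)\<^sup>2 * (norm y)\<^sup>2" by (simp add: power_mult_distrib)
  also have "\<dots> \<le> 4 * s * (norm y)\<^sup>2" by (intro mult_right_mono) (auto simp: s_def)
  finally have st: "s * t\<^sup>2 \<le> 4 * (norm y)\<^sup>2" using s by (simp add: mult_ac)
  have "((norm (x + y))\<^sup>2 powr r + (norm (x - y))\<^sup>2 powr r) / 2 = s powr r * (((1 + t) powr r + (1 - t) powr r) / 2)"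
    unfolding p powr_mult by (simp add: distrib_left)
  also have "\<dots> \<le> s powr r * (1 + 4 ^ k * t\<^sup>2) powr r"
    using two_point_powr_le[OF assms(1) t assms(2)] by (intro mult_left_mono) auto
  also have "\<dots> = (s + 4 ^ k * (s * t\<^sup>2)) powr r"
    using s by (subst powr_mult[symmetric]) (auto simp: algebra_simps)
  also have "\<dots> \<le> (s + 4 ^ k * (4 * (norm y)\<^sup>2)) powr r"
    using st s assms by (intro powr_mono2 add_left_mono mult_left_mono) auto
  also have "s + 4 ^ k * (4 * (norm y)\<^sup>2) = (norm x)\<^sup>2 + (1 + 4 ^ (k + 1)) * (norm y)\<^sup>2"
    by (simp add: s_def algebra_simps)
  finally show ?thesis .
qed simp

text \<open>This is 2-uniform smoothness of L^p. The pointwise inequality is integrated for squared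
  moduli, which lie in L^(p/2); since p / 2 >= 1, Minkowski's inequality there separates f from g,
  and the mean of two squares is at most the corresponding power mean of order p.\<close>

lemma Lp_norm_square_two_smooth:
  assumes "p \<ge> 2"
  shows "\<exists>D>0. \<forall>f\<in>Lp_space M p. \<forall>g\<in>Lp_space M p.
    ((Lp_norm M p (\<lambda>x. f x + g x))\<^sup>2 + (Lp_norm M p (\<lambda>x. f x - g x))\<^sup>2) / 2
      \<le> (Lp_norm M p f)\<^sup>2 + D * (Lp_norm M p g)\<^sup>2"
proof -
  define r where "r = p / 2"
  define k where "k = nat \<lceil>r\<rceil>"
  define D :: real where "D = 1 + 4 ^ (k + 1)"
  have r: "r \<ge> 1" "r \<le> real k" using assms by (auto simp: r_def k_def real_nat_ceiling_ge)
  have D: "D > 0" by (simp add: D_def add_pos_pos)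
  have sq: "(norm z)\<^sup>2 powr r = norm z powr p" for z :: complex
  proof -
    have "(norm z)\<^sup>2 = norm z powr 2" by simp
    then show ?thesis by (simp only: powr_powr) (simp add: r_def)
  qed
  have sqLp: "(\<lambda>x. complex_of_real ((norm (h x))\<^sup>2)) \<in> Lp_space M r"
    and sqN: "Lp_norm M r (\<lambda>x. complex_of_real ((norm (h x))\<^sup>2)) = (Lp_norm M p h)\<^sup>2"
    if h: "h \<in> Lp_space M p" for h
  proof -
    note [measurable] = Lp_spaceD(1)[OF h]
    show "(\<lambda>x. complex_of_real ((norm (h x))\<^sup>2)) \<in> Lp_space M r"
      using Lp_spaceD(2)[OF h] by (intro Lp_spaceI) (simp_all add: norm_power sq)
    have "Lp_norm M r (\<lambda>x. complex_of_real ((norm (h x))\<^sup>2)) = (LINT x|M. norm (h x) powr p) powr (2 / p)"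
      unfolding Lp_norm_def by (simp add: norm_power sq) (simp add: r_def)
    also have "\<dots> = (Lp_norm M p h) powr 2"
      using assms unfolding Lp_norm_def by (simp add: powr_powr)
    finally show "Lp_norm M r (\<lambda>x. complex_of_real ((norm (h x))\<^sup>2)) = (Lp_norm M p h)\<^sup>2"
      by simp
  qed
  have "((Lp_norm M p (\<lambda>x. f x + g x))\<^sup>2 + (Lp_norm M p (\<lambda>x. f x - g x))\<^sup>2) / 2
      \<le> (Lp_norm M p f)\<^sup>2 + D * (Lp_norm M p g)\<^sup>2" if f: "f \<in> Lp_space M p" and g: "g \<in> Lp_space M p" for f g
  proof -
    let ?a = "Lp_norm M p (\<lambda>x. f x + g x)" and ?b = "Lp_norm M p (\<lambda>x. f x - g x)"
    let ?h = "\<lambda>x. complex_of_real ((norm (f x))\<^sup>2) + complex_of_real D * complex_of_real ((norm (g x))\<^sup>2)"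
    have fg: "(\<lambda>x. f x + g x) \<in> Lp_space M p" "(\<lambda>x. f x - g x) \<in> Lp_space M p"
      using f g assms by (auto intro: Lp_space_add Lp_space_diff)
    have h: "?h \<in> Lp_space M r" using r sqLp f g by (intro Lp_space_add Lp_space_scale) auto
    have hn: "norm (?h x) = (norm (f x))\<^sup>2 + D * (norm (g x))\<^sup>2" for x
    proof -
      have "?h x = complex_of_real ((norm (f x))\<^sup>2 + D * (norm (g x))\<^sup>2)" by simp
      then show ?thesis using D by (simp only: norm_of_real) simp
    qed
    have "Lp_norm M r ?h \<le> Lp_norm M r (\<lambda>x. complex_of_real ((norm (f x))\<^sup>2))
        + Lp_norm M r (\<lambda>x. complex_of_real D * complex_of_real ((norm (g x))\<^sup>2))"
      using r sqLp f g by (intro Lp_norm_triangle Lp_space_scale) auto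
    also have "\<dots> = (Lp_norm M p f)\<^sup>2 + D * (Lp_norm M p g)\<^sup>2"
      using r D f g by (simp add: Lp_norm_scale sqN del: of_real_power)
    finally have hN: "Lp_norm M r ?h \<le> (Lp_norm M p f)\<^sup>2 + D * (Lp_norm M p g)\<^sup>2" .
    have ab: "(?a powr p + ?b powr p) / 2 \<le> Lp_norm M r ?h powr r"
    proof -
      have "(?a powr p + ?b powr p) / 2 = (LINT x|M. (norm (f x + g x) powr p + norm (f x - g x) powr p) / 2)"
        using assms Lp_spaceD(2)[OF fg(1)] Lp_spaceD(2)[OF fg(2)] by (simp add: Lp_norm_powr)
      also have "\<dots> \<le> (LINT x|M. norm (?h x) powr r)"
      proof (rule integral_mono)
        show "(norm (f x + g x) powr p + norm (f x - g x) powr p) / 2 \<le> norm (?h x) powr r" for x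
          using complex_two_point[OF r, of "f x" "g x"] unfolding D_def[symmetric] sq hn .
      qed (use Lp_spaceD(2)[OF fg(1)] Lp_spaceD(2)[OF fg(2)] Lp_spaceD(2)[OF h] in auto)
      also have "\<dots> = Lp_norm M r ?h powr r" using r by (simp add: Lp_norm_powr)
      finally show ?thesis .
    qed
    define z where "z i = (if i then ?a else ?b)" for i
    have z: "(z i powr p) powr (1 / r) = (z i)\<^sup>2" for i
      using assms by (simp add: powr_powr r_def z_def)
    have "(\<Sum>i\<in>UNIV. 1/2 * (z i powr p) powr (1 / r)) \<le> (\<Sum>i\<in>UNIV. 1/2 * (z i powr p)) powr (1 / r)"
      using r by (intro sum_powr_concave) (auto simp: UNIV_bool)
    then have "(?a\<^sup>2 + ?b\<^sup>2) / 2 \<le> ((?a powr p + ?b powr p) / 2) powr (1 / r)"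
      unfolding z by (simp add: UNIV_bool z_def add_divide_distrib add.commute)
    also have "\<dots> \<le> (Lp_norm M r ?h powr r) powr (1 / r)"
      using ab r by (intro powr_mono2) auto
    also have "\<dots> = Lp_norm M r ?h" using r by (simp add: powr_powr)
    finally show ?thesis using hN by simp
  qed
  then show ?thesis using D by blast
qed

lemma sign_choice_extend:
  fixes \<epsilon> :: "nat \<Rightarrow> real"
  assumes "k \<notin> F"
  shows "(\<Sum>n\<in>F. f ((\<epsilon>(k := s)) n) n) = (\<Sum>n\<in>F. f (\<epsilon> n) n)"
  using assms by (intro sum.cong) auto

text \<open>The potential \<open>Re (L\<^sub>\<epsilon> V\<^sub>\<epsilon>) - l \<parallel>V\<^sub>\<epsilon>\<parallel>\<^sup>2\<close> does not decrease on average over the sign of a new term, because the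
  terms that are odd in this sign cancel.\<close>

lemma greedy_signs_potential:
  fixes \<phi> :: "nat \<Rightarrow> ('a \<Rightarrow> complex) \<Rightarrow> complex" and a :: "nat \<Rightarrow> complex"
    and f :: "nat \<Rightarrow> 'a \<Rightarrow> complex"
  assumes "p \<ge> 1" "finite F" "l \<ge> 0"
    and D: "\<And>f g. f \<in> Lp_space M p \<Longrightarrow> g \<in> Lp_space M p \<Longrightarrow>
      ((Lp_norm M p (\<lambda>x. f x + g x))\<^sup>2 + (Lp_norm M p (\<lambda>x. f x - g x))\<^sup>2) / 2
        \<le> (Lp_norm M p f)\<^sup>2 + D * (Lp_norm M p g)\<^sup>2"
    and \<phi>: "\<And>n. \<phi> n \<in> dual_space (Lp_space M p) (Lp_norm M p)"
    and f: "\<And>n. f n \<in> Lp_space M p"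
  shows "\<exists>\<epsilon> :: nat \<Rightarrow> real. (\<forall>n. \<bar>\<epsilon> n\<bar> = (1::real)) \<and>
    (\<Sum>n\<in>F. Re (a n * \<phi> n (f n)) - l * D * (Lp_norm M p (f n))\<^sup>2)
      \<le> Re (\<Sum>n\<in>F. \<epsilon> n * a n * \<phi> n (\<lambda>x. \<Sum>m\<in>F. \<epsilon> m * f m x))
        - l * (Lp_norm M p (\<lambda>x. \<Sum>m\<in>F. \<epsilon> m * f m x))\<^sup>2"
  using assms(2)
proof (induction F)
  case empty
  then show ?case by (intro exI[of _ "\<lambda>_. 1"]) simp
next
  case (insert k F)
  have add: "\<phi> n (\<lambda>x. u x + v x) = \<phi> n u + \<phi> n v" if "u \<in> Lp_space M p" "v \<in> Lp_space M p" for n u v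
    using \<phi>[of n] that unfolding dual_space_def by auto
  have mult: "\<phi> n (\<lambda>x. c * u x) = c * \<phi> n u" if "u \<in> Lp_space M p" for n u c
    using \<phi>[of n] that unfolding dual_space_def by auto
  obtain \<epsilon> :: "nat \<Rightarrow> real" where \<epsilon>: "\<And>n. \<bar>\<epsilon> n\<bar> = (1::real)"
    and IH: "(\<Sum>n\<in>F. Re (a n * \<phi> n (f n)) - l * D * (Lp_norm M p (f n))\<^sup>2)
      \<le> Re (\<Sum>n\<in>F. \<epsilon> n * a n * \<phi> n (\<lambda>x. \<Sum>m\<in>F. \<epsilon> m * f m x))
        - l * (Lp_norm M p (\<lambda>x. \<Sum>m\<in>F. \<epsilon> m * f m x))\<^sup>2"
    using insert by blast
  define V where "V x = (\<Sum>m\<in>F. \<epsilon> m * f m x)" for x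
  have V: "V \<in> Lp_space M p" unfolding V_def using assms(1) f by (intro Lp_space_sum Lp_space_scale) auto
  \<comment> \<open>After \<open>f k\<close> is added with sign s, \<open>A\<close> is the old
    pairing and \<open>B\<close>, \<open>C\<close> are the cross terms, each with one factor s; the
    diagonal term carries s^2 = 1.\<close>
  define A where "A = (\<Sum>n\<in>F. \<epsilon> n * a n * \<phi> n V)"
  define B where "B = (\<Sum>n\<in>F. \<epsilon> n * a n * \<phi> n (f k))"
  define C where "C = a k * \<phi> k V"
  let ?P = "\<lambda>\<epsilon>. Re (\<Sum>n\<in>insert k F. complex_of_real (\<epsilon> n) * a n * \<phi> n (\<lambda>x. \<Sum>m\<in>insert k F. \<epsilon> m * f m x))
        - l * (Lp_norm M p (\<lambda>x. \<Sum>m\<in>insert k F. complex_of_real (\<epsilon> m) * f m x))\<^sup>2"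
  have avg: "x \<le> u \<or> x \<le> v" if "x \<le> (u + v) / 2" for x u v :: real
    using that by auto
  have step: "?P (\<epsilon>(k := s)) = Re (A + a k * \<phi> k (f k)) + s * Re (B + C)
      - l * (Lp_norm M p (\<lambda>x. V x + complex_of_real s * f k x))\<^sup>2" if s: "\<bar>s\<bar> = 1" for s :: real
  proof -
    have V': "(\<lambda>x. \<Sum>m\<in>insert k F. complex_of_real ((\<epsilon>(k := s)) m) * f m x) = (\<lambda>x. V x + complex_of_real s * f k x)"
      using insert(1,2) sign_choice_extend[OF insert(2), of "\<lambda>e m. complex_of_real e * f m _" \<epsilon> s]
      by (simp add: V_def fun_eq_iff add.commute)
    have ph: "\<phi> n (\<lambda>x. V x + complex_of_real s * f k x) = \<phi> n V + s * \<phi> n (f k)" for n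
      using V f by (simp add: add mult Lp_space_scale)
    have ss: "complex_of_real s * complex_of_real s = 1"
      using s by (metis abs_mult_self_eq mult.right_neutral of_real_1 of_real_mult)
    have "(\<Sum>n\<in>insert k F. complex_of_real ((\<epsilon>(k := s)) n) * a n * \<phi> n (\<lambda>x. V x + complex_of_real s * f k x))
       = s * a k * (\<phi> k V + s * \<phi> k (f k)) + (\<Sum>n\<in>F. \<epsilon> n * a n * (\<phi> n V + s * \<phi> n (f k)))"
      using insert(1,2) sign_choice_extend[OF insert(2), of "\<lambda>e n. complex_of_real e * a n * (\<phi> n V + s * \<phi> n (f k))" \<epsilon> s]
      unfolding ph by simp
    also have "\<dots> = A + a k * \<phi> k (f k) + s * (B + C)"
      using ss by (simp add: A_def B_def C_def algebra_simps sum.distrib sum_distrib_left)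
    finally show ?thesis unfolding V' by simp
  qed
  have "(\<Sum>n\<in>insert k F. Re (a n * \<phi> n (f n)) - l * D * (Lp_norm M p (f n))\<^sup>2)
     \<le> Re A - l * (Lp_norm M p V)\<^sup>2 + Re (a k * \<phi> k (f k)) - l * D * (Lp_norm M p (f k))\<^sup>2"
    using IH insert(1,2) unfolding A_def V_def by simp
  also have "\<dots> \<le> Re A + Re (a k * \<phi> k (f k))
     - l * (((Lp_norm M p (\<lambda>x. V x + f k x))\<^sup>2 + (Lp_norm M p (\<lambda>x. V x - f k x))\<^sup>2) / 2)"
    using mult_left_mono[OF D[OF V f[of k]] assms(3)] by (simp add: algebra_simps)
  also have "\<dots> = (?P (\<epsilon>(k := 1)) + ?P (\<epsilon>(k := -1))) / 2"
  proof -
    have "?P (\<epsilon>(k := 1)) = Re (A + a k * \<phi> k (f k)) + 1 * Re (B + C)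
        - l * (Lp_norm M p (\<lambda>x. V x + complex_of_real 1 * f k x))\<^sup>2"
      by (rule step) simp
    moreover have "?P (\<epsilon>(k := -1)) = Re (A + a k * \<phi> k (f k)) + (-1) * Re (B + C)
        - l * (Lp_norm M p (\<lambda>x. V x + complex_of_real (-1) * f k x))\<^sup>2"
      by (rule step) simp
    ultimately show ?thesis by (simp only:) (simp add: algebra_simps)
  qed
  finally have "(\<Sum>n\<in>insert k F. Re (a n * \<phi> n (f n)) - l * D * (Lp_norm M p (f n))\<^sup>2) \<le> ?P (\<epsilon>(k := 1)) \<or>
    (\<Sum>n\<in>insert k F. Re (a n * \<phi> n (f n)) - l * D * (Lp_norm M p (f n))\<^sup>2) \<le> ?P (\<epsilon>(k := -1))"
    by (rule avg)
  then obtain s where s: "s = 1 \<or> s = -1"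
    "(\<Sum>n\<in>insert k F. Re (a n * \<phi> n (f n)) - l * D * (Lp_norm M p (f n))\<^sup>2) \<le> ?P (\<epsilon>(k := s))"
    by blast
  show ?case using s(1) \<epsilon> by (intro exI[of _ "\<epsilon>(k := s)"] conjI s(2)) auto
qed

text \<open>The signed combination of functionals is tested on a vector with the same signs, built
  from multiples \<open>h n\<close> of the nearly norming \<open>f n\<close> with a_n \<phi>_n(h_n)
  = |a_n|^2. The penalty l times the squared norm in the greedy potential is paid for by
  2-smoothness.\<close>

lemma dual_cotype_two:
  assumes "p \<ge> 2" "A > 0"
  obtains C where "C > 0" "\<And>F \<phi> f (a :: nat \<Rightarrow> complex) K.
      finite F \<Longrightarrow> K \<ge> 0 \<Longrightarrow> (\<And>n. \<phi> n \<in> dual_space (Lp_space M p) (Lp_norm M p)) \<Longrightarrow>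
      (\<And>n. f n \<in> Lp_space M p) \<Longrightarrow> (\<And>n. Lp_norm M p (f n) \<le> 1) \<Longrightarrow> (\<And>n. A \<le> norm (\<phi> n (f n))) \<Longrightarrow>
      (\<And>\<epsilon> h. h \<in> Lp_space M p \<Longrightarrow> (\<And>n. \<bar>\<epsilon> n\<bar> = (1::real)) \<Longrightarrow>
         norm (\<Sum>n\<in>F. \<epsilon> n * a n * \<phi> n h) \<le> K * Lp_norm M p h) \<Longrightarrow>
      (\<Sum>n\<in>F. (norm (a n))\<^sup>2) \<le> C * K\<^sup>2"
proof -
  obtain D where D: "D > 0" "\<And>f g. f \<in> Lp_space M p \<Longrightarrow> g \<in> Lp_space M p \<Longrightarrow>
      ((Lp_norm M p (\<lambda>x. f x + g x))\<^sup>2 + (Lp_norm M p (\<lambda>x. f x - g x))\<^sup>2) / 2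
        \<le> (Lp_norm M p f)\<^sup>2 + D * (Lp_norm M p g)\<^sup>2"
    using Lp_norm_square_two_smooth[OF assms(1), of M] by auto
  have p1: "p \<ge> 1" using assms(1) by simp
  \<comment> \<open>The value for which the penalty l D (|a| / A)^2 takes exactly half of the gain
    |a|^2.\<close>
  define l where "l = A\<^sup>2 / (2 * D)"
  have l: "l > 0" using D assms by (simp add: l_def)
  have bound: "(\<Sum>n\<in>F. (norm (a n))\<^sup>2) \<le> (1 / (2 * l)) * K\<^sup>2"
    if F: "finite F" and K: "K \<ge> 0" and \<phi>: "\<And>n. \<phi> n \<in> dual_space (Lp_space M p) (Lp_norm M p)"
      and f: "\<And>n. f n \<in> Lp_space M p" "\<And>n. Lp_norm M p (f n) \<le> 1" "\<And>n. A \<le> norm (\<phi> n (f n))"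
      and bd: "\<And>\<epsilon> h. h \<in> Lp_space M p \<Longrightarrow> (\<And>n. \<bar>\<epsilon> n\<bar> = (1::real)) \<Longrightarrow>
         norm (\<Sum>n\<in>F. \<epsilon> n * a n * \<phi> n h) \<le> K * Lp_norm M p h"
    for F :: "nat set" and \<phi> f and a :: "nat \<Rightarrow> complex" and K
  proof -
    define b where "b n = cnj (a n) / \<phi> n (f n)" for n
    have ph0: "\<phi> n (f n) \<noteq> 0" for n using f(3)[of n] assms(2) by auto
    define h where "h n = (\<lambda>x. b n * f n x)" for n
    have h: "h n \<in> Lp_space M p" for n unfolding h_def using f by (intro Lp_space_scale)
    have ah: "a n * \<phi> n (h n) = complex_of_real ((norm (a n))\<^sup>2)" for n
    proof -
      have "\<phi> n (h n) = b n * \<phi> n (f n)" using \<phi>[of n] f(1) unfolding dual_space_def h_def by auto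
      then show ?thesis using ph0[of n] complex_norm_square[of "a n"] by (simp add: b_def)
    qed
    have hN: "Lp_norm M p (h n) \<le> norm (a n) / A" for n
    proof -
      have "Lp_norm M p (h n) = norm (b n) * Lp_norm M p (f n)" unfolding h_def using assms by (simp add: Lp_norm_scale)
      also have "\<dots> \<le> norm (b n) * 1" using f by (intro mult_left_mono) auto
      also have "\<dots> \<le> norm (a n) / A"
        unfolding b_def using f(3)[of n] assms(2) by (simp add: norm_divide frac_le)
      finally show ?thesis .
    qed
    have "\<exists>\<epsilon> :: nat \<Rightarrow> real. (\<forall>n. \<bar>\<epsilon> n\<bar> = (1::real)) \<and>
      (\<Sum>n\<in>F. Re (a n * \<phi> n (h n)) - l * D * (Lp_norm M p (h n))\<^sup>2)
      \<le> Re (\<Sum>n\<in>F. \<epsilon> n * a n * \<phi> n (\<lambda>x. \<Sum>m\<in>F. \<epsilon> m * h m x))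
        - l * (Lp_norm M p (\<lambda>x. \<Sum>m\<in>F. \<epsilon> m * h m x))\<^sup>2"
      by (rule greedy_signs_potential[OF p1 F less_imp_le[OF l]]; fact D(2) \<phi> h)
    then obtain \<epsilon> :: "nat \<Rightarrow> real" where \<epsilon>: "\<And>n. \<bar>\<epsilon> n\<bar> = (1::real)"
      and *: "(\<Sum>n\<in>F. Re (a n * \<phi> n (h n)) - l * D * (Lp_norm M p (h n))\<^sup>2)
      \<le> Re (\<Sum>n\<in>F. \<epsilon> n * a n * \<phi> n (\<lambda>x. \<Sum>m\<in>F. \<epsilon> m * h m x))
        - l * (Lp_norm M p (\<lambda>x. \<Sum>m\<in>F. \<epsilon> m * h m x))\<^sup>2"
      by blast
    let ?V = "\<lambda>x. \<Sum>m\<in>F. \<epsilon> m * h m x"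
    define N where "N = Lp_norm M p ?V"
    have V: "?V \<in> Lp_space M p" using assms(1) h by (intro Lp_space_sum Lp_space_scale) auto
    have "(\<Sum>n\<in>F. (norm (a n))\<^sup>2) / 2 = (\<Sum>n\<in>F. (norm (a n))\<^sup>2 - l * D * (norm (a n) / A)\<^sup>2)"
      using assms(2) D(1) by (simp add: l_def power_divide sum_divide_distrib)
    also have "\<dots> \<le> (\<Sum>n\<in>F. Re (a n * \<phi> n (h n)) - l * D * (Lp_norm M p (h n))\<^sup>2)"
      using hN l D(1) unfolding ah by (intro sum_mono diff_mono mult_left_mono power_mono) auto
    also have "\<dots> \<le> K * N - l * N\<^sup>2"
      using * order_trans[OF complex_Re_le_cmod bd[OF V, of \<epsilon>, OF \<epsilon>]] unfolding N_def by linarith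
    \<comment> \<open>The maximum over all real N of the preceding quadratic.\<close>
    also have "\<dots> \<le> K\<^sup>2 / (4 * l)"
    proof -
      have "0 \<le> (2 * l * N - K)\<^sup>2" by simp
      then have "4 * l * (K * N - l * N\<^sup>2) \<le> K\<^sup>2" by (simp add: power2_eq_square algebra_simps)
      then show ?thesis using l by (simp add: pos_le_divide_eq mult.commute)
    qed
    finally show ?thesis by simp
  qed
  show thesis
  proof (rule that[of "1 / (2 * l)"])
    show "1 / (2 * l) > 0" using l by simp
  next
    fix F \<phi> f and a :: "nat \<Rightarrow> complex" and K
    assume "finite F" "K \<ge> 0" "\<And>n. \<phi> n \<in> dual_space (Lp_space M p) (Lp_norm M p)"
      "\<And>n. f n \<in> Lp_space M p" "\<And>n. Lp_norm M p (f n) \<le> 1" "\<And>n. A \<le> norm (\<phi> n (f n))"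
      "\<And>\<epsilon> h. h \<in> Lp_space M p \<Longrightarrow> (\<And>n. \<bar>\<epsilon> n\<bar> = (1::real)) \<Longrightarrow>
         norm (\<Sum>n\<in>F. \<epsilon> n * a n * \<phi> n h) \<le> K * Lp_norm M p h"
    show "(\<Sum>n\<in>F. (norm (a n))\<^sup>2) \<le> 1 / (2 * l) * K\<^sup>2"
      by (rule bound[where \<phi> = \<phi> and f = f]; fact)
  qed
qed

text \<open>If q grows by at least c on average over the two signs, one sign achieves it. This is
  used for the squared L^2 norm of functions and for the square sum of finitely many coefficients,
  where the parallelogram law provides the hypothesis.\<close>

lemma greedy_signs:
  fixes v :: "nat \<Rightarrow> 'b \<Rightarrow> complex" and q :: "('b \<Rightarrow> complex) \<Rightarrow> real"
  assumes "finite F" "(\<lambda>x. 0) \<in> X" "q (\<lambda>x. 0) \<ge> 0"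
    and X: "\<And>y n s. y \<in> X \<Longrightarrow> n \<in> F \<Longrightarrow> \<bar>s\<bar> = 1 \<Longrightarrow> (\<lambda>x. y x + complex_of_real s * v n x) \<in> X"
    and q: "\<And>y n. y \<in> X \<Longrightarrow> n \<in> F \<Longrightarrow> 2 * (q y + c n) \<le> q (\<lambda>x. y x + v n x) + q (\<lambda>x. y x - v n x)"
  shows "\<exists>\<epsilon> :: nat \<Rightarrow> real. (\<forall>n. \<bar>\<epsilon> n\<bar> = (1::real)) \<and> (\<lambda>x. \<Sum>n\<in>F. \<epsilon> n * v n x) \<in> X
     \<and> (\<Sum>n\<in>F. c n) \<le> q (\<lambda>x. \<Sum>n\<in>F. \<epsilon> n * v n x)"
  using assms(1,4,5)
proof (induction F)
  case empty
  then show ?case using assms(2,3) by (intro exI[of _ "\<lambda>_. 1"]) simp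
next
  case (insert k F)
  from insert(3)[OF insert(4,5)] obtain \<epsilon> :: "nat \<Rightarrow> real" where \<epsilon>: "\<And>n. \<bar>\<epsilon> n\<bar> = (1::real)"
    and mem: "(\<lambda>x. \<Sum>n\<in>F. \<epsilon> n * v n x) \<in> X"
    and le: "(\<Sum>n\<in>F. c n) \<le> q (\<lambda>x. \<Sum>n\<in>F. \<epsilon> n * v n x)" by auto
  define y where "y = (\<lambda>x. \<Sum>n\<in>F. \<epsilon> n * v n x)"
  have "2 * (q y + c k) \<le> q (\<lambda>x. y x + v k x) + q (\<lambda>x. y x - v k x)"
    using insert(5)[of y k] mem by (auto simp: y_def)
  moreover have "(\<Sum>n\<in>insert k F. c n) = c k + sum c F" "sum c F \<le> q y" using le insert(1,2) by (simp_all add: y_def)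
  ultimately have "(\<Sum>n\<in>insert k F. c n) \<le> q (\<lambda>x. y x + v k x) \<or> (\<Sum>n\<in>insert k F. c n) \<le> q (\<lambda>x. y x - v k x)"
    by argo
  then have "(\<Sum>n\<in>insert k F. c n) \<le> q (\<lambda>x. y x + complex_of_real 1 * v k x) \<or>
      (\<Sum>n\<in>insert k F. c n) \<le> q (\<lambda>x. y x + complex_of_real (-1) * v k x)"
    by simp
  then obtain s :: real where s: "s = 1 \<or> s = -1" "(\<Sum>n\<in>insert k F. c n) \<le> q (\<lambda>x. y x + complex_of_real s * v k x)"
    by metis
  have V: "(\<lambda>x. \<Sum>m\<in>insert k F. complex_of_real ((\<epsilon>(k := s)) m) * v m x) = (\<lambda>x. y x + complex_of_real s * v k x)"
    using insert(1,2) sign_choice_extend[OF insert(2), of "\<lambda>e m. complex_of_real e * v m _" \<epsilon> s]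
    by (simp add: y_def fun_eq_iff add.commute)
  show ?case
    using s \<epsilon> insert(4)[of y k s] mem unfolding V[symmetric] y_def[symmetric]
    by (intro exI[of _ "\<epsilon>(k := s)"]) (auto simp del: of_real_eq_iff)
qed

subsection \<open>Exponents above two\<close>

lemma dual_space_sum:
  assumes "p \<ge> 0" "\<phi> \<in> dual_space (Lp_space M p) N" "\<And>j. j \<in> F \<Longrightarrow> f j \<in> Lp_space M p" "finite F"
  shows "\<phi> (\<lambda>x. \<Sum>j\<in>F. c j * f j x) = (\<Sum>j\<in>F. c j * \<phi> (f j))"
  using assms(4,3)
proof (induction F)
  case empty
  have "\<phi> (\<lambda>x. c * h x) = c * \<phi> h" if "h \<in> Lp_space M p" for c h
    using assms(2) that unfolding dual_space_def by auto
  from this[of "\<lambda>x. 0" 0] show ?case by simp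
next
  case (insert k F)
  have "\<phi> (\<lambda>x. c k * f k x + (\<Sum>j\<in>F. c j * f j x)) = \<phi> (\<lambda>x. c k * f k x) + \<phi> (\<lambda>x. \<Sum>j\<in>F. c j * f j x)"
  proof -
    have "(\<lambda>x. c k * f k x) \<in> Lp_space M p" "(\<lambda>x. \<Sum>j\<in>F. c j * f j x) \<in> Lp_space M p"
      using insert assms(1) by (auto intro!: Lp_space_sum Lp_space_scale)
    moreover have "\<phi> (\<lambda>x. u x + v x) = \<phi> u + \<phi> v" if "u \<in> Lp_space M p" "v \<in> Lp_space M p" for u v
      using assms(2) that unfolding dual_space_def by auto
    ultimately show ?thesis by blast
  qed
  moreover have "\<phi> (\<lambda>x. c k * f k x) = c k * \<phi> (f k)"
    using assms(2) insert unfolding dual_space_def by auto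
  ultimately show ?case using insert by simp
qed

lemma powr_le_powrD:
  fixes a b p :: real
  assumes "a powr p \<le> b powr p" "p > 0" "b \<ge> 0"
  shows "a \<le> b"
  using powr_less_mono2[of p b a] assms by force

lemma norm_integral_le_Lp_norm:
  assumes "finite_measure M" "E \<in> sets M" "f \<in> Lp_space M p" "p \<ge> 1"
  shows "norm (LINT x|M. indicator E x * f x) \<le> measure M E powr (1 - 1 / p) * Lp_norm M p f"
proof -
  have int: "integrable M (\<lambda>x. norm (f x) powr p)" using Lp_spaceD[OF assms(3)] by simp
  have "norm (LINT x|M. indicator E x * f x) powr p \<le> measure M E powr (p - 1) * (LINT x|M. indicator E x * norm (f x) powr p)"
    by (rule norm_integral_indicator_le[OF assms])
  also have "\<dots> \<le> measure M E powr (p - 1) * (LINT x|M. norm (f x) powr p)"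
    using int integrable_mult_indicator[OF assms(2) int]
    by (intro mult_left_mono integral_mono) (auto simp: indicator_def)
  also have "\<dots> = (measure M E powr (1 - 1 / p) * Lp_norm M p f) powr p"
    using assms(4) by (simp add: powr_mult powr_powr Lp_norm_powr left_diff_distrib)
  finally show ?thesis by (rule powr_le_powrD) (use assms(4) in auto)
qed

lemma integral_indicator_complex:
  assumes "E \<in> sets M"
  shows "(LINT x|M. (indicator E x :: complex)) = measure M E"
proof -
  have "(LINT x|M. (indicator E x :: complex)) = (LINT x|M. complex_of_real (indicator E x))"
    by (intro Bochner_Integration.integral_cong) (auto simp: indicator_def)
  also have "\<dots> = complex_of_real (LINT x|M. indicator E x)" by (rule integral_complex_of_real)
  also have "(LINT x|M. indicat_real E x) = measure M E"
    using assms sets.sets_into_space[OF assms] by (simp add: Int_absorb2)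
  finally show ?thesis .
qed

lemma norm_parallelogram_complex:
  fixes x y :: complex
  shows "(norm (x + y))\<^sup>2 + (norm (x - y))\<^sup>2 = 2 * ((norm x)\<^sup>2 + (norm y)\<^sup>2)"
  unfolding power2_norm_eq_inner
  by (simp add: inner_add_left inner_add_right inner_diff_left inner_diff_right inner_commute)

lemma Lp_two_parallelogram:
  assumes "f \<in> Lp_space M 2" "g \<in> Lp_space M 2"
  shows "(Lp_norm M 2 (\<lambda>x. f x + g x))\<^sup>2 + (Lp_norm M 2 (\<lambda>x. f x - g x))\<^sup>2
     = 2 * ((Lp_norm M 2 f)\<^sup>2 + (Lp_norm M 2 g)\<^sup>2)"
proof -
  have n2: "(Lp_norm M 2 h)\<^sup>2 = (LINT x|M. (norm (h x))\<^sup>2)" for h :: "'a \<Rightarrow> complex"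
    using Lp_norm_powr[of 2 M h] by simp
  have i2: "integrable M (\<lambda>x. (norm (h x))\<^sup>2)" if "h \<in> Lp_space M 2" for h :: "'a \<Rightarrow> complex"
    using Lp_spaceD(2)[OF that] by simp
  have "(Lp_norm M 2 (\<lambda>x. f x + g x))\<^sup>2 + (Lp_norm M 2 (\<lambda>x. f x - g x))\<^sup>2
     = (LINT x|M. (norm (f x + g x))\<^sup>2 + (norm (f x - g x))\<^sup>2)"
    unfolding n2 using assms by (intro Bochner_Integration.integral_add[symmetric] i2 Lp_space_add Lp_space_diff) auto
  also have "\<dots> = 2 * ((Lp_norm M 2 f)\<^sup>2 + (Lp_norm M 2 g)\<^sup>2)"
    unfolding n2 norm_parallelogram_complex using i2 assms by simp
  finally show ?thesis .
qed

text \<open>A signed sum is a difference of two subset sums, hence the factor 2.\<close>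

lemma signed_sum_bound:
  assumes "p \<ge> 1" "finite F" "\<And>n. \<bar>\<epsilon> n\<bar> = (1::real)" "\<And>n. v n \<in> Lp_space M p"
    and "\<And>G. finite G \<Longrightarrow> Lp_norm M p (\<lambda>x. \<Sum>n\<in>G. v n x) \<le> B"
  shows "Lp_norm M p (\<lambda>x. \<Sum>n\<in>F. \<epsilon> n * v n x) \<le> 2 * B"
proof -
  let ?P = "{n\<in>F. \<epsilon> n = 1}"
  have "(\<lambda>x. \<Sum>n\<in>F. \<epsilon> n * v n x) = (\<lambda>x. (\<Sum>n\<in>?P. v n x) - (\<Sum>n\<in>F - ?P. v n x))"
  proof
    fix x
    have em: "\<epsilon> n = - 1" if "n \<in> F - ?P" for n using assms(3)[of n] that by (auto simp: abs_if split: if_splits)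
    have "complex_of_real (\<epsilon> n) * v n x = - v n x" if "n \<in> F - ?P" for n
      using em[OF that] by simp
    then have "(\<Sum>n\<in>F - ?P. \<epsilon> n * v n x) = (\<Sum>n\<in>F - ?P. - v n x)" by (rule sum.cong[OF refl])
    moreover have "(\<Sum>n\<in>?P. \<epsilon> n * v n x) = (\<Sum>n\<in>?P. v n x)" by (intro sum.cong) auto
    moreover have "(\<Sum>n\<in>F. \<epsilon> n * v n x) = (\<Sum>n\<in>F - ?P. \<epsilon> n * v n x) + (\<Sum>n\<in>?P. \<epsilon> n * v n x)"
      using assms(2) by (intro sum.subset_diff) auto
    ultimately show "(\<Sum>n\<in>F. \<epsilon> n * v n x) = (\<Sum>n\<in>?P. v n x) - (\<Sum>n\<in>F - ?P. v n x)"
      by (simp add: sum_negf)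
  qed
  then have "Lp_norm M p (\<lambda>x. \<Sum>n\<in>F. \<epsilon> n * v n x)
      \<le> Lp_norm M p (\<lambda>x. \<Sum>n\<in>?P. v n x) + Lp_norm M p (\<lambda>x. \<Sum>n\<in>F - ?P. v n x)"
    using assms(1,4) by (simp only:) (intro Lp_norm_triangle_diff Lp_space_sum; simp)
  also have "\<dots> \<le> 2 * B" using assms(5)[of ?P] assms(5)[of "F - ?P"] assms(2) by simp
  finally show ?thesis .
qed

text \<open>The underlying measure enters only through its finiteness and an infinite disjoint
  family of sets of positive measure, on which the normalized indicators \<open>e j\<close>
  live.\<close>

lemma no_unconditional_Schauder_frame_bounded:
  fixes M :: "'a measure" and J :: "nat \<Rightarrow> 'a set"
  assumes fin: "finite_measure M" and p: "2 < p"
    and J: "disjoint_family J" "\<And>j. J j \<in> sets M" "\<And>j. 0 < measure M (J j)"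
    and frame: "unconditional_Schauder_frame (Lp_space M p) (Lp_norm M p) g g'"
    and ub: "uniformly_bounded M g"
    and sg: "seminormalized (Lp_norm M p) g"
    and sg': "seminormalized (dual_norm (Lp_space M p) (Lp_norm M p)) g'"
  shows False
proof -
  interpret finite_measure M by fact
  have p1: "p \<ge> 1" "p > 0" "p \<ge> 2" using p by auto
  have g: "g n \<in> Lp_space M p" and g': "g' n \<in> dual_space (Lp_space M p) (Lp_norm M p)" for n
    using frame unfolding unconditional_Schauder_frame_def by auto
  obtain K where K: "K > 0" "\<And>F f. finite F \<Longrightarrow> f \<in> Lp_space M p \<Longrightarrow>
      Lp_norm M p (\<lambda>x. \<Sum>n\<in>F. g' n f * g n x) \<le> K * Lp_norm M p f"
    using unconditional_Schauder_frame_bound[OF p1(1) frame] by auto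
  have KS: "Lp_norm M p (\<lambda>x. \<Sum>n\<in>F. \<epsilon> n * (g' n f * g n x)) \<le> 2 * (K * Lp_norm M p f)"
    if "finite F" "f \<in> Lp_space M p" "\<And>n. \<bar>\<epsilon> n\<bar> = (1::real)" for F f \<epsilon>
    using that g p1 K(2) by (intro signed_sum_bound) (auto intro: Lp_space_scale)
  obtain A where A: "A > 0" "\<And>n. A \<le> Lp_norm M p (g n)" using sg unfolding seminormalized_def by auto
  obtain A' where A': "A' > 0" "\<And>n. A' \<le> dual_norm (Lp_space M p) (Lp_norm M p) (g' n)"
    using sg' unfolding seminormalized_def by auto
  obtain B0 where B0: "\<And>n. AE x in M. norm (g n x) \<le> B0" using ub unfolding uniformly_bounded_def by auto
  define B where "B = max B0 1"
  have B: "B > 0" "AE x in M. norm (g n x) \<le> B" for n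
    using B0[of n] by (auto simp: B_def elim!: eventually_mono)

  have g2: "g n \<in> Lp_space M 2" for n using Lp_norm_exponent_mono(1)[OF fin g, of 2] p by simp
  \<comment> \<open>Boundedness turns a lower bound in L^p into one in L^2, since |g|^p <= B^(p-2)
    |g|^2.\<close>
  have lower2: "A powr p / B powr (p - 2) \<le> (Lp_norm M 2 (g n))\<^sup>2" for n
  proof -
    have "A powr p \<le> Lp_norm M p (g n) powr p" using A p1 by (intro powr_mono2) auto
    also have "\<dots> = (LINT x|M. norm (g n x) powr p)" using p1 by (simp add: Lp_norm_powr)
    also have "\<dots> \<le> (LINT x|M. B powr (p - 2) * norm (g n x) powr 2)"
    proof (rule integral_mono_AE)
      show "AE x in M. norm (g n x) powr p \<le> B powr (p - 2) * norm (g n x) powr 2"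
        using B(2)[of n]
      proof eventually_elim
        case (elim x)
        have "norm (g n x) powr p = norm (g n x) powr (p - 2) * norm (g n x) powr 2"
          by (simp only: powr_add[symmetric]) simp
        also have "\<dots> \<le> B powr (p - 2) * norm (g n x) powr 2"
          using elim p by (intro mult_right_mono powr_mono2) auto
        finally show ?case .
      qed
    qed (use Lp_spaceD(2)[OF g[of n]] Lp_spaceD(2)[OF g2[of n]] in auto)
    also have "\<dots> = B powr (p - 2) * (Lp_norm M 2 (g n)) powr 2"
      by (subst Lp_norm_powr) auto
    finally show ?thesis using B(1) by (simp add: divide_le_eq mult.commute)
  qed
  define c2 where "c2 = A powr p / B powr (p - 2)"
  have c2: "c2 > 0" using A B by (simp add: c2_def)
  define S where "S = measure M (space M) powr (1 / 2 - 1 / p)"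
  define C1 where "C1 = (S * 2 * K)\<^sup>2 / c2"
  \<comment> \<open>Signs are chosen so that the L^2 norm of the signed expansion dominates the
    square sum of its coefficients; \<open>S\<close> is the embedding constant of L^p into L^2, and
    the factor 2 K bounds signed sums in L^p.\<close>
  have C1: "(\<Sum>n\<in>F. (norm (g' n f))\<^sup>2) \<le> C1 * (Lp_norm M p f)\<^sup>2" if F: "finite F" and f: "f \<in> Lp_space M p" for F f
  proof -
    have X: "(\<lambda>x. y x + complex_of_real s * (g' n f * g n x)) \<in> Lp_space M 2" if "y \<in> Lp_space M 2" for y s n
      using that g2 by (intro Lp_space_add Lp_space_scale) auto
    have Q: "2 * ((Lp_norm M 2 y)\<^sup>2 + (norm (g' n f))\<^sup>2 * c2)
       \<le> (Lp_norm M 2 (\<lambda>x. y x + g' n f * g n x))\<^sup>2 + (Lp_norm M 2 (\<lambda>x. y x - g' n f * g n x))\<^sup>2"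
      if "y \<in> Lp_space M 2" for y n
      using Lp_two_parallelogram[OF that Lp_space_scale[OF g2], of "g' n f" n]
        mult_left_mono[OF lower2[of n], of "(norm (g' n f))\<^sup>2"]
      by (simp add: Lp_norm_scale power_mult_distrib c2_def)
    obtain \<epsilon> :: "nat \<Rightarrow> real" where \<epsilon>: "\<And>n. \<bar>\<epsilon> n\<bar> = 1"
      and le: "(\<Sum>n\<in>F. (norm (g' n f))\<^sup>2 * c2) \<le> (Lp_norm M 2 (\<lambda>x. \<Sum>n\<in>F. \<epsilon> n * (g' n f * g n x)))\<^sup>2"
      using greedy_signs[of F "Lp_space M 2" "\<lambda>y. (Lp_norm M 2 y)\<^sup>2" "\<lambda>n x. g' n f * g n x" "\<lambda>n. (norm (g' n f))\<^sup>2 * c2"]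
        F X Q by auto
    let ?V = "\<lambda>x. \<Sum>n\<in>F. \<epsilon> n * (g' n f * g n x)"
    have V: "?V \<in> Lp_space M p" using p1 g by (intro Lp_space_sum Lp_space_scale) auto
    have "Lp_norm M 2 ?V \<le> S * Lp_norm M p ?V"
      unfolding S_def using p by (intro Lp_norm_exponent_mono(2)[OF fin V]) auto
    also have "\<dots> \<le> S * (2 * (K * Lp_norm M p f))"
      using KS[OF F f \<epsilon>] by (intro mult_left_mono) (auto simp: S_def)
    finally have VS: "(Lp_norm M 2 ?V)\<^sup>2 \<le> (S * 2 * K * Lp_norm M p f)\<^sup>2"
      by (intro power_mono) (auto simp: mult_ac)
    have "c2 * (\<Sum>n\<in>F. (norm (g' n f))\<^sup>2) = (\<Sum>n\<in>F. (norm (g' n f))\<^sup>2 * c2)"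
      by (simp add: sum_distrib_left mult.commute)
    also note le
    also note VS
    finally have "c2 * (\<Sum>n\<in>F. (norm (g' n f))\<^sup>2) \<le> (S * 2 * K)\<^sup>2 * (Lp_norm M p f)\<^sup>2"
      by (simp only: power_mult_distrib)
    then show ?thesis using c2 by (simp add: C1_def field_simps)
  qed

  \<comment> \<open>Vectors that norm each coefficient functional up to a factor 2, as the cotype
    estimate requires; this is where the lower bound on the functionals enters.\<close>
  have "\<exists>f. f \<in> Lp_space M p \<and> Lp_norm M p f \<le> 1 \<and> A' / 2 \<le> norm (g' n f)" for n
  proof -
    have "A' / 2 < dual_norm (Lp_space M p) (Lp_norm M p) (g' n)" using A'(1) A'(2)[of n] by linarith
    moreover have "bdd_above ((\<lambda>f. norm (g' n f)) ` {f \<in> Lp_space M p. Lp_norm M p f \<le> 1})"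
    proof -
      obtain C where C: "\<forall>f\<in>Lp_space M p. norm (g' n f) \<le> C * Lp_norm M p f"
        using g'[of n] unfolding dual_space_def by auto
      have "norm (g' n f) \<le> \<bar>C\<bar>" if "f \<in> Lp_space M p" "Lp_norm M p f \<le> 1" for f
      proof -
        have "norm (g' n f) \<le> C * Lp_norm M p f" using C that by auto
        also have "\<dots> \<le> \<bar>C\<bar> * 1" using that by (intro mult_mono) auto
        finally show ?thesis by simp
      qed
      then show ?thesis by (intro bdd_aboveI[of _ "\<bar>C\<bar>"]) auto
    qed
    moreover have "{f \<in> Lp_space M p. Lp_norm M p f \<le> 1} \<noteq> {}"
      by (auto intro!: exI[of _ "\<lambda>x. 0"])
    ultimately obtain f where "f \<in> {f \<in> Lp_space M p. Lp_norm M p f \<le> 1}" "A' / 2 < norm (g' n f)"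
      unfolding dual_norm_def by (subst (asm) less_cSUP_iff) auto
    then show ?thesis by auto
  qed
  then obtain f where f: "\<And>n. f n \<in> Lp_space M p" "\<And>n. Lp_norm M p (f n) \<le> 1" "\<And>n. A' / 2 \<le> norm (g' n (f n))"
    by metis
  have A2: "A' / 2 > 0" using A'(1) by simp
  show False
  proof (rule dual_cotype_two[OF p1(3) A2, of M])
    fix C2 :: real
    assume C2: "C2 > 0" and cotype: "\<And>F \<phi> f (a :: nat \<Rightarrow> complex) K.
        finite F \<Longrightarrow> K \<ge> 0 \<Longrightarrow> (\<And>n. \<phi> n \<in> dual_space (Lp_space M p) (Lp_norm M p)) \<Longrightarrow>
        (\<And>n. f n \<in> Lp_space M p) \<Longrightarrow> (\<And>n. Lp_norm M p (f n) \<le> 1) \<Longrightarrow> (\<And>n. A' / 2 \<le> norm (\<phi> n (f n))) \<Longrightarrow>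
        (\<And>\<epsilon> h. h \<in> Lp_space M p \<Longrightarrow> (\<And>n. \<bar>\<epsilon> n\<bar> = (1::real)) \<Longrightarrow>
           norm (\<Sum>n\<in>F. \<epsilon> n * a n * \<phi> n h) \<le> K * Lp_norm M p h) \<Longrightarrow>
        (\<Sum>n\<in>F. (norm (a n))\<^sup>2) \<le> C2 * K\<^sup>2"
    define e where "e j x = complex_of_real (measure M (J j) powr (- 1 / p)) * indicator (J j) x" for j x
    have [measurable]: "J j \<in> sets M" for j by (rule J)
    have e: "e j \<in> Lp_space M p" for j
      unfolding e_def using p1 by (intro Lp_space_scale Lp_space_bounded[OF fin, of _ 1]) (auto simp: indicator_def)
    define c3 where "c3 = 1 / (16 * C2 * K\<^sup>2)"
    have c3: "c3 > 0" using C2 K by (simp add: c3_def)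
    \<comment> \<open>The expansion of \<open>e j\<close> is tested against integration over
      \<open>J j\<close>. The numbers \<open>a n\<close> are the values of that functional at
      \<open>g n\<close>, and cotype of the dual bounds their square sum by C2 (2 m K)^2. As the
      coefficients must reproduce at least half of the value m at \<open>e j\<close>, Cauchy-Schwarz
      leaves them the square sum 1 / (16 C2 K^2).\<close>
    have "\<exists>k. c3 \<le> (\<Sum>n<k. (norm (g' n (e j)))\<^sup>2)" for j
    proof -
      define m where "m = measure M (J j) powr (1 - 1 / p)"
      have m: "m > 0" using J(3)[of j] by (simp add: m_def)
      define a where "a n = (LINT x|M. indicator (J j) x * g n x)" for n
      have ig: "integrable M (\<lambda>x. indicator (J j) x * h x)" if "h \<in> Lp_space M p" for h :: "'a \<Rightarrow> complex"
      proof -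
        have "integrable M h" using norm_integral_indicator_le(1)[OF fin J(2) that p1(1)] .
        from integrable_mult_indicator[OF J(2) this] show ?thesis
          by (rule Bochner_Integration.integrable_cong[THEN iffD1, rotated 2]) (auto simp: indicator_def)
      qed
      have asum: "(\<Sum>n\<in>F. c n * a n) = (LINT x|M. indicator (J j) x * (\<Sum>n\<in>F. c n * g n x))" for F c
      proof -
        have "(LINT x|M. indicator (J j) x * (\<Sum>n\<in>F. c n * g n x)) = (LINT x|M. (\<Sum>n\<in>F. c n * (indicator (J j) x * g n x)))"
          by (intro Bochner_Integration.integral_cong) (auto simp: sum_distrib_left mult_ac)
        then show ?thesis using ig[OF g] by (simp add: a_def)
      qed
      have abound: "norm (\<Sum>n\<in>F. \<epsilon> n * a n * g' n h) \<le> (2 * m * K) * Lp_norm M p h"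
        if "finite F" "h \<in> Lp_space M p" "\<And>n. \<bar>\<epsilon> n\<bar> = (1::real)" for F h \<epsilon>
      proof -
        let ?V = "\<lambda>x. \<Sum>n\<in>F. \<epsilon> n * (g' n h * g n x)"
        have V: "?V \<in> Lp_space M p" using p1 g by (intro Lp_space_sum Lp_space_scale) auto
        have "(\<Sum>n\<in>F. \<epsilon> n * a n * g' n h) = (\<Sum>n\<in>F. (\<epsilon> n * g' n h) * a n)" by (simp add: mult_ac)
        also have "\<dots> = (LINT x|M. indicator (J j) x * ?V x)" unfolding asum by (simp add: mult_ac)
        also have "norm \<dots> \<le> m * Lp_norm M p ?V"
          unfolding m_def by (rule norm_integral_le_Lp_norm[OF fin J(2) V p1(1)])
        also have "\<dots> \<le> m * (2 * (K * Lp_norm M p h))" using KS[OF that] m by (intro mult_left_mono) auto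
        finally show ?thesis by (simp add: mult_ac)
      qed
      have a2: "(\<Sum>n\<in>F. (norm (a n))\<^sup>2) \<le> C2 * (2 * m * K)\<^sup>2" if "finite F" for F
        by (rule cotype[where \<phi> = g' and f = f]; (fact that g' f abound[OF that])?) (use m K(1) in simp)
      have "sums_in (Lp_norm M p) (\<lambda>n x. g' n (e j) * g n x) (e j)"
        using frame e[of j] unfolding unconditional_Schauder_frame_def by auto
      then have "eventually (\<lambda>k. Lp_norm M p (\<lambda>x. (\<Sum>n<k. g' n (e j) * g n x) - e j x) < 1 / 2) sequentially"
        unfolding sums_in_def by (rule order_tendstoD) simp
      then obtain k where k: "Lp_norm M p (\<lambda>x. (\<Sum>n<k. g' n (e j) * g n x) - e j x) < 1 / 2"
        by (auto simp: eventually_sequentially)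
      let ?T = "\<lambda>x. \<Sum>n<k. g' n (e j) * g n x"
      have T: "?T \<in> Lp_space M p" using p1 g by (intro Lp_space_sum Lp_space_scale) auto
      have "(LINT x|M. indicator (J j) x * e j x) = (LINT x|M. complex_of_real (measure M (J j) powr (- 1 / p)) * indicator (J j) x)"
        by (intro Bochner_Integration.integral_cong) (auto simp: e_def indicator_def)
      also have "\<dots> = m"
        using J(3)[of j] powr_add[of "measure M (J j)" "- 1 / p" 1]
        by (simp add: m_def add.commute integral_indicator_complex flip: of_real_mult)
      finally have em: "(LINT x|M. indicator (J j) x * e j x) = m" .
      have "(LINT x|M. indicator (J j) x * (?T x - e j x)) = (\<Sum>n<k. g' n (e j) * a n) - m"
        unfolding asum em[symmetric] right_diff_distrib
        by (intro Bochner_Integration.integral_diff ig T e)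
      moreover have "norm (LINT x|M. indicator (J j) x * (?T x - e j x)) \<le> m * Lp_norm M p (\<lambda>x. ?T x - e j x)"
        unfolding m_def using T e p1 by (intro norm_integral_le_Lp_norm[OF fin J(2)] Lp_space_diff) auto
      moreover have "m * Lp_norm M p (\<lambda>x. ?T x - e j x) \<le> m * (1 / 2)" using k m by (intro mult_left_mono) auto
      ultimately have "norm ((\<Sum>n<k. g' n (e j) * a n) - m) \<le> m / 2" by simp
      then have "m / 2 \<le> norm (\<Sum>n<k. g' n (e j) * a n)"
        using norm_triangle_ineq2[of "complex_of_real m" "\<Sum>n<k. g' n (e j) * a n"] m by (simp add: norm_minus_commute)
      also have "\<dots> \<le> (\<Sum>n<k. norm (g' n (e j)) * norm (a n))"
        by (rule order_trans[OF norm_sum]) (simp add: norm_mult)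
      finally have "(m / 2)\<^sup>2 \<le> (\<Sum>n<k. norm (g' n (e j)) * norm (a n))\<^sup>2"
        using m by (intro power_mono) auto
      also have "\<dots> \<le> (\<Sum>n<k. (norm (g' n (e j)))\<^sup>2) * (\<Sum>n<k. (norm (a n))\<^sup>2)"
        by (rule Cauchy_Schwarz_ineq_sum)
      also have "\<dots> \<le> (\<Sum>n<k. (norm (g' n (e j)))\<^sup>2) * (C2 * (2 * m * K)\<^sup>2)"
        using a2 by (intro mult_left_mono sum_nonneg) auto
      finally have "m\<^sup>2 * 1 \<le> m\<^sup>2 * ((\<Sum>n<k. (norm (g' n (e j)))\<^sup>2) * (16 * C2 * K\<^sup>2))"
        by (simp add: power_mult_distrib power_divide mult_ac)
      then have "1 \<le> (\<Sum>n<k. (norm (g' n (e j)))\<^sup>2) * (16 * C2 * K\<^sup>2)"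
        using m by (subst (asm) mult_le_cancel_left_pos) auto
      then show ?thesis
        using C2 K(1) by (intro exI[of _ k]) (simp add: c3_def divide_le_eq)
    qed
    then obtain k where k: "\<And>j. c3 \<le> (\<Sum>n<k j. (norm (g' n (e j)))\<^sup>2)" by metis

    have main: "c3 * real L \<le> C1 * real L powr (2 / p)" for L
    proof -
      define k' where "k' = Max (insert 0 (k ` {..<L}))"
      have ck: "c3 \<le> (\<Sum>n<k'. (norm (g' n (e j)))\<^sup>2)" if "j < L" for j
      proof -
        have "k j \<le> k'" unfolding k'_def using that by (intro Max_ge) auto
        then show ?thesis by (intro order_trans[OF k[of j] sum_mono2]) auto
      qed
      \<comment> \<open>Signs across the disjoint functions, chosen for the coefficient sequences
        truncated at \<open>k'\<close>: the square sums of the single sequences, each at least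
        \<open>c3\<close>, accumulate.\<close>
      obtain \<epsilon> :: "nat \<Rightarrow> real" where \<epsilon>: "\<And>n. \<bar>\<epsilon> n\<bar> = 1"
        and le: "(\<Sum>j<L. c3) \<le> (\<Sum>n<k'. (norm (\<Sum>j<L. \<epsilon> j * g' n (e j)))\<^sup>2)"
      proof -
        have "2 * ((\<Sum>n<k'. (norm (y n))\<^sup>2) + c3)
            \<le> (\<Sum>n<k'. (norm (y n + g' n (e j)))\<^sup>2) + (\<Sum>n<k'. (norm (y n - g' n (e j)))\<^sup>2)" if "j < L" for y j
          using ck[OF that] unfolding sum.distrib[symmetric] norm_parallelogram_complex
          by (simp add: sum.distrib sum_distrib_left[symmetric])
        then show ?thesis
          using greedy_signs[of "{..<L}" UNIV "\<lambda>y. \<Sum>n<k'. (norm (y n))\<^sup>2" "\<lambda>j n. g' n (e j)" "\<lambda>_. c3"] that by auto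
      qed
      let ?E = "\<lambda>x. \<Sum>j<L. \<epsilon> j * e j x"
      have E: "?E \<in> Lp_space M p" using p1 e by (intro Lp_space_sum Lp_space_scale) auto
      have "g' n ?E = (\<Sum>j<L. \<epsilon> j * g' n (e j))" for n
        using p1 e by (intro dual_space_sum[OF _ g']) auto
      with le have "c3 * real L \<le> (\<Sum>n<k'. (norm (g' n ?E))\<^sup>2)" by (simp add: mult.commute)
      also have "\<dots> \<le> C1 * (Lp_norm M p ?E)\<^sup>2" by (rule C1[OF _ E]) simp
      finally have 1: "c3 * real L \<le> C1 * (Lp_norm M p ?E)\<^sup>2" .
      have pw: "norm (?E x) powr p \<le> (\<Sum>j<L. indicator (J j) x / measure M (J j))" for x
      proof (cases "\<exists>i<L. x \<in> J i")
        case True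
        then obtain i where i: "i < L" "x \<in> J i" by blast
        have "x \<notin> J j" if "j \<noteq> i" for j using i(2) that J(1) unfolding disjoint_family_on_def by auto
        then have "(\<Sum>j<L. \<epsilon> j * e j x) = (\<Sum>j\<in>{i}. \<epsilon> j * e j x)"
          using i by (intro sum.mono_neutral_right) (auto simp: e_def)
        then have "norm (?E x) = measure M (J i) powr (- 1 / p)"
          using i \<epsilon>[of i] by (simp add: e_def norm_mult)
        then have "norm (?E x) powr p = indicator (J i) x / measure M (J i)"
          using i p1 J(3)[of i] by (simp add: powr_powr powr_minus_divide powr_divide)
        also have "\<dots> \<le> (\<Sum>j<L. indicator (J j) x / measure M (J j))"
          using i by (intro member_le_sum) auto
        finally show ?thesis .
      next
        case False
        then have "?E x = 0" by (auto simp: e_def intro!: sum.neutral)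
        then show ?thesis by (simp add: sum_nonneg)
      qed
      have "(LINT x|M. norm (?E x) powr p) \<le> (LINT x|M. (\<Sum>j<L. indicator (J j) x / measure M (J j)))"
        using Lp_spaceD(2)[OF E] pw by (intro integral_mono) (auto simp: emeasure_eq_measure)
      also have "\<dots> = (\<Sum>j<L. 1)"
      proof -
        have "(LINT x|M. (\<Sum>j<L. indicator (J j) x / measure M (J j))) = (\<Sum>j<L. measure M (J j) / measure M (J j))"
          by (subst Bochner_Integration.integral_sum) (auto simp: emeasure_eq_measure)
        also have "\<dots> = (\<Sum>j<L. 1)" using J(3) by (intro sum.cong) (auto simp: less_imp_neq[symmetric])
        finally show ?thesis .
      qed
      also have "\<dots> = (real L powr (1 / p)) powr p" using p1 by (simp add: powr_powr)
      finally have "Lp_norm M p ?E \<le> real L powr (1 / p)"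
        using p1 by (simp add: Lp_norm_le_iff)
      then have "(Lp_norm M p ?E)\<^sup>2 \<le> (real L powr (1 / p))\<^sup>2" by (intro power_mono) auto
      also have "\<dots> = real L powr (2 / p)" by (simp add: power2_eq_square flip: powr_add)
      finally have "C1 * (Lp_norm M p ?E)\<^sup>2 \<le> C1 * real L powr (2 / p)"
        using c2 by (intro mult_left_mono) (auto simp: C1_def)
      with 1 show ?thesis by linarith
    qed
    \<comment> \<open>Here p > 2 gives the contradiction: L^(2/p) grows more slowly than L.\<close>
    have "((\<lambda>L. C1 * real L powr (2 / p - 1)) \<longlongrightarrow> C1 * 0) sequentially"
      using p by (intro tendsto_mult tendsto_const tendsto_neg_powr filterlim_real_sequentially) auto
    then have "eventually (\<lambda>L. C1 * real L powr (2 / p - 1) < c3) sequentially"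
      using c3 by (intro order_tendstoD) auto
    then obtain L where L: "L > 0" "C1 * real L powr (2 / p - 1) < c3"
      unfolding eventually_sequentially by (metis lessI less_Suc_eq_le less_imp_le zero_less_Suc le_SucI order_refl)
    then have "C1 * real L powr (2 / p - 1) * real L < c3 * real L" by simp
    moreover have "real L powr (2 / p - 1) * real L = real L powr (2 / p)"
      using L by (simp add: powr_diff)
    ultimately show False using main[of L] by (simp add: mult.assoc)
  qed
qed

subsection \<open>A zigzag-concave function\<close>

text \<open>The second derivative of the first power is at most r 6 b q^(r-1): the square of R' has
  the coefficient r - 1 <= 0, d <= 3 b, and R >= q. That of q^r is at least r 2 b (2 r - 1) q^(r-1)
  by the discriminant condition. The factor 3 / (2 r - 1) is the quotient; \<delta> keeps both bases
  positive, so the powers are smooth.\<close>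

lemma quadratic_powr_concave:
  fixes q0 q1 b R0 R1 d \<delta> r :: real
  assumes r: "1 / 2 < r" "r \<le> 1" and b: "b \<ge> 0" and d: "d \<le> 3 * b" and \<delta>: "\<delta> > 0"
    and disc: "q1\<^sup>2 \<le> 4 * q0 * b" and q0: "\<And>t. 0 \<le> q0 + q1 * t + b * t\<^sup>2"
    and qR: "\<And>t. q0 + q1 * t + b * t\<^sup>2 \<le> R0 + R1 * t + d * t\<^sup>2"
  shows "concave_on UNIV (\<lambda>t. (R0 + R1 * t + d * t\<^sup>2 + \<delta>) powr r
     - 3 / (2 * r - 1) * (q0 + q1 * t + b * t\<^sup>2 + \<delta>) powr r)"
proof -
  define q where "q t = q0 + q1 * t + b * t\<^sup>2 + \<delta>" for t
  define R where "R t = R0 + R1 * t + d * t\<^sup>2 + \<delta>" for t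
  have pos: "0 < q t" "0 < R t" "q t \<le> R t" for t
    using q0[of t] qR[of t] \<delta> by (auto simp: q_def R_def)
  have dq: "(q has_real_derivative q1 + 2 * b * t) (at t)" for t
    unfolding q_def by (auto intro!: derivative_eq_intros)
  have dR: "(R has_real_derivative R1 + 2 * d * t) (at t)" for t
    unfolding R_def by (auto intro!: derivative_eq_intros)
  have dpow: "((\<lambda>t. u t powr e) has_real_derivative e * u t powr (e - 1) * u') (at t)"
    if "(u has_real_derivative u') (at t)" "u t > 0" for u u' e and t :: real
    using that by (auto intro!: derivative_eq_intros simp: powr_diff field_simps)
  let ?B = "3 / (2 * r - 1)"
  let ?f' = "\<lambda>t. r * R t powr (r - 1) * (R1 + 2 * d * t) - ?B * (r * q t powr (r - 1) * (q1 + 2 * b * t))"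
  let ?f'' = "\<lambda>t. r * ((r - 1) * R t powr (r - 1 - 1) * (R1 + 2 * d * t) * (R1 + 2 * d * t) + R t powr (r - 1) * (2 * d))
     - ?B * (r * ((r - 1) * q t powr (r - 1 - 1) * (q1 + 2 * b * t) * (q1 + 2 * b * t) + q t powr (r - 1) * (2 * b)))"
  have "concave_on UNIV (\<lambda>t. R t powr r - ?B * q t powr r)"
  proof (rule f''_le0_imp_concave)
    show "((\<lambda>t. R t powr r - ?B * q t powr r) has_real_derivative ?f' t) (at t)" for t
      by (intro DERIV_diff DERIV_cmult dpow dq dR pos)
    have prod: "((\<lambda>t. r * u t powr (r - 1) * (c + 2 * e * t)) has_real_derivative
        r * ((r - 1) * u t powr (r - 1 - 1) * u' * (c + 2 * e * t) + u t powr (r - 1) * (2 * e))) (at t)"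
      if "(u has_real_derivative u') (at t)" "u t > 0" for u u' c e and t :: real
      by (rule derivative_eq_intros dpow[OF that] refl | simp add: algebra_simps)+
    show "(?f' has_real_derivative ?f'' t) (at t)" for t
      by (intro DERIV_diff DERIV_cmult prod dq dR pos)
    show "?f'' t \<le> 0" for t
    proof -
      \<comment> \<open>The left side is the squared derivative of q; the nonpositive discriminant
        bounds it by a multiple of q itself.\<close>
      have sq: "(q1 + 2 * b * t) * (q1 + 2 * b * t) \<le> 4 * b * q t"
      proof -
        have "(q1 + 2 * b * t) * (q1 + 2 * b * t) = q1\<^sup>2 - 4 * q0 * b + 4 * b * (q t - \<delta>)"
          by (simp add: q_def power2_eq_square algebra_simps)
        also have "\<dots> \<le> 4 * b * q t"
          using disc mult_nonneg_nonneg[OF b less_imp_le[OF \<delta>]] by (simp add: algebra_simps)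
        finally show ?thesis .
      qed
      have "(r - 1) * q t powr (r - 1 - 1) * (q1 + 2 * b * t) * (q1 + 2 * b * t)
          = - ((1 - r) * q t powr (r - 1 - 1) * ((q1 + 2 * b * t) * (q1 + 2 * b * t)))"
        by (simp add: algebra_simps)
      also have "\<dots> \<ge> - ((1 - r) * q t powr (r - 1 - 1) * (4 * b * q t))"
        using sq r by (intro le_imp_neg_le mult_left_mono) auto
      also have "- ((1 - r) * q t powr (r - 1 - 1) * (4 * b * q t)) = - (4 * b * (1 - r) * q t powr (r - 1))"
      proof -
        have "q t powr (r - 1) = q t * q t powr (r - 1 - 1)"
          using powr_mult_base[of "q t" "r - 1 - 1"] pos(1)[of t] by simp
        then show ?thesis by (simp add: mult_ac)
      qed
      finally have 1: "(r - 1) * q t powr (r - 1 - 1) * (q1 + 2 * b * t) * (q1 + 2 * b * t) + q t powr (r - 1) * (2 * b)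
          \<ge> 2 * b * (2 * r - 1) * q t powr (r - 1)"
        by (simp add: algebra_simps)
      have "?B * (2 * b * (2 * r - 1) * q t powr (r - 1)) \<le>
          ?B * ((r - 1) * q t powr (r - 1 - 1) * (q1 + 2 * b * t) * (q1 + 2 * b * t) + q t powr (r - 1) * (2 * b))"
        using r by (intro mult_left_mono 1) auto
      moreover have "?B * (2 * b * (2 * r - 1) * q t powr (r - 1)) = 6 * b * q t powr (r - 1)"
        using r by simp
      ultimately have 2: "6 * b * q t powr (r - 1) \<le>
          ?B * ((r - 1) * q t powr (r - 1 - 1) * (q1 + 2 * b * t) * (q1 + 2 * b * t) + q t powr (r - 1) * (2 * b))"
        by simp
      have "(r - 1) * R t powr (r - 1 - 1) * (R1 + 2 * d * t) * (R1 + 2 * d * t) \<le> 0"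
        using r by (simp add: mult_nonpos_nonneg mult.assoc)
      moreover have "R t powr (r - 1) * (2 * d) \<le> R t powr (r - 1) * (2 * (3 * b))"
        using d by (intro mult_left_mono) auto
      moreover have "R t powr (r - 1) * (2 * (3 * b)) \<le> q t powr (r - 1) * (2 * (3 * b))"
        using pos[of t] r b by (intro mult_right_mono powr_mono2') auto
      ultimately have "(r - 1) * R t powr (r - 1 - 1) * (R1 + 2 * d * t) * (R1 + 2 * d * t) + R t powr (r - 1) * (2 * d)
          \<le> 6 * b * q t powr (r - 1)"
        by (simp add: mult.commute)
      with 2 have "r * ((r - 1) * R t powr (r - 1 - 1) * (R1 + 2 * d * t) * (R1 + 2 * d * t) + R t powr (r - 1) * (2 * d))
        \<le> r * (?B * ((r - 1) * q t powr (r - 1 - 1) * (q1 + 2 * b * t) * (q1 + 2 * b * t) + q t powr (r - 1) * (2 * b)))"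
        using r by (intro mult_left_mono) auto
      then show ?thesis by (simp add: mult.left_commute)
    qed
  qed auto
  then show ?thesis by (simp add: q_def R_def)
qed

text \<open>A Burkholder-type function with an additional variable: x is the martingale, y its
  transform, and S accumulates squared increments. Thus one concavity argument yields both the
  multiplier bound and the square function bound.\<close>

definition zigzag :: "real \<Rightarrow> complex \<Rightarrow> complex \<Rightarrow> real \<Rightarrow> real" where
  "zigzag p x y S = ((norm x)\<^sup>2 + (norm y)\<^sup>2 + S) powr (p / 2) - 3 / (p - 1) * norm x powr p"

lemma norm_square_powr_half: "((norm x)\<^sup>2) powr (p / 2) = norm x powr p"
proof -
  have "(norm x)\<^sup>2 = norm x powr 2" by simp
  then show ?thesis by (simp only: powr_powr) simp
qed

lemma norm_affine_square:
  fixes x \<beta> :: complex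
  shows "(norm (x + complex_of_real t * \<beta>))\<^sup>2 = (norm x)\<^sup>2 + 2 * (x \<bullet> \<beta>) * t + (norm \<beta>)\<^sup>2 * t\<^sup>2"
proof -
  have "x + complex_of_real t * \<beta> = x + t *\<^sub>R \<beta>" by (simp add: scaleR_conv_of_real)
  then show ?thesis
    unfolding power2_norm_eq_inner
    by (simp add: inner_add_left inner_add_right inner_commute power2_eq_square)
qed

text \<open>Along the line both the squares and S are quadratic in t, so the regularized function is
  concave, and \<delta> tends to 0. The quadratic coefficient is at most 3 |\<beta>|^2: one share
  each from x, y and S. The weights are not normalized because they will be measures of cells,
  possibly zero.\<close>

lemma zigzag_jensen:
  fixes x y \<beta> \<theta> :: complex
  assumes p: "1 < p" "p \<le> 2" and \<theta>: "norm \<theta> \<le> 1" and S: "S \<ge> 0"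
    and w: "w1 \<ge> 0" "w2 \<ge> 0" "w1 * t1 + w2 * t2 = 0"
  shows "w1 * zigzag p (x + t1 * \<beta>) (y + t1 * (\<theta> * \<beta>)) (S + (norm \<beta>)\<^sup>2 * t1\<^sup>2)
       + w2 * zigzag p (x + t2 * \<beta>) (y + t2 * (\<theta> * \<beta>)) (S + (norm \<beta>)\<^sup>2 * t2\<^sup>2)
       \<le> (w1 + w2) * zigzag p x y S"
proof (cases "w1 + w2 = 0")
  case True
  then have "w1 = 0" "w2 = 0" using w by linarith+
  then show ?thesis by simp
next
  case False
  define W where "W = w1 + w2"
  have W: "W > 0" using False w by (simp add: W_def)
  define b where "b = (norm \<beta>)\<^sup>2"
  define q where "q t = (norm x)\<^sup>2 + 2 * (x \<bullet> \<beta>) * t + b * t\<^sup>2" for t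
  define R where "R t = ((norm x)\<^sup>2 + (norm y)\<^sup>2 + S) + (2 * (x \<bullet> \<beta>) + 2 * (y \<bullet> (\<theta> * \<beta>))) * t + (2 * b + (norm (\<theta> * \<beta>))\<^sup>2) * t\<^sup>2" for t
  have q: "q t = (norm (x + t * \<beta>))\<^sup>2" for t unfolding norm_affine_square q_def b_def by simp
  have R: "R t = q t + ((norm (y + t * (\<theta> * \<beta>)))\<^sup>2 + (S + b * t\<^sup>2))" for t
    unfolding norm_affine_square R_def q_def b_def by (simp add: algebra_simps)
  have zz: "zigzag p (x + t * \<beta>) (y + t * (\<theta> * \<beta>)) (S + (norm \<beta>)\<^sup>2 * t\<^sup>2)
      = R t powr (p / 2) - 3 / (p - 1) * q t powr (p / 2)" for t :: real
    unfolding zigzag_def R q b_def norm_square_powr_half by (simp add: add.assoc)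
  let ?h = "\<lambda>\<delta> t. (R t + \<delta>) powr (p / 2) - 3 / (p - 1) * (q t + \<delta>) powr (p / 2)"
  have jensen: "w1 * ?h \<delta> t1 + w2 * ?h \<delta> t2 \<le> W * ?h \<delta> 0" if \<delta>: "\<delta> > 0" for \<delta>
  proof -
    have "norm (\<theta> * \<beta>) \<le> norm \<beta>" using mult_right_mono[OF \<theta>, of "norm \<beta>"] by (simp add: norm_mult)
    then have nb: "(norm (\<theta> * \<beta>))\<^sup>2 \<le> b" unfolding b_def by (intro power_mono) auto
    have "concave_on UNIV (\<lambda>t. ((norm x)\<^sup>2 + (norm y)\<^sup>2 + S + (2 * (x \<bullet> \<beta>) + 2 * (y \<bullet> (\<theta> * \<beta>))) * t
        + (2 * b + (norm (\<theta> * \<beta>))\<^sup>2) * t\<^sup>2 + \<delta>) powr (p / 2)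
      - 3 / (2 * (p / 2) - 1) * ((norm x)\<^sup>2 + 2 * (x \<bullet> \<beta>) * t + b * t\<^sup>2 + \<delta>) powr (p / 2))"
    proof (rule quadratic_powr_concave)
      show "(2 * (x \<bullet> \<beta>))\<^sup>2 \<le> 4 * (norm x)\<^sup>2 * b"
        using Cauchy_Schwarz_ineq[of x \<beta>] by (simp add: b_def power_mult_distrib power2_norm_eq_inner)
      show "0 \<le> (norm x)\<^sup>2 + 2 * (x \<bullet> \<beta>) * t + b * t\<^sup>2" for t
        using q[of t] unfolding q_def by simp
      show "(norm x)\<^sup>2 + 2 * (x \<bullet> \<beta>) * t + b * t\<^sup>2 \<le> (norm x)\<^sup>2 + (norm y)\<^sup>2 + S
         + (2 * (x \<bullet> \<beta>) + 2 * (y \<bullet> (\<theta> * \<beta>))) * t + (2 * b + (norm (\<theta> * \<beta>))\<^sup>2) * t\<^sup>2" for t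
      proof -
        have "q t \<le> R t" unfolding R[of t] using S by (simp add: b_def)
        then show ?thesis unfolding R_def q_def .
      qed
    qed (use p \<delta> nb in \<open>auto simp: b_def\<close>)
    then have conc: "concave_on UNIV (?h \<delta>)" unfolding R_def q_def by simp
    have w1W: "1 - w2 / W = w1 / W" using W by (simp add: W_def field_simps)
    have "?h \<delta> ((w1 / W) *\<^sub>R t1 + (w2 / W) *\<^sub>R t2) \<ge> (w1 / W) * ?h \<delta> t1 + (w2 / W) * ?h \<delta> t2"
      using concave_onD[OF conc, of "w2 / W" t1 t2] w W unfolding w1W by (simp add: W_def)
    moreover have "(w1 / W) *\<^sub>R t1 + (w2 / W) *\<^sub>R t2 = 0"
      using w(3) W by (simp add: add_divide_distrib[symmetric])
    ultimately have "W * ((w1 / W) * ?h \<delta> t1 + (w2 / W) * ?h \<delta> t2) \<le> W * ?h \<delta> 0"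
      using W by (intro mult_left_mono) auto
    moreover have "W * ((w1 / W) * A + (w2 / W) * C) = w1 * A + w2 * C" for A C
      using W by (simp add: distrib_left)
    ultimately show ?thesis by metis
  qed
  have lim: "((\<lambda>n. ?h (inverse (real (Suc n))) t) \<longlongrightarrow> R t powr (p / 2) - 3 / (p - 1) * q t powr (p / 2)) sequentially" for t
  proof -
    have "((\<lambda>n. (u + inverse (real (Suc n))) powr (p / 2)) \<longlongrightarrow> u powr (p / 2)) sequentially" if "u \<ge> 0" for u
    proof -
      have "((\<lambda>n. (u + inverse (real (Suc n))) powr (p / 2)) \<longlongrightarrow> (u + 0) powr (p / 2)) sequentially"
        using p that by (intro tendsto_powr' tendsto_add tendsto_const LIMSEQ_inverse_real_of_nat) auto
      then show ?thesis by simp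
    qed
    moreover have "R t \<ge> 0" "q t \<ge> 0" unfolding R q using S by (auto simp: b_def)
    ultimately show ?thesis by (intro tendsto_diff tendsto_mult tendsto_const)
  qed
  have "w1 * (R t1 powr (p / 2) - 3 / (p - 1) * q t1 powr (p / 2)) + w2 * (R t2 powr (p / 2) - 3 / (p - 1) * q t2 powr (p / 2))
      \<le> W * (R 0 powr (p / 2) - 3 / (p - 1) * q 0 powr (p / 2))"
    by (rule LIMSEQ_le[OF tendsto_add[OF tendsto_mult_left[OF lim] tendsto_mult_left[OF lim]] tendsto_mult_left[OF lim]])
      (use jensen in auto)
  moreover have "zigzag p x y S = R 0 powr (p / 2) - 3 / (p - 1) * q 0 powr (p / 2)"
    using zz[of 0] by simp
  ultimately show ?thesis unfolding zz W_def by simp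
qed

lemma zigzag_ge:
  assumes "1 < p" "S \<ge> 0"
  shows "norm y powr p \<le> zigzag p x y S + 3 / (p - 1) * norm x powr p"
    "S powr (p / 2) \<le> zigzag p x y S + 3 / (p - 1) * norm x powr p"
proof -
  have "((norm y)\<^sup>2) powr (p / 2) \<le> ((norm x)\<^sup>2 + (norm y)\<^sup>2 + S) powr (p / 2)"
    using assms by (intro powr_mono2) auto
  then show "norm y powr p \<le> zigzag p x y S + 3 / (p - 1) * norm x powr p"
    unfolding norm_square_powr_half by (simp add: zigzag_def)
  have "S powr (p / 2) \<le> ((norm x)\<^sup>2 + (norm y)\<^sup>2 + S) powr (p / 2)"
    using assms by (intro powr_mono2) auto
  then show "S powr (p / 2) \<le> zigzag p x y S + 3 / (p - 1) * norm x powr p"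
    by (simp add: zigzag_def)
qed

text \<open>At the root all three variables come from one coefficient, and 3^(p/2) <= 3 <= 3 / (p -
  1).\<close>

lemma zigzag_start:
  assumes "1 < p" "p \<le> 2" "norm \<theta> \<le> 1"
  shows "zigzag p a (\<theta> * a) ((norm a)\<^sup>2) \<le> 0"
proof -
  have "(norm (\<theta> * a))\<^sup>2 \<le> (norm a)\<^sup>2"
    using mult_right_mono[OF assms(3), of "norm a"] by (intro power_mono) (auto simp: norm_mult)
  then have "((norm a)\<^sup>2 + (norm (\<theta> * a))\<^sup>2 + (norm a)\<^sup>2) powr (p / 2) \<le> (3 * (norm a)\<^sup>2) powr (p / 2)"
    using assms by (intro powr_mono2) auto
  also have "\<dots> = 3 powr (p / 2) * norm a powr p"
    by (simp add: powr_mult norm_square_powr_half)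
  also have "\<dots> \<le> 3 powr 1 * norm a powr p"
    using assms by (intro mult_right_mono powr_mono) auto
  also have "\<dots> \<le> 3 / (p - 1) * norm a powr p"
    using assms by (intro mult_right_mono) (auto simp: le_divide_eq)
  finally show ?thesis by (simp add: zigzag_def)
qed

text \<open>For |h| <= |x| the power p / 2 of the squared norm lies below its tangent at |x|^2, and
  |x|^(p-2) <= |h|^(p-2) absorbs the quadratic term. Otherwise both sides are comparable to |h|^p,
  and 6 = 4 + 2 adds the bound for the left side to that for the linear term. The linear term is
  kept because it averages out over the two children of a cell.\<close>

lemma norm_add_powr_expand:
  fixes x h :: complex
  assumes p: "1 < p" "p \<le> 2"
  shows "norm (x + h) powr p \<le> norm x powr p + p * norm x powr (p - 2) * (x \<bullet> h) + 6 * norm h powr p"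
proof (cases "norm h \<le> norm x")
  case True
  show ?thesis
  proof (cases "x = 0")
    case True
    then show ?thesis using \<open>norm h \<le> norm x\<close> by simp
  next
    case False
    define a where "a = (norm x)\<^sup>2"
    define z where "z = (norm (x + h))\<^sup>2"
    have a: "a > 0" using False by (simp add: a_def)
    have za: "z = a + (2 * (x \<bullet> h) + (norm h)\<^sup>2)"
      unfolding z_def a_def power2_norm_eq_inner by (simp add: inner_add_left inner_add_right inner_commute)
    have ap: "a powr (p / 2) = norm x powr p" "z powr (p / 2) = norm (x + h) powr p"
      by (simp_all add: a_def z_def norm_square_powr_half)
    have a1: "a powr (p / 2 - 1) = norm x powr (p - 2)"
      using norm_square_powr_half[of x "p - 2"] by (simp add: a_def diff_divide_distrib)
    have "z powr (p / 2) \<le> a powr (p / 2) + (p / 2) * a powr (p / 2 - 1) * (z - a)"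
    proof (cases "z = 0")
      case True
      have "a powr (p / 2 - 1) * a = a powr (p / 2)" using a by (simp add: powr_diff)
      then have "a powr (p / 2) + (p / 2) * a powr (p / 2 - 1) * (z - a) = (1 - p / 2) * a powr (p / 2)"
        using True by (simp add: algebra_simps)
      then show ?thesis using True p by simp
    next
      case False
      then have z: "z > 0" by (simp add: z_def)
      have "z powr (p / 2) * a powr (1 - p / 2) \<le> (p / 2) * z + (1 - p / 2) * a"
        using p z a by (intro Youngs_inequality_0) auto
      then have "z powr (p / 2) * a powr (1 - p / 2) * a powr (p / 2 - 1) \<le> ((p / 2) * z + (1 - p / 2) * a) * a powr (p / 2 - 1)"
        by (intro mult_right_mono) auto
      moreover have "z powr (p / 2) * a powr (1 - p / 2) * a powr (p / 2 - 1) = z powr (p / 2)"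
        using a by (simp add: mult.assoc flip: powr_add)
      moreover have "a * a powr (p / 2 - 1) = a powr (p / 2)" using a by (simp add: powr_diff)
      moreover have "(c * z + (1 - c) * a) * w = a * w + c * w * (z - a)" for c w
        by (simp add: algebra_simps)
      ultimately show ?thesis by metis
    qed
    also have "\<dots> = norm x powr p + p * norm x powr (p - 2) * (x \<bullet> h) + (p / 2) * (norm x powr (p - 2) * (norm h)\<^sup>2)"
      unfolding ap a1 za by (simp add: algebra_simps)
    also have "(p / 2) * (norm x powr (p - 2) * (norm h)\<^sup>2) \<le> 6 * norm h powr p"
    proof (cases "h = 0")
      case False
      have "norm x powr (p - 2) * (norm h)\<^sup>2 \<le> norm h powr (p - 2) * (norm h)\<^sup>2"
        using p True False \<open>norm h \<le> norm x\<close> by (intro mult_right_mono powr_mono2') auto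
      also have "\<dots> = norm h powr p" using False by (simp add: powr_diff power2_eq_square)
      finally have 1: "norm x powr (p - 2) * (norm h)\<^sup>2 \<le> norm h powr p" .
      have "(p / 2) * (norm x powr (p - 2) * (norm h)\<^sup>2) \<le> 6 * norm h powr p"
        using p by (intro mult_mono 1) auto
      then show ?thesis .
    qed simp
    finally show ?thesis unfolding ap by simp
  qed
next
  case False
  then have hx: "norm x \<le> norm h" "norm h > 0" by (auto intro: le_less_trans[of 0 "norm x"] simp: not_le)
  have "norm (x + h) powr p \<le> (2 * norm h) powr p"
    using p hx norm_triangle_ineq[of x h] by (intro powr_mono2) auto
  also have "\<dots> \<le> 4 * norm h powr p"
  proof -
    have "2 powr p \<le> 2 powr (2 :: real)" using p by (intro powr_mono) auto
    then show ?thesis by (simp add: powr_mult mult_right_mono)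
  qed
  finally have 1: "norm (x + h) powr p \<le> 4 * norm h powr p" .
  have "- (p * norm x powr (p - 2) * (x \<bullet> h)) \<le> p * norm x powr (p - 2) * (norm x * norm h)"
  proof -
    have "- (x \<bullet> h) \<le> norm x * norm h" using Cauchy_Schwarz_ineq2[of x h] by linarith
    then have "p * norm x powr (p - 2) * (- (x \<bullet> h)) \<le> p * norm x powr (p - 2) * (norm x * norm h)"
      using p by (intro mult_left_mono) auto
    then show ?thesis by simp
  qed
  also have "\<dots> = p * (norm x powr (p - 1) * norm h)"
    by (cases "x = 0") (simp_all add: powr_diff power2_eq_square)
  also have "\<dots> \<le> p * (norm h powr (p - 1) * norm h)"
    using p hx by (intro mult_left_mono mult_right_mono powr_mono2) auto
  also have "\<dots> = p * norm h powr p" using hx by (simp add: powr_diff)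
  also have "\<dots> \<le> 2 * norm h powr p" using p by (intro mult_right_mono) auto
  finally have "- (p * norm x powr (p - 2) * (x \<bullet> h)) \<le> 2 * norm h powr p" .
  with 1 show ?thesis using powr_ge_zero[of "norm x" p] by linarith
qed

subsection \<open>The Haar system of a sequence of splittings\<close>

text \<open>The cells form a binary tree in heap numbering: the root is cell 1 and the children of cell \<open>k\<close> are
  cells \<open>2 k\<close> and \<open>2 k + 1\<close>.  After the cells \<open>1, \<dots>, n - 1\<close> have been split, the leaves are
  \<open>n, \<dots>, 2 n - 1\<close>.  All cells of depth \<open>i\<close> are split by the set \<open>B i\<close>.\<close>

fun depth :: "nat \<Rightarrow> nat" where
  "depth k = (if k < 2 then 0 else Suc (depth (k div 2)))"

declare depth.simps [simp del]

locale haar_tree = finite_measure M for M :: "'a measure" +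
  fixes B :: "nat \<Rightarrow> 'a set"
  assumes B_sets [measurable]: "\<And>i. B i \<in> sets M"
begin

fun cell :: "nat \<Rightarrow> 'a set" where
  "cell k = (if k < 2 then space M else if even k then cell (k div 2) \<inter> B (depth (k div 2))
     else cell (k div 2) - B (depth (k div 2)))"

declare cell.simps [simp del]

lemma cell_1 [simp]: "cell (Suc 0) = space M"
  by (simp add: cell.simps)

lemma cell_children:
  assumes "k \<ge> 1"
  shows "cell (2 * k) = cell k \<inter> B (depth k)" "cell (2 * k + 1) = cell k - B (depth k)"
  using assms by (simp_all add: cell.simps[of "2 * k"] cell.simps[of "Suc (2 * k)"])

lemma cell_sets [measurable]: "cell k \<in> sets M"
proof (induction k rule: less_induct)
  case (less k)
  show ?case
  proof (cases "k < 2")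
    case True
    then show ?thesis by (simp add: cell.simps)
  next
    case False
    then have [measurable]: "cell (k div 2) \<in> sets M" by (intro less) auto
    show ?thesis using False by (simp add: cell.simps[of k])
  qed
qed

abbreviation mu :: "nat \<Rightarrow> real" where "mu k \<equiv> measure M (cell k)"

lemma mu_split:
  assumes "k \<ge> 1"
  shows "mu k = mu (2 * k) + mu (2 * k + 1)"
proof -
  have "cell k = cell (2 * k) \<union> cell (2 * k + 1)" "cell (2 * k) \<inter> cell (2 * k + 1) = {}"
    using cell_children[OF assms] by auto
  then show ?thesis by (metis cell_sets finite_measure_Union)
qed

text \<open>Only cell n changes between two consecutive partitions, so one further Haar function
  affects an integral only on that cell.\<close>

lemma leaves_Suc:
  assumes "n \<ge> 1"
  shows "{Suc n..<2 * Suc n} = ({n..<2 * n} - {n}) \<union> {2 * n, 2 * n + 1}"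
  using assms by auto

lemma sum_leaves_Suc:
  fixes f :: "nat \<Rightarrow> 'b::ab_group_add"
  assumes "n \<ge> 1"
  shows "(\<Sum>v\<in>{Suc n..<2 * Suc n}. f v) = (\<Sum>v\<in>{n..<2 * n}. f v) - f n + f (2 * n) + f (2 * n + 1)"
proof -
  have "(\<Sum>v\<in>{Suc n..<2 * Suc n}. f v) = (\<Sum>v\<in>{n..<2 * n} - {n}. f v) + (\<Sum>v\<in>{2 * n, 2 * n + 1}. f v)"
    unfolding leaves_Suc[OF assms] by (rule sum.union_disjoint) auto
  also have "(\<Sum>v\<in>{n..<2 * n} - {n}. f v) = (\<Sum>v\<in>{n..<2 * n}. f v) - f n"
    using assms by (subst sum_diff) auto
  finally show ?thesis by simp
qed

lemma leaf_induct [consumes 1, case_names base step]: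
  assumes "n \<ge> 1" "P 1" "\<And>n. n \<ge> 1 \<Longrightarrow> P n \<Longrightarrow> P (Suc n)"
  shows "P n"
  using assms by (induction n rule: nat_induct_at_least) auto

lemma leaf_cover:
  assumes "n \<ge> 1" "x \<in> space M"
  shows "\<exists>v\<in>{n..<2 * n}. x \<in> cell v"
  using assms(1)
proof (induction n rule: leaf_induct)
  case base
  then show ?case using assms(2) by (intro bexI[of _ 1]) auto
next
  case (step n)
  then obtain v where v: "v \<in> {n..<2 * n}" "x \<in> cell v" by blast
  show ?case
  proof (cases "v = n")
    case True
    then have "x \<in> cell (2 * n) \<or> x \<in> cell (2 * n + 1)" using v cell_children[OF step(1)] by auto
    then show ?thesis unfolding leaves_Suc[OF step(1)] by blast
  next
    case False
    then show ?thesis unfolding leaves_Suc[OF step(1)] using v by blast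
  qed
qed

lemma leaf_disjoint:
  assumes "n \<ge> 1" "v \<in> {n..<2 * n}" "w \<in> {n..<2 * n}" "x \<in> cell v" "x \<in> cell w"
  shows "v = w"
proof -
  have "\<forall>v\<in>{n..<2 * n}. \<forall>w\<in>{n..<2 * n}. x \<in> cell v \<longrightarrow> x \<in> cell w \<longrightarrow> v = w"
    using assms(1)
  proof (induction n rule: leaf_induct)
    case (step n)
    note ch = cell_children[OF step(1)]
    have n: "n \<in> {n..<2 * n}" using step(1) by auto
    have "v = w" if vw: "v \<in> ({n..<2 * n} - {n}) \<union> {2 * n, 2 * n + 1}" "w \<in> ({n..<2 * n} - {n}) \<union> {2 * n, 2 * n + 1}"
      "x \<in> cell v" "x \<in> cell w" for v w
    proof -
      have no: "x \<notin> cell n" if "u \<in> {n..<2 * n} - {n}" "x \<in> cell u" for u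
        using step(2) n that by blast
      have "x \<in> cell n" if "u \<in> {2 * n, 2 * n + 1}" "x \<in> cell u" for u
        using that ch by auto
      then consider "v \<in> {n..<2 * n} - {n}" "w \<in> {n..<2 * n} - {n}"
        | "v \<in> {2 * n, 2 * n + 1}" "w \<in> {2 * n, 2 * n + 1}"
        using vw no by blast
      then show ?thesis
      proof cases
        case 1
        then show ?thesis using step(2) vw by blast
      next
        case 2
        then show ?thesis using vw(3,4) ch by auto
      qed
    qed
    then show ?case unfolding leaves_Suc[OF step(1)] by blast
  qed simp
  then show ?thesis using assms by blast
qed

lemma leaf_refine:
  assumes "n \<ge> 1" "n \<le> m" "w \<in> {m..<2 * m}"
  shows "\<exists>v\<in>{n..<2 * n}. cell w \<subseteq> cell v"
  using assms(2,3)
proof (induction m arbitrary: w rule: nat_induct_at_least)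
  case (Suc m)
  have m: "m \<ge> 1" using assms(1) Suc by simp
  show ?case
  proof (cases "w \<in> {m..<2 * m} - {m}")
    case True
    then show ?thesis using Suc by blast
  next
    case False
    then have "w \<in> {2 * m, 2 * m + 1}" using Suc(3) unfolding leaves_Suc[OF m] by blast
    then have "cell w \<subseteq> cell m" using cell_children[OF m] by auto
    moreover obtain v where "v \<in> {n..<2 * n}" "cell m \<subseteq> cell v" using Suc(2)[of m] m by auto
    ultimately show ?thesis by blast
  qed
qed auto

lemma leaf_integral:
  fixes G :: "'a \<Rightarrow> real"
  assumes "n \<ge> 1" "\<And>v x. v \<in> {n..<2 * n} \<Longrightarrow> x \<in> cell v \<Longrightarrow> G x = c v"
  shows "integrable M G" "(LINT x|M. G x) = (\<Sum>v\<in>{n..<2 * n}. mu v * c v)"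
proof -
  have eq: "G x = (\<Sum>v\<in>{n..<2 * n}. c v * indicator (cell v) x)" if x: "x \<in> space M" for x
  proof -
    obtain v where v: "v \<in> {n..<2 * n}" "x \<in> cell v" using leaf_cover[OF assms(1) x] by blast
    have "(\<Sum>v\<in>{n..<2 * n}. c v * indicator (cell v) x) = (\<Sum>w\<in>{v}. c w * indicator (cell w) x)"
    proof (rule sum.mono_neutral_right)
      have "x \<notin> cell w" if "w \<in> {n..<2 * n} - {v}" for w
        using leaf_disjoint[OF assms(1) _ v(1) _ v(2), of w] that by blast
      then show "\<forall>w\<in>{n..<2 * n} - {v}. c w * indicator (cell w) x = 0" by simp
    qed (use v in auto)
    then show ?thesis using v assms(2)[OF v] by simp
  qed
  have int: "integrable M (\<lambda>x. \<Sum>v\<in>{n..<2 * n}. c v * indicator (cell v) x)"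
    by (intro Bochner_Integration.integrable_sum integrable_mult_right) (auto simp: emeasure_eq_measure)
  then show "integrable M G" by (rule Bochner_Integration.integrable_cong[THEN iffD1, rotated 2]) (auto simp: eq)
  have "(LINT x|M. G x) = (LINT x|M. (\<Sum>v\<in>{n..<2 * n}. c v * indicator (cell v) x))"
    by (intro Bochner_Integration.integral_cong) (auto simp: eq)
  also have "\<dots> = (\<Sum>v\<in>{n..<2 * n}. c v * mu v)"
    by (subst Bochner_Integration.integral_sum) (auto simp: emeasure_eq_measure)
  finally show "(LINT x|M. G x) = (\<Sum>v\<in>{n..<2 * n}. mu v * c v)" by (simp add: mult.commute)
qed

text \<open>The value of the Haar function of a cell on its child \<open>v\<close>; the case distinction makes the
  Haar function vanish identically as soon as one of the two children is a null set.\<close>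

definition jump :: "nat \<Rightarrow> real" where
  "jump v = (if mu v = 0 then 0 else if even v then mu (v + 1) else - mu (v - 1))"

lemma jump_balance: "mu (2 * k) * jump (2 * k) + mu (2 * k + 1) * jump (2 * k + 1) = 0"
  by (simp add: jump_def)

text \<open>Function 0 is the constant 1 and function k >= 1 belongs to cell k. Normalization is
  postponed: up to sign, the value on a child is the measure of its sibling, which gives mean zero
  without a division.\<close>

definition haar :: "nat \<Rightarrow> 'a \<Rightarrow> real" where
  "haar k x = (if k = 0 then 1
     else jump (2 * k) * indicator (cell (2 * k)) x + jump (2 * k + 1) * indicator (cell (2 * k + 1)) x)"

lemma haar_measurable [measurable]: "haar k \<in> borel_measurable M"
  unfolding haar_def by simp

lemma haar_bounded: "\<exists>b. \<forall>x. \<bar>haar k x\<bar> \<le> b"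
proof -
  have "\<bar>haar k x\<bar> \<le> 1 + \<bar>jump (2 * k)\<bar> + \<bar>jump (2 * k + 1)\<bar>" for x
    by (auto simp: haar_def indicator_def)
  then show ?thesis by blast
qed

lemma haar_child:
  assumes "k \<ge> 1" "v \<in> {2 * k, 2 * k + 1}" "x \<in> cell v"
  shows "haar k x = jump v"
  using assms cell_children[OF assms(1)] by (auto simp: haar_def)

lemma haar_outside:
  assumes "k \<ge> 1" "x \<notin> cell k"
  shows "haar k x = 0"
  using assms cell_children[OF assms(1)] by (auto simp: haar_def)

text \<open>A quantity accumulated along the ancestors of v, with the constant function seen at the
  root. Leaving \<open>g\<close> open lets one recursion serve a martingale and its transform,
  linear in the jump, and the square function, quadratic in it.\<close>

fun path :: "(nat \<Rightarrow> real \<Rightarrow> 'b::ab_group_add) \<Rightarrow> nat \<Rightarrow> 'b" where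
  "path g v = (if v < 2 then g 0 1 else path g (v div 2) + g (v div 2) (jump v))"

declare path.simps [simp del]

lemma path_1: "path g (Suc 0) = g 0 1"
  by (simp add: path.simps)

lemma path_child:
  assumes "k \<ge> 1" "v \<in> {2 * k, 2 * k + 1}"
  shows "path g v = path g k + g k (jump v)"
  using assms by (auto simp: path.simps[of _ "2 * k"] path.simps[of _ "Suc (2 * k)"])

text \<open>At a point of leaf v only function 0 and the Haar functions of proper ancestors of v can
  be nonzero; \<open>g k 0 = 0\<close> removes the others from the sum.\<close>

lemma path_sum:
  fixes g :: "nat \<Rightarrow> real \<Rightarrow> 'b::ab_group_add"
  assumes "n \<ge> 1" "v \<in> {n..<2 * n}" "x \<in> cell v" "\<And>k. g k 0 = 0"
  shows "(\<Sum>k<n. g k (haar k x)) = path g v"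
  using assms(1-3)
proof (induction n arbitrary: v rule: leaf_induct)
  case base
  then have "v = Suc 0" by auto
  then show ?case by (simp add: path_1 haar_def)
next
  case (step n)
  note n = step(1)
  have nl: "n \<in> {n..<2 * n}" using n by auto
  consider "v \<in> {n..<2 * n} - {n}" | "v \<in> {2 * n, 2 * n + 1}" using step(3) unfolding leaves_Suc[OF n] by blast
  then show ?case
  proof cases
    case 1
    then have "x \<notin> cell n" using leaf_disjoint[OF n _ nl step(4)] by auto
    then show ?thesis using step(2)[of v] 1 step(4) haar_outside[OF n] assms(4) by simp
  next
    case 2
    then have "x \<in> cell n" using step(4) cell_children[OF n] by auto
    then show ?thesis using step(2)[OF nl] haar_child[OF n 2 step(4)] path_child[OF n 2, of g] by simp
  qed
qed

lemma haar_integral_powr: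
  assumes "n \<ge> 1" "p > 0"
  shows "(LINT x|M. \<bar>haar n x\<bar> powr p) = mu (2 * n) * \<bar>jump (2 * n)\<bar> powr p + mu (2 * n + 1) * \<bar>jump (2 * n + 1)\<bar> powr p"
proof -
  have "\<bar>haar n x\<bar> powr p = indicator (cell (2 * n)) x * \<bar>jump (2 * n)\<bar> powr p
      + indicator (cell (2 * n + 1)) x * \<bar>jump (2 * n + 1)\<bar> powr p" for x
    using assms cell_children[OF assms(1)] by (auto simp: haar_def indicator_def)
  then show ?thesis by (simp add: emeasure_eq_measure)
qed

subsection \<open>Inequalities for Haar sums\<close>

lemma path_nonneg:
  fixes g :: "nat \<Rightarrow> real \<Rightarrow> real"
  assumes "\<And>k t. g k t \<ge> 0"
  shows "path g v \<ge> 0"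
proof (induction v rule: less_induct)
  case (less v)
  then show ?case using assms by (subst path.simps) auto
qed

text \<open>A supermartingale argument: when a leaf is split, the weighted value on its children
  does not exceed the value on the leaf, because the jumps have mean zero, and the value at the root
  is at most 0.\<close>

lemma leaf_zigzag_le:
  fixes a \<theta> :: "nat \<Rightarrow> complex"
  assumes p: "1 < p" "p \<le> 2" and "n \<ge> 1" "\<And>k. norm (\<theta> k) \<le> 1"
  shows "(\<Sum>v\<in>{n..<2 * n}. mu v * zigzag p (path (\<lambda>k t. of_real t * a k) v)
      (path (\<lambda>k t. of_real t * (\<theta> k * a k)) v) (path (\<lambda>k t. (norm (a k))\<^sup>2 * t\<^sup>2) v)) \<le> 0"
  using assms(3)
proof (induction n rule: leaf_induct)
  case base
  have "{1..<2 * 1} = {Suc 0}" by auto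
  then show ?case
    using zigzag_start[OF p assms(4), of "a 0" 0] by (simp add: path_1 mult_nonneg_nonpos)
next
  case (step n)
  define X where "X v = path (\<lambda>k t. of_real t * a k) v" for v
  define Y where "Y v = path (\<lambda>k t. of_real t * (\<theta> k * a k)) v" for v
  define S where "S v = path (\<lambda>k t. (norm (a k))\<^sup>2 * t\<^sup>2) v" for v
  define U where "U v = zigzag p (X v) (Y v) (S v)" for v
  have S0: "S v \<ge> 0" for v unfolding S_def by (rule path_nonneg) simp
  have ch: "X v = X n + of_real (jump v) * a n" "Y v = Y n + of_real (jump v) * (\<theta> n * a n)"
    "S v = S n + (norm (a n))\<^sup>2 * (jump v)\<^sup>2" if "v \<in> {2 * n, 2 * n + 1}" for v
    unfolding X_def Y_def S_def by (rule path_child[OF step(1) that])+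
  have "mu (2 * n) * U (2 * n) + mu (2 * n + 1) * U (2 * n + 1) \<le> (mu (2 * n) + mu (2 * n + 1)) * U n"
    unfolding U_def ch[OF insertI1] ch[OF insertI2[OF singletonI]]
    by (rule zigzag_jensen[OF p assms(4) S0 _ _ jump_balance]) auto
  then have "mu (2 * n) * U (2 * n) + mu (2 * n + 1) * U (2 * n + 1) \<le> mu n * U n"
    using mu_split[OF step(1)] by simp
  then show ?case
    using step(2) unfolding sum_leaves_Suc[OF step(1)] U_def X_def Y_def S_def by linarith
qed

text \<open>\<open>zigzag\<close> plus its subtracted multiple of |x|^p dominates both |y|^p and
  S^(p/2), so the same leaf sum controls the transform and the square function.\<close>

lemma haar_sum_bounds:
  fixes a \<theta> :: "nat \<Rightarrow> complex"
  assumes p: "1 < p" "p \<le> 2" and n: "n \<ge> 1" and \<theta>: "\<And>k. norm (\<theta> k) \<le> 1"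
  shows "(LINT x|M. norm (\<Sum>k<n. \<theta> k * a k * haar k x) powr p)
      \<le> 3 / (p - 1) * (LINT x|M. norm (\<Sum>k<n. a k * haar k x) powr p)" (is ?A)
    and "(LINT x|M. (\<Sum>k<n. (norm (a k))\<^sup>2 * (haar k x)\<^sup>2) powr (p / 2))
      \<le> 3 / (p - 1) * (LINT x|M. norm (\<Sum>k<n. a k * haar k x) powr p)" (is ?B)
    and "integrable M (\<lambda>x. (\<Sum>k<n. (norm (a k))\<^sup>2 * (haar k x)\<^sup>2) powr (p / 2))"
proof -
  define X where "X v = path (\<lambda>k t. of_real t * a k) v" for v
  define Y where "Y v = path (\<lambda>k t. of_real t * (\<theta> k * a k)) v" for v
  define S where "S v = path (\<lambda>k t. (norm (a k))\<^sup>2 * t\<^sup>2) v" for v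
  have X: "(\<Sum>k<n. a k * haar k x) = X v" if "v \<in> {n..<2 * n}" "x \<in> cell v" for v x
    using path_sum[OF n that, of "\<lambda>k t. of_real t * a k"] by (simp add: X_def mult.commute)
  have Y: "(\<Sum>k<n. \<theta> k * a k * haar k x) = Y v" if "v \<in> {n..<2 * n}" "x \<in> cell v" for v x
    using path_sum[OF n that, of "\<lambda>k t. of_real t * (\<theta> k * a k)"] by (simp add: Y_def mult.commute)
  have S: "(\<Sum>k<n. (norm (a k))\<^sup>2 * (haar k x)\<^sup>2) = S v" if "v \<in> {n..<2 * n}" "x \<in> cell v" for v x
    using path_sum[OF n that, of "\<lambda>k t. (norm (a k))\<^sup>2 * t\<^sup>2"] by (simp add: S_def)
  have S0: "S v \<ge> 0" for v unfolding S_def by (rule path_nonneg) simp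
  have IX: "(LINT x|M. norm (\<Sum>k<n. a k * haar k x) powr p) = (\<Sum>v\<in>{n..<2 * n}. mu v * norm (X v) powr p)"
    by (rule leaf_integral(2)[OF n]) (simp add: X)
  have IY: "(LINT x|M. norm (\<Sum>k<n. \<theta> k * a k * haar k x) powr p) = (\<Sum>v\<in>{n..<2 * n}. mu v * norm (Y v) powr p)"
    by (rule leaf_integral(2)[OF n]) (simp add: Y)
  have IS: "(LINT x|M. (\<Sum>k<n. (norm (a k))\<^sup>2 * (haar k x)\<^sup>2) powr (p / 2)) = (\<Sum>v\<in>{n..<2 * n}. mu v * S v powr (p / 2))"
    by (rule leaf_integral(2)[OF n]) (simp add: S)
  show "integrable M (\<lambda>x. (\<Sum>k<n. (norm (a k))\<^sup>2 * (haar k x)\<^sup>2) powr (p / 2))"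
    by (rule leaf_integral(1)[OF n, of _ "\<lambda>v. S v powr (p / 2)"]) (simp add: S)
  have U: "(\<Sum>v\<in>{n..<2 * n}. mu v * zigzag p (X v) (Y v) (S v)) \<le> 0"
    unfolding X_def Y_def S_def by (rule leaf_zigzag_le[OF p n \<theta>])
  have split: "(\<Sum>v\<in>{n..<2 * n}. mu v * (zigzag p (X v) (Y v) (S v) + 3 / (p - 1) * norm (X v) powr p))
      \<le> 3 / (p - 1) * (\<Sum>v\<in>{n..<2 * n}. mu v * norm (X v) powr p)"
  proof -
    have eq: "(\<Sum>v\<in>{n..<2 * n}. mu v * (zigzag p (X v) (Y v) (S v) + c * norm (X v) powr p))
      = (\<Sum>v\<in>{n..<2 * n}. mu v * zigzag p (X v) (Y v) (S v)) + c * (\<Sum>v\<in>{n..<2 * n}. mu v * norm (X v) powr p)" for c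
      by (simp add: distrib_left sum.distrib sum_distrib_left mult_ac)
    show ?thesis unfolding eq using U by simp
  qed
  have "(\<Sum>v\<in>{n..<2 * n}. mu v * norm (Y v) powr p)
      \<le> (\<Sum>v\<in>{n..<2 * n}. mu v * (zigzag p (X v) (Y v) (S v) + 3 / (p - 1) * norm (X v) powr p))"
    by (intro sum_mono mult_left_mono zigzag_ge(1)[OF p(1) S0]) auto
  with split show ?A unfolding IX IY by linarith
  have "(\<Sum>v\<in>{n..<2 * n}. mu v * S v powr (p / 2))
      \<le> (\<Sum>v\<in>{n..<2 * n}. mu v * (zigzag p (X v) (Y v) (S v) + 3 / (p - 1) * norm (X v) powr p))"
    by (intro sum_mono mult_left_mono zigzag_ge(2)[OF p(1) S0]) auto
  with split show ?B unfolding IX IS by linarith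
qed

text \<open>Type p of the Haar system: splitting a leaf adds at most 6 times the p-th moment of the
  new term, since the linear term of the expansion integrates to zero.\<close>

lemma haar_type:
  fixes a :: "nat \<Rightarrow> complex"
  assumes p: "1 < p" "p \<le> 2" and "n \<ge> 1"
  shows "(LINT x|M. norm (\<Sum>k<n. a k * haar k x) powr p) \<le> 6 * (\<Sum>k<n. norm (a k) powr p * (LINT x|M. \<bar>haar k x\<bar> powr p))"
proof -
  define X where "X v = path (\<lambda>k t. of_real t * a k) v" for v
  have X: "(\<Sum>k<n. a k * haar k x) = X v" if "n \<ge> 1" "v \<in> {n..<2 * n}" "x \<in> cell v" for v x n
    using path_sum[OF that, of "\<lambda>k t. of_real t * a k"] by (simp add: X_def mult.commute)
  have IX: "(LINT x|M. norm (\<Sum>k<n. a k * haar k x) powr p) = (\<Sum>v\<in>{n..<2 * n}. mu v * norm (X v) powr p)"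
    by (rule leaf_integral(2)[OF assms(3)]) (simp add: X[OF assms(3)])
  have "(\<Sum>v\<in>{n..<2 * n}. mu v * norm (X v) powr p) \<le> 6 * (\<Sum>k<n. norm (a k) powr p * (LINT x|M. \<bar>haar k x\<bar> powr p))"
    using assms(3)
  proof (induction n rule: leaf_induct)
    case base
    have "{1..<2 * 1} = {Suc 0}" by auto
    then show ?case by (simp add: X_def path_1 haar_def)
  next
    case (step n)
    define c where "c = p * norm (X n) powr (p - 2) * (X n \<bullet> a n)"
    have child: "mu v * norm (X v) powr p \<le> mu v * norm (X n) powr p + c * (mu v * jump v) + 6 * norm (a n) powr p * (mu v * \<bar>jump v\<bar> powr p)"
      if v: "v \<in> {2 * n, 2 * n + 1}" for v
    proof -
      have Xv: "X v = X n + of_real (jump v) * a n" unfolding X_def by (rule path_child[OF step(1) v])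
      have in_: "X n \<bullet> (of_real (jump v) * a n) = jump v * (X n \<bullet> a n)"
        by (simp flip: scaleR_conv_of_real)
      have "norm (X v) powr p \<le> norm (X n) powr p + c * jump v + 6 * (norm (a n) powr p * \<bar>jump v\<bar> powr p)"
        using norm_add_powr_expand[OF p, of "X n" "of_real (jump v) * a n"] unfolding Xv in_ c_def
        by (simp add: norm_mult powr_mult mult_ac)
      from mult_left_mono[OF this, of "mu v"] show ?thesis by (simp add: algebra_simps)
    qed
    have "c * (mu (2 * n) * jump (2 * n)) + c * (mu (2 * n + 1) * jump (2 * n + 1)) = 0"
      using jump_balance[of n] by (metis distrib_left mult_zero_right)
    then have "mu (2 * n) * norm (X (2 * n)) powr p + mu (2 * n + 1) * norm (X (2 * n + 1)) powr p
      \<le> mu n * norm (X n) powr p + 6 * (norm (a n) powr p * (LINT x|M. \<bar>haar n x\<bar> powr p))"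
      using child[of "2 * n"] child[of "2 * n + 1"] p haar_integral_powr[OF step(1), of p] mu_split[OF step(1)]
      by (simp add: algebra_simps)
    then show ?case
      using step(2) unfolding sum_leaves_Suc[OF step(1)] by simp
  qed
  then show ?thesis unfolding IX .
qed

end

lemma Lp_cong:
  assumes "\<And>x. x \<in> space M \<Longrightarrow> f x = g x"
  shows "f \<in> Lp_space M p \<longleftrightarrow> g \<in> Lp_space M p" "Lp_norm M p f = Lp_norm M p g"
proof -
  have "f \<in> borel_measurable M \<longleftrightarrow> g \<in> borel_measurable M" using assms by (rule measurable_cong)
  moreover have "integrable M (\<lambda>x. norm (f x) powr p) \<longleftrightarrow> integrable M (\<lambda>x. norm (g x) powr p)"
    using assms by (intro Bochner_Integration.integrable_cong) auto
  ultimately show "f \<in> Lp_space M p \<longleftrightarrow> g \<in> Lp_space M p" unfolding Lp_space_def by simp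
  show "Lp_norm M p f = Lp_norm M p g"
    unfolding Lp_norm_def using assms by (intro arg_cong2[where f = "(powr)"] Bochner_Integration.integral_cong) auto
qed

text \<open>For exponents p / 2 <= 1 Minkowski's inequality reverses. Each square is weighted by its
  share \<open>l k\<close> of the total A of the left side; concavity is applied pointwise, and the
  integral of the weighted powers is exactly A^(p/2).\<close>

lemma reverse_Minkowski_squares:
  fixes a :: "nat \<Rightarrow> complex" and h :: "nat \<Rightarrow> 'a \<Rightarrow> real"
  assumes p: "0 < p" "p \<le> 2" and F: "finite F"
    and h: "\<And>k. k \<in> F \<Longrightarrow> integrable M (\<lambda>x. \<bar>h k x\<bar> powr p)"
    and S: "integrable M (\<lambda>x. (\<Sum>k\<in>F. (norm (a k))\<^sup>2 * (h k x)\<^sup>2) powr (p / 2))"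
  shows "(\<Sum>k\<in>F. (norm (a k))\<^sup>2 * ((LINT x|M. \<bar>h k x\<bar> powr p) powr (1 / p))\<^sup>2) powr (p / 2)
    \<le> (LINT x|M. (\<Sum>k\<in>F. (norm (a k))\<^sup>2 * (h k x)\<^sup>2) powr (p / 2))"
proof -
  define v where "v k = (LINT x|M. \<bar>h k x\<bar> powr p) powr (1 / p)" for k
  have vp: "v k powr p = (LINT x|M. \<bar>h k x\<bar> powr p)" for k using p by (simp add: v_def powr_powr)
  define A where "A = (\<Sum>k\<in>F. (norm (a k))\<^sup>2 * (v k)\<^sup>2)"
  show ?thesis
  proof (cases "A = 0")
    case True
    then show ?thesis using p by (simp add: A_def v_def)
  next
    case False
    moreover have "A \<ge> 0" unfolding A_def by (intro sum_nonneg) auto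
    ultimately have A: "A > 0" by simp
    define l where "l k = (norm (a k))\<^sup>2 * (v k)\<^sup>2 / A" for k
    have l: "l k \<ge> 0" for k using A by (simp add: l_def)
    have l1: "sum l F = 1" using A by (simp add: l_def A_def sum_divide_distrib[symmetric])
    \<comment> \<open>Scaled so that \<open>l k * y k x\<close> is the original square; where
      \<open>v k\<close> vanishes, so does the weight.\<close>
    define y where "y k x = A * (h k x)\<^sup>2 / (v k)\<^sup>2" for k x
    have y0: "y k x \<ge> 0" for k x using A by (simp add: y_def)
    have yp: "y k x powr (p / 2) = A powr (p / 2) / v k powr p * \<bar>h k x\<bar> powr p" for k x
      using A norm_square_powr_half[of "complex_of_real (h k x)" p] norm_square_powr_half[of "complex_of_real (v k)" p]
      by (simp add: y_def powr_divide powr_mult) (simp add: v_def)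
    have pw: "(\<Sum>k\<in>F. l k * y k x powr (p / 2)) \<le> (\<Sum>k\<in>F. (norm (a k))\<^sup>2 * (h k x)\<^sup>2) powr (p / 2)" for x
    proof -
      have "(\<Sum>k\<in>F. l k * y k x powr (p / 2)) \<le> (\<Sum>k\<in>F. l k * y k x) powr (p / 2)"
        using p F l l1 y0 by (intro sum_powr_concave) auto
      also have "\<dots> \<le> (\<Sum>k\<in>F. (norm (a k))\<^sup>2 * (h k x)\<^sup>2) powr (p / 2)"
        using p A l y0 by (intro powr_mono2 sum_mono sum_nonneg) (auto simp: l_def y_def)
      finally show ?thesis .
    qed
    have "(LINT x|M. (\<Sum>k\<in>F. l k * y k x powr (p / 2))) = (\<Sum>k\<in>F. l k * (A powr (p / 2) / v k powr p * v k powr p))"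
      unfolding yp vp using h by (subst Bochner_Integration.integral_sum) (auto intro!: sum.cong)
    also have "\<dots> = (\<Sum>k\<in>F. l k * A powr (p / 2))"
      by (intro sum.cong) (auto simp: l_def)
    also have "\<dots> = A powr (p / 2)" using l1 by (simp add: sum_distrib_right[symmetric])
    finally have "A powr (p / 2) = (LINT x|M. (\<Sum>k\<in>F. l k * y k x powr (p / 2)))" ..
    also have "\<dots> \<le> (LINT x|M. (\<Sum>k\<in>F. (norm (a k))\<^sup>2 * (h k x)\<^sup>2) powr (p / 2))"
      using pw S h unfolding yp by (intro integral_mono Bochner_Integration.integrable_sum integrable_mult_right) auto
    finally show ?thesis unfolding A_def v_def .
  qed
qed

context haar_tree
begin

subsection \<open>Haar coefficients\<close>

definition mean :: "('a \<Rightarrow> complex) \<Rightarrow> nat \<Rightarrow> complex" where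
  "mean f v = (LINT x|M. indicator (cell v) x * f x) / mu v"

text \<open>The scaling matches the unnormalized Haar functions: if both children have positive
  measure, jump times coefficient is the change of the mean from a cell to its child.\<close>

definition coef :: "('a \<Rightarrow> complex) \<Rightarrow> nat \<Rightarrow> complex" where
  "coef f k = (if k = 0 then mean f 1 else (mean f (2 * k) - mean f (2 * k + 1)) / mu k)"

lemma integrable_cell:
  fixes f :: "'a \<Rightarrow> complex"
  assumes "integrable M f"
  shows "integrable M (\<lambda>x. indicator (cell v) x * f x)"
  using integrable_mult_indicator[OF cell_sets assms]
  by (rule Bochner_Integration.integrable_cong[THEN iffD1, rotated 2]) (auto simp: indicator_def)

lemma Lp_integrable:
  assumes "f \<in> Lp_space M p" "p \<ge> 1"
  shows "integrable M f"
  using norm_integral_indicator_le(1)[OF finite_measure_axioms _ assms, of "{}"] by simp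

lemma integral_cell:
  "(LINT x|M. indicator (cell v) x * f x) = mu v * mean f v"
proof (cases "mu v = 0")
  case True
  then have "cell v \<in> null_sets M" by (auto simp: emeasure_eq_measure intro!: null_setsI)
  then have "AE x in M. indicator (cell v) x * f x = 0"
    using AE_not_in[of "cell v" M] by (auto elim!: eventually_mono)
  then show ?thesis using True integral_eq_zero_AE[of "\<lambda>x. indicator (cell v) x * f x" M] by simp
qed (simp add: mean_def)

lemma mean_split:
  assumes "integrable M f" "k \<ge> 1"
  shows "mu k * mean f k = mu (2 * k) * mean f (2 * k) + mu (2 * k + 1) * mean f (2 * k + 1)"
proof -
  have "(LINT x|M. indicator (cell k) x * f x)
      = (LINT x|M. indicator (cell (2 * k)) x * f x + indicator (cell (2 * k + 1)) x * f x)"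
    unfolding cell_children[OF assms(2)] by (intro Bochner_Integration.integral_cong) (auto simp: indicator_def)
  also have "\<dots> = (LINT x|M. indicator (cell (2 * k)) x * f x) + (LINT x|M. indicator (cell (2 * k + 1)) x * f x)"
    by (intro Bochner_Integration.integral_add integrable_cell assms)
  finally show ?thesis unfolding integral_cell .
qed

text \<open>The changes of the mean telescope along the ancestors, all of which have positive
  measure when v has.\<close>

lemma path_coef:
  assumes "integrable M f" "v \<ge> 1" "mu v \<noteq> 0"
  shows "path (\<lambda>k t. of_real t * coef f k) v = mean f v"
  using assms(2,3)
proof (induction v rule: less_induct)
  case (less v)
  show ?case
  proof (cases "v = 1")
    case True
    then show ?thesis by (simp add: path_1 coef_def)
  next
    case False
    define k where "k = v div 2"
    have k: "k \<ge> 1" "k < v" using False less(2) by (auto simp: k_def)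
    have vk: "v \<in> {2 * k, 2 * k + 1}" by (auto simp: k_def)
    have "mu v \<le> mu k"
      using vk mu_split[OF k(1)] by auto
    then have muk: "mu k \<noteq> 0" using less(3) measure_nonneg[of M "cell v"] by linarith
    have IH: "path (\<lambda>k t. of_real t * coef f k) k = mean f k" using less(1) k muk by blast
    have mc: "complex_of_real (mu k) = complex_of_real (mu (2 * k)) + complex_of_real (mu (2 * k + 1))"
      using mu_split[OF k(1)] by simp
    have "mu k * (mean f k + of_real (jump v) * coef f k) = mu k * mean f k + of_real (jump v) * (mean f (2 * k) - mean f (2 * k + 1))"
      using k muk by (simp add: coef_def distrib_left)
    also have "\<dots> = mu k * mean f v"
    proof (cases "v = 2 * k")
      case True
      then show ?thesis
        unfolding mean_split[OF assms(1) k(1)] unfolding mc using less(3) by (simp add: jump_def algebra_simps)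
    next
      case False
      then have "v = 2 * k + 1" using vk by simp
      then show ?thesis
        unfolding mean_split[OF assms(1) k(1)] unfolding mc using less(3) by (simp add: jump_def algebra_simps)
    qed
    finally have "mean f k + of_real (jump v) * coef f k = mean f v" using muk by simp
    then show ?thesis using path_child[OF k(1) vk, of "\<lambda>k t. of_real t * coef f k"] IH by simp
  qed
qed

lemma coef_linear:
  assumes "integrable M f" "integrable M g"
  shows "coef (\<lambda>x. f x + g x) k = coef f k + coef g k" "coef (\<lambda>x. c * f x) k = c * coef f k"
proof -
  have "mean (\<lambda>x. f x + g x) v = mean f v + mean g v" for v
  proof -
    have "(LINT x|M. indicator (cell v) x * (f x + g x)) = (LINT x|M. indicator (cell v) x * f x + indicator (cell v) x * g x)"
      by (simp add: distrib_left)
    also have "\<dots> = (LINT x|M. indicator (cell v) x * f x) + (LINT x|M. indicator (cell v) x * g x)"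
      by (intro Bochner_Integration.integral_add integrable_cell assms)
    finally show ?thesis by (simp add: mean_def add_divide_distrib)
  qed
  then show "coef (\<lambda>x. f x + g x) k = coef f k + coef g k"
    by (simp add: coef_def diff_divide_distrib add_divide_distrib)
  have "mean (\<lambda>x. c * f x) v = c * mean f v" for v
  proof -
    have "(LINT x|M. indicator (cell v) x * (c * f x)) = (LINT x|M. c * (indicator (cell v) x * f x))"
      by (simp add: mult.left_commute)
    then show ?thesis by (simp add: mean_def)
  qed
  then show "coef (\<lambda>x. c * f x) k = c * coef f k" by (simp add: coef_def right_diff_distrib)
qed

lemma sum_integral_leaves:
  fixes G :: "'a \<Rightarrow> real"
  assumes "n \<ge> 1" "integrable M G"
  shows "(\<Sum>v\<in>{n..<2 * n}. (LINT x|M. indicator (cell v) x * G x)) = (LINT x|M. G x)"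
proof -
  have int: "integrable M (\<lambda>x. indicator (cell v) x * G x)" for v
    using integrable_mult_indicator[OF cell_sets assms(2)] by simp
  have "(\<Sum>v\<in>{n..<2 * n}. (LINT x|M. indicator (cell v) x * G x)) = (LINT x|M. (\<Sum>v\<in>{n..<2 * n}. indicator (cell v) x * G x))"
    by (rule Bochner_Integration.integral_sum[OF int, symmetric])
  also have "\<dots> = (LINT x|M. G x)"
  proof (rule Bochner_Integration.integral_cong[OF refl])
    fix x assume x: "x \<in> space M"
    obtain v where v: "v \<in> {n..<2 * n}" "x \<in> cell v" using leaf_cover[OF assms(1) x] by blast
    have "(\<Sum>v\<in>{n..<2 * n}. indicator (cell v) x * G x) = (\<Sum>w\<in>{v}. indicator (cell w) x * G x)"
    proof (rule sum.mono_neutral_right)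
      have "x \<notin> cell w" if "w \<in> {n..<2 * n} - {v}" for w
        using leaf_disjoint[OF assms(1) _ v(1) _ v(2), of w] that by blast
      then show "\<forall>w\<in>{n..<2 * n} - {v}. indicator (cell w) x * G x = 0" by simp
    qed (use v in auto)
    then show "(\<Sum>v\<in>{n..<2 * n}. indicator (cell v) x * G x) = G x" using v by simp
  qed
  finally show ?thesis .
qed

text \<open>Up to null sets the partial Haar sum is the conditional expectation on the leaves;
  Jensen's inequality on each leaf gives the contraction.\<close>

lemma expectation_contraction:
  assumes "p \<ge> 1" "n \<ge> 1" "f \<in> Lp_space M p"
  shows "(LINT x|M. norm (\<Sum>k<n. coef f k * haar k x) powr p) \<le> (LINT x|M. norm (f x) powr p)"
proof -
  define X where "X v = path (\<lambda>k t. of_real t * coef f k) v" for v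
  have X: "(\<Sum>k<n. coef f k * haar k x) = X v" if "v \<in> {n..<2 * n}" "x \<in> cell v" for v x
    using path_sum[OF assms(2) that, of "\<lambda>k t. of_real t * coef f k"] by (simp add: X_def mult.commute)
  have fi: "integrable M f" using Lp_integrable assms by blast
  have "(LINT x|M. norm (\<Sum>k<n. coef f k * haar k x) powr p) = (\<Sum>v\<in>{n..<2 * n}. mu v * norm (X v) powr p)"
    by (rule leaf_integral(2)[OF assms(2)]) (simp add: X)
  also have "\<dots> \<le> (\<Sum>v\<in>{n..<2 * n}. (LINT x|M. indicator (cell v) x * norm (f x) powr p))"
  proof (rule sum_mono)
    fix v assume v: "v \<in> {n..<2 * n}"
    show "mu v * norm (X v) powr p \<le> (LINT x|M. indicator (cell v) x * norm (f x) powr p)"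
    proof (cases "mu v = 0")
      case True
      have "(LINT x|M. indicator (cell v) x * norm (f x) powr p) \<ge> 0"
        by (intro integral_nonneg_AE AE_I2) (auto simp: indicator_def)
      with True show ?thesis by simp
    next
      case False
      then have m: "mu v > 0" by (simp add: less_le)
      have "X v = mean f v" unfolding X_def using v assms(2) False fi by (intro path_coef) auto
      then have "(mu v * norm (X v)) powr p = norm (LINT x|M. indicator (cell v) x * f x) powr p"
        unfolding integral_cell by (simp add: norm_mult)
      also have "\<dots> \<le> mu v powr (p - 1) * (LINT x|M. indicator (cell v) x * norm (f x) powr p)"
        by (rule norm_integral_indicator_le(2)[OF finite_measure_axioms cell_sets assms(3,1)])
      finally have "mu v powr (p - 1) * (mu v * norm (X v) powr p) \<le> mu v powr (p - 1) * (LINT x|M. indicator (cell v) x * norm (f x) powr p)"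
        using m by (simp add: powr_mult powr_diff)
      then show ?thesis using m by simp
    qed
  qed
  also have "\<dots> = (LINT x|M. norm (f x) powr p)"
    by (rule sum_integral_leaves[OF assms(2) Lp_spaceD(2)[OF assms(3)]])
  finally show ?thesis .
qed

lemma haar_Lp:
  assumes "p > 0"
  shows "(\<lambda>x. complex_of_real (haar k x)) \<in> Lp_space M p"
proof -
  obtain b where "\<And>x. \<bar>haar k x\<bar> \<le> b" using haar_bounded by blast
  then show ?thesis using assms by (intro Lp_space_bounded[OF finite_measure_axioms]) auto
qed

definition haar_norm :: "real \<Rightarrow> nat \<Rightarrow> real" where
  "haar_norm p k = (LINT x|M. \<bar>haar k x\<bar> powr p) powr (1 / p)"

text \<open>The zero comes from the jumps and therefore holds at every point, which makes later
  divisions by a vanishing \<open>haar_norm\<close> harmless.\<close>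

lemma haar_norm_zero:
  assumes "p > 0" "measure M (space M) > 0" "haar_norm p k = 0"
  shows "haar k x = 0"
proof -
  have 0: "(LINT x|M. \<bar>haar k x\<bar> powr p) = 0" using assms by (simp add: haar_norm_def)
  have k: "k \<ge> 1"
  proof (rule ccontr)
    assume "\<not> k \<ge> 1"
    then have "(LINT x|M. \<bar>haar k x\<bar> powr p) = measure M (space M)" by (simp add: haar_def)
    then show False using 0 assms by simp
  qed
  have "mu (2 * k) * \<bar>jump (2 * k)\<bar> powr p = 0" "mu (2 * k + 1) * \<bar>jump (2 * k + 1)\<bar> powr p = 0"
    using 0 unfolding haar_integral_powr[OF k assms(1)]
    by (metis add_nonneg_eq_0_iff measure_nonneg mult_nonneg_nonneg powr_ge_zero)+
  then have "jump (2 * k) = 0" "jump (2 * k + 1) = 0" by (auto simp: jump_def)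
  then show ?thesis using k by (simp add: haar_def)
qed

text \<open>A finite set is completed to an initial segment by a multiplier that is zero off F, so
  the martingale estimate covers arbitrary finite subsets.\<close>

lemma haar_multiplier:
  assumes p: "1 < p" "p \<le> 2" and F: "finite F" and f: "f \<in> Lp_space M p" and \<theta>: "\<And>k. norm (\<theta> k) \<le> 1"
  shows "Lp_norm M p (\<lambda>x. \<Sum>k\<in>F. \<theta> k * coef f k * haar k x) \<le> (3 / (p - 1)) powr (1 / p) * Lp_norm M p f"
proof -
  define n where "n = Suc (Max (insert 0 F))"
  have n: "n \<ge> 1" "F \<subseteq> {..<n}" using F by (auto simp: n_def less_Suc_eq_le)
  define \<theta>' where "\<theta>' k = (if k \<in> F then \<theta> k else 0)" for k
  have \<theta>': "norm (\<theta>' k) \<le> 1" for k using \<theta> by (simp add: \<theta>'_def)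
  have eq: "(\<Sum>k<n. \<theta>' k * coef f k * haar k x) = (\<Sum>k\<in>F. \<theta> k * coef f k * haar k x)" for x
  proof -
    have "(\<Sum>k<n. \<theta>' k * coef f k * haar k x) = (\<Sum>k\<in>F. \<theta>' k * coef f k * haar k x)"
      using n by (intro sum.mono_neutral_right) (auto simp: \<theta>'_def)
    then show ?thesis by (simp add: \<theta>'_def)
  qed
  have "(LINT x|M. norm (\<Sum>k\<in>F. \<theta> k * coef f k * haar k x) powr p)
      \<le> 3 / (p - 1) * (LINT x|M. norm (\<Sum>k<n. coef f k * haar k x) powr p)"
    using haar_sum_bounds(1)[OF p n(1), where \<theta> = \<theta>' and a = "coef f", OF \<theta>'] unfolding eq .
  also have "\<dots> \<le> 3 / (p - 1) * (LINT x|M. norm (f x) powr p)"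
    using p by (intro mult_left_mono expectation_contraction n f) auto
  also have "\<dots> = ((3 / (p - 1)) powr (1 / p) * Lp_norm M p f) powr p"
    using p by (simp add: powr_mult powr_powr Lp_norm_powr)
  finally show ?thesis using p by (subst Lp_norm_le_iff) auto
qed

text \<open>The reverse Minkowski inequality passes from the coefficients to the L^p norm of the
  square function, which the Haar sum and then f itself dominate.\<close>

lemma haar_square:
  assumes p: "1 < p" "p \<le> 2" and F: "finite F" and f: "f \<in> Lp_space M p"
  shows "(\<Sum>k\<in>F. (norm (coef f k))\<^sup>2 * (haar_norm p k)\<^sup>2) \<le> ((3 / (p - 1)) powr (1 / p) * Lp_norm M p f)\<^sup>2"
proof -
  define n where "n = Suc (Max (insert 0 F))"
  have n: "n \<ge> 1" "F \<subseteq> {..<n}" using F by (auto simp: n_def less_Suc_eq_le)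
  let ?A = "\<Sum>k<n. (norm (coef f k))\<^sup>2 * (haar_norm p k)\<^sup>2"
  have "?A powr (p / 2) \<le> (LINT x|M. (\<Sum>k<n. (norm (coef f k))\<^sup>2 * (haar k x)\<^sup>2) powr (p / 2))"
    unfolding haar_norm_def
    using Lp_spaceD(2)[OF haar_Lp, of p] p haar_sum_bounds(3)[OF p n(1), where \<theta> = "\<lambda>_. 0"]
    by (intro reverse_Minkowski_squares) auto
  also have "\<dots> \<le> 3 / (p - 1) * (LINT x|M. norm (\<Sum>k<n. coef f k * haar k x) powr p)"
    by (rule haar_sum_bounds(2)[OF p n(1), where \<theta> = "\<lambda>_. 0"]) simp
  also have "\<dots> \<le> 3 / (p - 1) * (LINT x|M. norm (f x) powr p)"
    using p by (intro mult_left_mono expectation_contraction n f) auto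
  also have "\<dots> = ((3 / (p - 1)) powr (1 / p) * Lp_norm M p f) powr p"
    using p by (simp add: powr_mult powr_powr Lp_norm_powr)
  also have "\<dots> = (((3 / (p - 1)) powr (1 / p) * Lp_norm M p f)\<^sup>2) powr (p / 2)"
  proof -
    have "c powr p = c\<^sup>2 powr (p / 2)" if "c \<ge> 0" for c :: real
      using norm_square_powr_half[of "complex_of_real c" p] that by simp
    then show ?thesis by simp
  qed
  finally have "?A \<le> ((3 / (p - 1)) powr (1 / p) * Lp_norm M p f)\<^sup>2"
    by (rule powr_le_powrD) (use p in auto)
  moreover have "(\<Sum>k\<in>F. (norm (coef f k))\<^sup>2 * (haar_norm p k)\<^sup>2) \<le> ?A"
    using n by (intro sum_mono2) auto
  ultimately show ?thesis by linarith
qed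

lemma haar_type_norm:
  fixes b :: "nat \<Rightarrow> complex"
  assumes p: "1 < p" "p \<le> 2" and F: "finite F"
  shows "Lp_norm M p (\<lambda>x. \<Sum>k\<in>F. b k * haar k x) \<le> (6 * (\<Sum>k\<in>F. (norm (b k) * haar_norm p k) powr p)) powr (1 / p)"
proof -
  define n where "n = Suc (Max (insert 0 F))"
  have n: "n \<ge> 1" "F \<subseteq> {..<n}" using F by (auto simp: n_def less_Suc_eq_le)
  define b' where "b' k = (if k \<in> F then b k else 0)" for k
  have eq: "(\<Sum>k<n. b' k * haar k x) = (\<Sum>k\<in>F. b k * haar k x)" for x
  proof -
    have "(\<Sum>k<n. b' k * haar k x) = (\<Sum>k\<in>F. b' k * haar k x)"
      using n by (intro sum.mono_neutral_right) (auto simp: b'_def)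
    then show ?thesis by (simp add: b'_def)
  qed
  have hp: "(LINT x|M. \<bar>haar k x\<bar> powr p) = haar_norm p k powr p" for k
    using p by (simp add: haar_norm_def powr_powr)
  have "(LINT x|M. norm (\<Sum>k\<in>F. b k * haar k x) powr p) \<le> 6 * (\<Sum>k<n. norm (b' k) powr p * haar_norm p k powr p)"
    using haar_type[OF p n(1), of b'] unfolding eq hp .
  also have "(\<Sum>k<n. norm (b' k) powr p * haar_norm p k powr p) = (\<Sum>k\<in>F. norm (b' k) powr p * haar_norm p k powr p)"
    using n by (intro sum.mono_neutral_right) (auto simp: b'_def)
  also have "\<dots> = (\<Sum>k\<in>F. (norm (b k) * haar_norm p k) powr p)"
    by (intro sum.cong) (auto simp: b'_def powr_mult)
  also have "6 * (\<Sum>k\<in>F. (norm (b k) * haar_norm p k) powr p)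
      = ((6 * (\<Sum>k\<in>F. (norm (b k) * haar_norm p k) powr p)) powr (1 / p)) powr p"
    using p by (simp add: powr_powr sum_nonneg)
  finally show ?thesis using p by (subst Lp_norm_le_iff) auto
qed

lemma coef_bounded:
  assumes "p \<ge> 1"
  shows "\<exists>C. \<forall>f\<in>Lp_space M p. norm (coef f k) \<le> C * Lp_norm M p f"
proof -
  have m: "\<exists>C. \<forall>f\<in>Lp_space M p. norm (mean f v) \<le> C * Lp_norm M p f" for v
  proof (intro exI[of _ "mu v powr (1 - 1 / p) / mu v"] ballI)
    fix f assume f: "f \<in> Lp_space M p"
    have "norm (mean f v) = norm (LINT x|M. indicator (cell v) x * f x) / mu v"
      by (simp add: mean_def norm_divide)
    also have "\<dots> \<le> (mu v powr (1 - 1 / p) * Lp_norm M p f) / mu v"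
      by (intro divide_right_mono norm_integral_le_Lp_norm[OF finite_measure_axioms cell_sets f assms]) auto
    finally show "norm (mean f v) \<le> mu v powr (1 - 1 / p) / mu v * Lp_norm M p f" by simp
  qed
  show ?thesis
  proof (cases "k = 0")
    case True
    then show ?thesis using m[of 1] by (simp add: coef_def)
  next
    case False
    obtain C D where C: "\<forall>f\<in>Lp_space M p. norm (mean f (2 * k)) \<le> C * Lp_norm M p f"
      and D: "\<forall>f\<in>Lp_space M p. norm (mean f (2 * k + 1)) \<le> D * Lp_norm M p f" using m by metis
    show ?thesis
    proof (intro exI[of _ "(C + D) / mu k"] ballI)
      fix f assume f: "f \<in> Lp_space M p"
      have "norm (mean f (2 * k) - mean f (2 * k + 1)) \<le> (C + D) * Lp_norm M p f"
        using C D f norm_triangle_ineq4[of "mean f (2 * k)" "mean f (2 * k + 1)"] by (fastforce simp: distrib_right)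
      then have "norm (mean f (2 * k) - mean f (2 * k + 1)) / mu k \<le> (C + D) * Lp_norm M p f / mu k"
        by (intro divide_right_mono) auto
      then show "norm (coef f k) \<le> (C + D) / mu k * Lp_norm M p f"
        using False by (simp add: coef_def norm_divide)
    qed
  qed
qed

subsection \<open>Density of the functions that are constant on the leaves\<close>

definition adapted :: "nat \<Rightarrow> ('a \<Rightarrow> complex) \<Rightarrow> bool" where
  "adapted n g \<longleftrightarrow> (\<forall>v\<in>{n..<2 * n}. \<forall>x\<in>cell v. \<forall>y\<in>cell v. g x = g y)"

lemma adapted_mono:
  assumes "n \<ge> 1" "n \<le> m" "adapted n g"
  shows "adapted m g"
  unfolding adapted_def
proof (intro ballI)
  fix w x y assume w: "w \<in> {m..<2 * m}" "x \<in> cell w" "y \<in> cell w"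
  obtain v where "v \<in> {n..<2 * n}" "cell w \<subseteq> cell v" using leaf_refine[OF assms(1,2) w(1)] by blast
  then show "g x = g y" using assms(3) w unfolding adapted_def by blast
qed

lemma mean_const:
  assumes "\<And>x. x \<in> cell v \<Longrightarrow> g x = c" "mu v \<noteq> 0"
  shows "mean g v = c"
proof -
  have "(LINT x|M. indicator (cell v) x * g x) = (LINT x|M. c * indicator (cell v) x)"
    using assms by (intro Bochner_Integration.integral_cong) (auto simp: indicator_def)
  also have "\<dots> = c * mu v" using integral_indicator_complex[OF cell_sets] by simp
  finally show ?thesis using assms(2) by (simp add: mean_def)
qed

text \<open>The product, not the coefficient, is what vanishes: on a null child the mean is 0 by
  convention, so the coefficient may survive, but then the Haar function is zero.\<close>

lemma adapted_coef:
  assumes "n \<ge> 1" "adapted n g" "k \<ge> n"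
  shows "coef g k * haar k x = 0"
proof (cases "mu (2 * k) = 0 \<or> mu (2 * k + 1) = 0")
  case True
  then have "jump (2 * k) = 0" "jump (2 * k + 1) = 0" by (auto simp: jump_def)
  then have "haar k x = 0" using assms by (simp add: haar_def)
  then show ?thesis by simp
next
  case False
  have k: "k \<ge> 1" using assms by simp
  obtain v where v: "v \<in> {n..<2 * n}" "cell k \<subseteq> cell v" using leaf_refine[OF assms(1,3), of k] k by auto
  have "cell k \<noteq> {}"
    using False cell_children[OF k] by (metis Int_empty_left measure_empty)
  then obtain y where y: "y \<in> cell k" by blast
  have c: "g x = g y" if "x \<in> cell k" for x
    using assms(2) v that y unfolding adapted_def by blast
  have "mean g (2 * k) = g y"
    using False c cell_children[OF k] by (intro mean_const) auto
  moreover have "mean g (2 * k + 1) = g y"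
    using False c cell_children[OF k] by (intro mean_const) auto
  ultimately show ?thesis using k by (simp add: coef_def)
qed

lemma adapted_expectation:
  assumes "p \<ge> 1" "n \<ge> 1" "adapted n g" "g \<in> Lp_space M p" "finite F" "{..<n} \<subseteq> F"
  shows "Lp_norm M p (\<lambda>x. (\<Sum>k\<in>F. coef g k * haar k x) - g x) = 0"
proof -
  define X where "X v = path (\<lambda>k t. of_real t * coef g k) v" for v
  define c where "c v = g (SOME x. x \<in> cell v)" for v
  have c: "g x = c v" if "v \<in> {n..<2 * n}" "x \<in> cell v" for v x
    using assms(3) that someI[of "\<lambda>x. x \<in> cell v", OF that(2)] unfolding adapted_def c_def by blast
  have eq: "(\<Sum>k\<in>F. coef g k * haar k x) = (\<Sum>k<n. coef g k * haar k x)" for x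
    using assms(5,6) adapted_coef[OF assms(2,3)] by (intro sum.mono_neutral_right) auto
  have X: "(\<Sum>k\<in>F. coef g k * haar k x) = X v" if "v \<in> {n..<2 * n}" "x \<in> cell v" for v x
    using path_sum[OF assms(2) that, of "\<lambda>k t. of_real t * coef g k"] unfolding eq by (simp add: X_def mult.commute)
  have "(LINT x|M. norm ((\<Sum>k\<in>F. coef g k * haar k x) - g x) powr p) = (\<Sum>v\<in>{n..<2 * n}. mu v * norm (X v - c v) powr p)"
    by (rule leaf_integral(2)[OF assms(2)]) (simp add: X c)
  also have "\<dots> = 0"
  proof (rule sum.neutral, rule ballI)
    fix v assume v: "v \<in> {n..<2 * n}"
    show "mu v * norm (X v - c v) powr p = 0"
    proof (cases "mu v = 0")
      case False
      have "X v = mean g v" unfolding X_def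
        using v assms False Lp_integrable[OF assms(4,1)] by (intro path_coef) auto
      also have "\<dots> = c v" using c[OF v] False by (intro mean_const)
      finally show ?thesis by simp
    qed simp
  qed
  finally show ?thesis unfolding Lp_norm_def by simp
qed

definition approximable :: "real \<Rightarrow> ('a \<Rightarrow> complex) \<Rightarrow> bool" where
  "approximable p f \<longleftrightarrow> f \<in> Lp_space M p \<and>
     (\<forall>e>0. \<exists>n\<ge>1. \<exists>g\<in>Lp_space M p. adapted n g \<and> Lp_norm M p (\<lambda>x. f x - g x) < e)"

lemma approximable_add:
  assumes p: "p \<ge> 1" and "approximable p f" "approximable p g"
  shows "approximable p (\<lambda>x. f x + g x)"
  unfolding approximable_def
proof (intro conjI allI impI)
  have fg: "f \<in> Lp_space M p" "g \<in> Lp_space M p" using assms unfolding approximable_def by auto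
  show "(\<lambda>x. f x + g x) \<in> Lp_space M p" using fg p by (intro Lp_space_add) auto
  fix e :: real assume e: "e > 0"
  have e2: "e / 2 > 0" using e by simp
  obtain n f' where f': "n \<ge> 1" "f' \<in> Lp_space M p" "adapted n f'" "Lp_norm M p (\<lambda>x. f x - f' x) < e / 2"
    using assms(2) e2 unfolding approximable_def by metis
  obtain m g' where g': "m \<ge> 1" "g' \<in> Lp_space M p" "adapted m g'" "Lp_norm M p (\<lambda>x. g x - g' x) < e / 2"
    using assms(3) e2 unfolding approximable_def by metis
  have "adapted (max n m) f'" "adapted (max n m) g'"
    using f' g' by (auto intro: adapted_mono[of n] adapted_mono[of m])
  then have ad: "adapted (max n m) (\<lambda>x. f' x + g' x)" unfolding adapted_def by metis
  have "(\<lambda>x. f x + g x - (f' x + g' x)) = (\<lambda>x. (f x - f' x) + (g x - g' x))" by auto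
  then have "Lp_norm M p (\<lambda>x. f x + g x - (f' x + g' x)) \<le> Lp_norm M p (\<lambda>x. f x - f' x) + Lp_norm M p (\<lambda>x. g x - g' x)"
    using p fg f' g' by (simp only:) (intro Lp_norm_triangle Lp_space_diff; simp)
  then have lt: "Lp_norm M p (\<lambda>x. f x + g x - (f' x + g' x)) < e" using f' g' by linarith
  show "\<exists>n\<ge>1. \<exists>h\<in>Lp_space M p. adapted n h \<and> Lp_norm M p (\<lambda>x. f x + g x - h x) < e"
    using f' g' ad lt p by (intro exI[of _ "max n m"] conjI bexI[of _ "\<lambda>x. f' x + g' x"] Lp_space_add) auto
qed

lemma approximable_scale:
  assumes p: "p \<ge> 1" and "approximable p f"
  shows "approximable p (\<lambda>x. c * f x)"
  unfolding approximable_def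
proof (intro conjI allI impI)
  have f: "f \<in> Lp_space M p" using assms unfolding approximable_def by auto
  show "(\<lambda>x. c * f x) \<in> Lp_space M p" using f by (rule Lp_space_scale)
  fix e :: real assume e: "e > 0"
  then have "e / (norm c + 1) > 0" by (simp add: add_nonneg_pos)
  then obtain n f' where f': "n \<ge> 1" "f' \<in> Lp_space M p" "adapted n f'" "Lp_norm M p (\<lambda>x. f x - f' x) < e / (norm c + 1)"
    using assms(2) unfolding approximable_def by metis
  have "Lp_norm M p (\<lambda>x. c * f x - c * f' x) = norm c * Lp_norm M p (\<lambda>x. f x - f' x)"
    using p by (simp add: Lp_norm_scale flip: right_diff_distrib)
  also have "\<dots> \<le> (norm c + 1) * Lp_norm M p (\<lambda>x. f x - f' x)" by (intro mult_right_mono) auto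
  also have "\<dots> < e" using f'(4) by (simp add: pos_less_divide_eq add_nonneg_pos mult.commute)
  finally have "Lp_norm M p (\<lambda>x. c * f x - c * f' x) < e" .
  moreover have "adapted n (\<lambda>x. c * f' x)" using f'(3) unfolding adapted_def by metis
  ultimately show "\<exists>n\<ge>1. \<exists>h\<in>Lp_space M p. adapted n h \<and> Lp_norm M p (\<lambda>x. c * f x - h x) < e"
    using f' by (intro exI[of _ n] conjI bexI[of _ "\<lambda>x. c * f' x"] Lp_space_scale) auto
qed

lemma approximable_zero: "approximable p (\<lambda>x. 0)"
  unfolding approximable_def
  by (auto intro!: exI[of _ 1] bexI[of _ "\<lambda>x. 0"] simp: adapted_def)

lemma approximable_sum:
  assumes "p \<ge> 1" "finite F" "\<And>i. i \<in> F \<Longrightarrow> approximable p (f i)"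
  shows "approximable p (\<lambda>x. \<Sum>i\<in>F. f i x)"
  using assms(2,3)
proof (induction F)
  case (insert i F)
  then show ?case using approximable_add[OF assms(1), of "f i" "\<lambda>x. \<Sum>i\<in>F. f i x"] by simp
qed (simp add: approximable_zero)

lemma approximable_closed:
  assumes p: "p \<ge> 1" and f: "f \<in> Lp_space M p"
    and "\<And>e. e > 0 \<Longrightarrow> \<exists>g. approximable p g \<and> Lp_norm M p (\<lambda>x. f x - g x) < e"
  shows "approximable p f"
  unfolding approximable_def
proof (intro conjI f allI impI)
  fix e :: real assume "e > 0"
  then have e2: "e / 2 > 0" by simp
  obtain g where g: "approximable p g" "Lp_norm M p (\<lambda>x. f x - g x) < e / 2" using assms(3)[OF e2] by blast
  obtain n h where h: "n \<ge> 1" "h \<in> Lp_space M p" "adapted n h" "Lp_norm M p (\<lambda>x. g x - h x) < e / 2"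
    using g(1) e2 unfolding approximable_def by metis
  have gL: "g \<in> Lp_space M p" using g(1) unfolding approximable_def by auto
  have "(\<lambda>x. f x - h x) = (\<lambda>x. (f x - g x) + (g x - h x))" by auto
  then have "Lp_norm M p (\<lambda>x. f x - h x) \<le> Lp_norm M p (\<lambda>x. f x - g x) + Lp_norm M p (\<lambda>x. g x - h x)"
    using p f gL h by (simp only:) (intro Lp_norm_triangle Lp_space_diff; simp)
  then have "Lp_norm M p (\<lambda>x. f x - h x) < e" using g h by linarith
  then show "\<exists>n\<ge>1. \<exists>h\<in>Lp_space M p. adapted n h \<and> Lp_norm M p (\<lambda>x. f x - h x) < e" using h by blast
qed

lemma depth_ge: "2 ^ j \<le> v \<Longrightarrow> j \<le> depth v"
proof (induction j arbitrary: v)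
  case (Suc j)
  have "(1::nat) \<le> 2 ^ j" by simp
  then have v: "2 \<le> v" "2 ^ j \<le> v div 2" using Suc(2) unfolding power_Suc by linarith+
  then show ?case using Suc(1)[OF v(2)] by (subst depth.simps) auto
qed simp

lemma cell_decides:
  "i < depth v \<Longrightarrow> cell v \<subseteq> B i \<or> cell v \<inter> B i = {}"
proof (induction v rule: less_induct)
  case (less v)
  have v: "v \<ge> 2" using less(2) by (subst (asm) depth.simps) (auto split: if_splits)
  define k where "k = v div 2"
  have k: "k \<ge> 1" "k < v" using v by (auto simp: k_def)
  have vk: "v = 2 * k \<or> v = 2 * k + 1" by (auto simp: k_def)
  have d: "depth v = Suc (depth k)" using v by (subst depth.simps) (simp add: k_def)
  show ?case
  proof (cases "i = depth k")
    case True
    then show ?thesis using vk cell_children[OF k(1)] by auto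
  next
    case False
    then have "cell k \<subseteq> B i \<or> cell k \<inter> B i = {}" using less k d by auto
    then show ?thesis using vk cell_children[OF k(1)] by auto
  qed
qed

text \<open>From depth j on, a cell lies inside or outside each \<open>B i\<close> with i < j; the
  leaves 2^j, ..., 2^(j+1) - 1 have reached that depth.\<close>

lemma adapted_Union:
  assumes "finite I"
  shows "\<exists>n\<ge>1. adapted n (indicator (\<Union>i\<in>I. B i))"
proof -
  define j where "j = Suc (Max (insert 0 I))"
  have j: "i < j" if "i \<in> I" for i using assms that by (auto simp: j_def less_Suc_eq_le)
  have "adapted (2 ^ j) (indicator (\<Union>i\<in>I. B i))"
    unfolding adapted_def
  proof (intro ballI)
    fix v x y assume v: "v \<in> {2 ^ j..<2 * 2 ^ j}" "x \<in> cell v" "y \<in> cell v"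
    have "cell v \<subseteq> B i \<or> cell v \<inter> B i = {}" if "i \<in> I" for i
      using cell_decides[of i v] depth_ge[of j v] v(1) j[OF that] by auto
    then have "x \<in> (\<Union>i\<in>I. B i) \<longleftrightarrow> y \<in> (\<Union>i\<in>I. B i)" using v by blast
    then show "indicator (\<Union>i\<in>I. B i) x = (indicator (\<Union>i\<in>I. B i) y :: complex)" by (simp add: indicator_def)
  qed
  then show ?thesis by (intro exI[of _ "2 ^ j"]) auto
qed

text \<open>The last hypothesis says that finite unions of splitting sets are dense in the measure
  algebra. Density then passes from indicators to simple functions and, by dominated convergence, to
  L^p.\<close>

lemma adapted_dense:
  assumes p: "p \<ge> 1" and f: "f \<in> Lp_space M p"
    and dense: "\<And>S e. S \<in> sets M \<Longrightarrow> e > 0 \<Longrightarrow>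
      \<exists>I. finite I \<and> measure M ((S - (\<Union>i\<in>I. B i)) \<union> ((\<Union>i\<in>I. B i) - S)) < e"
  shows "approximable p f"
proof -
  have ind: "approximable p (indicator S)" if S: "S \<in> sets M" for S
    unfolding approximable_def
  proof (intro conjI allI impI)
    have indL: "(indicator T :: 'a \<Rightarrow> complex) \<in> Lp_space M p" if "T \<in> sets M" for T
      using that p by (intro Lp_space_bounded[OF finite_measure_axioms, of _ 1]) (auto simp: indicator_def)
    show "indicator S \<in> Lp_space M p" using S by (rule indL)
    fix e :: real assume e: "e > 0"
    then have "(e / 2) powr p > 0" by simp
    then obtain I where I: "finite I" "measure M ((S - (\<Union>i\<in>I. B i)) \<union> ((\<Union>i\<in>I. B i) - S)) < (e / 2) powr p"
      using dense[OF S] by blast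
    obtain n where n: "n \<ge> 1" "adapted n (indicator (\<Union>i\<in>I. B i))" using adapted_Union[OF I(1)] by blast
    let ?U = "\<Union>i\<in>I. B i" and ?D = "(S - (\<Union>i\<in>I. B i)) \<union> ((\<Union>i\<in>I. B i) - S)"
    have [measurable]: "?U \<in> sets M" using I(1) by (intro sets.finite_UN) auto
    have [measurable]: "S \<in> sets M" by fact
    have "(LINT x|M. norm (indicator S x - indicator ?U x :: complex) powr p) = (LINT x|M. indicator ?D x)"
      by (intro Bochner_Integration.integral_cong) (auto simp: indicator_def)
    also have "\<dots> = measure M ?D"
      using sets.sets_into_space[of ?D M] by (simp add: Int_absorb2)
    finally have "Lp_norm M p (\<lambda>x. indicator S x - indicator ?U x :: complex) \<le> e / 2"
      using I(2) e p by (subst Lp_norm_le_iff) auto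
    then have "Lp_norm M p (\<lambda>x. indicator S x - indicator ?U x :: complex) < e" using e by linarith
    then show "\<exists>n\<ge>1. \<exists>g\<in>Lp_space M p. adapted n g \<and> Lp_norm M p (\<lambda>x. indicator S x - g x) < e"
      using n indL[of ?U] by (intro exI[of _ n] conjI bexI[of _ "indicator ?U"]) auto
  qed
  have simple: "approximable p s" if s: "simple_function M s" for s
  proof -
    define t where "t x = (\<Sum>y\<in>s ` space M. y * indicator (s -` {y} \<inter> space M) x)" for x
    have fin: "finite (s ` space M)" using s by (rule simple_functionD)
    have "approximable p t" unfolding t_def
      using s fin by (intro approximable_sum approximable_scale ind p) (auto intro: simple_functionD)
    moreover have st: "s x = t x" if x: "x \<in> space M" for x
    proof -
      have "t x = (\<Sum>y\<in>{s x}. y * indicator (s -` {y} \<inter> space M) x)"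
        unfolding t_def using fin x by (intro sum.mono_neutral_right) auto
      then show ?thesis using x by simp
    qed
    moreover have "Lp_norm M p (\<lambda>x. s x - g x) = Lp_norm M p (\<lambda>x. t x - g x)" for g
      by (rule Lp_cong) (simp add: st)
    ultimately show ?thesis
      unfolding approximable_def using Lp_cong(1)[of M s t p] by simp
  qed
  note [measurable] = Lp_spaceD(1)[OF f]
  obtain s where s: "\<And>i. simple_function M (s i)" "\<And>x. x \<in> space M \<Longrightarrow> (\<lambda>i. s i x) \<longlonglongrightarrow> f x"
    "\<And>i x. x \<in> space M \<Longrightarrow> dist (s i x) 0 \<le> 2 * dist (f x) 0"
    using borel_measurable_implies_sequence_metric[OF Lp_spaceD(1)[OF f], of 0] by metis
  have [measurable]: "s i \<in> borel_measurable M" for i using s(1) by (rule borel_measurable_simple_function)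
  have "(\<lambda>i. LINT x|M. norm (f x - s i x) powr p) \<longlonglongrightarrow> (LINT x|M. 0)"
  proof (rule integral_dominated_convergence)
    \<comment> \<open>The simple approximants are bounded by 2 |f|, so the difference from f is
      bounded by 3 |f|.\<close>
    show "integrable M (\<lambda>x. 3 powr p * norm (f x) powr p)" using Lp_spaceD(2)[OF f] by simp
    show "AE x in M. (\<lambda>i. norm (f x - s i x) powr p) \<longlonglongrightarrow> 0"
    proof (rule AE_I2)
      fix x assume x: "x \<in> space M"
      have "(\<lambda>i. norm (f x - s i x) powr p) \<longlonglongrightarrow> norm (f x - f x) powr p"
        using p by (intro tendsto_powr' tendsto_norm tendsto_diff tendsto_const s(2) x) auto
      then show "(\<lambda>i. norm (f x - s i x) powr p) \<longlonglongrightarrow> 0" using p by simp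
    qed
    show "AE x in M. norm (norm (f x - s i x) powr p) \<le> 3 powr p * norm (f x) powr p" for i
    proof (rule AE_I2)
      fix x assume x: "x \<in> space M"
      have "norm (f x - s i x) \<le> 3 * norm (f x)"
        using norm_triangle_ineq4[of "f x" "s i x"] s(3)[OF x, of i] by simp
      then have "norm (f x - s i x) powr p \<le> (3 * norm (f x)) powr p" using p by (intro powr_mono2) auto
      then show "norm (norm (f x - s i x) powr p) \<le> 3 powr p * norm (f x) powr p" by (simp add: powr_mult)
    qed
  qed simp_all
  then have lim: "(\<lambda>i. LINT x|M. norm (f x - s i x) powr p) \<longlonglongrightarrow> 0" by simp
  show ?thesis
  proof (rule approximable_closed[OF p f])
    fix e :: real assume e: "e > 0"
    then have "(e / 2) powr p > 0" by simp
    from order_tendstoD(2)[OF lim this] obtain i where "(LINT x|M. norm (f x - s i x) powr p) < (e / 2) powr p"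
      by (auto simp: eventually_sequentially)
    then have "Lp_norm M p (\<lambda>x. f x - s i x) \<le> e / 2" using e p by (subst Lp_norm_le_iff) auto
    then have "Lp_norm M p (\<lambda>x. f x - s i x) < e" using e by linarith
    then show "\<exists>g. approximable p g \<and> Lp_norm M p (\<lambda>x. f x - g x) < e" using simple[OF s(1)] by blast
  qed
qed

end

subsection \<open>Unconditional systems\<close>

text \<open>The properties of the normalized Haar system from which the unimodular frame is built.
  \<open>multiplier\<close> gives unconditionality, \<open>square\<close> controls coefficients from
  above in l^2, \<open>type_p\<close> synthesizes l^p sequences, and \<open>dense\<close> provides
  approximants that a finite expansion reproduces up to norm zero.\<close>

locale unconditional_system = finite_measure M for M :: "'a measure" +
  fixes p :: real and h :: "nat \<Rightarrow> 'a \<Rightarrow> real" and hs :: "nat \<Rightarrow> ('a \<Rightarrow> complex) \<Rightarrow> complex" and K :: real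
  assumes p: "1 < p" "p \<le> 2" and K: "1 \<le> K"
    and h_measurable [measurable]: "\<And>k. h k \<in> borel_measurable M"
    and h_bounded: "\<And>k. \<exists>b. \<forall>x. \<bar>h k x\<bar> \<le> b"
    and hs_dual: "\<And>k. hs k \<in> dual_space (Lp_space M p) (Lp_norm M p)"
    and multiplier: "\<And>F (\<theta> :: nat \<Rightarrow> complex) f. finite F \<Longrightarrow> f \<in> Lp_space M p \<Longrightarrow> (\<And>k. norm (\<theta> k) \<le> 1) \<Longrightarrow>
      Lp_norm M p (\<lambda>x. \<Sum>k\<in>F. \<theta> k * hs k f * h k x) \<le> K * Lp_norm M p f"
    and square: "\<And>F f. finite F \<Longrightarrow> f \<in> Lp_space M p \<Longrightarrow>
      (\<Sum>k\<in>F. (norm (hs k f))\<^sup>2) \<le> (K * Lp_norm M p f)\<^sup>2"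
    and type_p: "\<And>F (b :: nat \<Rightarrow> complex). finite F \<Longrightarrow>
      Lp_norm M p (\<lambda>x. \<Sum>k\<in>F. b k * h k x) \<le> K * (\<Sum>k\<in>F. norm (b k) powr p) powr (1 / p)"
    and dense: "\<And>f e. f \<in> Lp_space M p \<Longrightarrow> e > 0 \<Longrightarrow> \<exists>n. \<exists>g\<in>Lp_space M p. Lp_norm M p (\<lambda>x. f x - g x) < e \<and>
      (\<forall>k\<ge>n. hs k g = 0) \<and> Lp_norm M p (\<lambda>x. (\<Sum>k<n. hs k g * h k x) - g x) = 0"

context haar_tree
begin

text \<open>The first entry of the maximum dominates the type constant 6^(1/p) and ensures K >= 1;
  the second bounds multipliers and square sums.\<close>

lemma haar_unconditional_system:
  assumes p: "1 < p" "p \<le> 2" and pos: "measure M (space M) > 0"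
    and dense: "\<And>S e. S \<in> sets M \<Longrightarrow> e > 0 \<Longrightarrow>
      \<exists>I. finite I \<and> measure M ((S - (\<Union>i\<in>I. B i)) \<union> ((\<Union>i\<in>I. B i) - S)) < e"
  shows "unconditional_system M p (\<lambda>k x. haar k x / haar_norm p k) (\<lambda>k f. haar_norm p k * coef f k)
     (max 6 ((3 / (p - 1)) powr (1 / p)))"
proof -
  define K where "K = max 6 ((3 / (p - 1)) powr (1 / p))"
  have K: "K \<ge> 6" "(3 / (p - 1)) powr (1 / p) \<le> K" by (auto simp: K_def)
  have p1: "p \<ge> 1" "p > 0" using p by auto
  \<comment> \<open>Normalizing the function and its functional inversely leaves the expansion
    unchanged, also where the norm is zero, since then the Haar function vanishes at x.\<close>
  have cancel: "complex_of_real (haar_norm p k) * a * complex_of_real (haar k x / haar_norm p k) = a * haar k x" for a k x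
    using haar_norm_zero[OF p1(2) pos, of k x] by (cases "haar_norm p k = 0") auto
  have nn: "haar_norm p k \<ge> 0" for k by (simp add: haar_norm_def)
  show ?thesis
    unfolding K_def[symmetric]
  proof (unfold_locales, goal_cases)
    case (5 k)
    obtain b where b: "\<And>x. \<bar>haar k x\<bar> \<le> b" using haar_bounded by blast
    have "\<bar>haar k x / haar_norm p k\<bar> \<le> b / haar_norm p k" for x
      using b[of x] nn[of k] by (simp add: abs_divide divide_right_mono)
    then show ?case by blast
  next
    case (6 k)
    obtain C where C: "\<forall>f\<in>Lp_space M p. norm (coef f k) \<le> C * Lp_norm M p f"
      using coef_bounded[OF p1(1)] by blast
    have "norm (haar_norm p k * coef f k) \<le> (haar_norm p k * C) * Lp_norm M p f" if "f \<in> Lp_space M p" for f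
      using C that mult_left_mono[OF _ nn[of k], of "norm (coef f k)" "C * Lp_norm M p f"] nn[of k]
      by (simp add: norm_mult mult.assoc)
    moreover have "coef (\<lambda>x. f x + g x) k = coef f k + coef g k" if "f \<in> Lp_space M p" "g \<in> Lp_space M p" for f g
      using coef_linear(1) Lp_integrable[OF _ p1(1)] that by blast
    moreover have "coef (\<lambda>x. c * f x) k = c * coef f k" if "f \<in> Lp_space M p" for f c
      using coef_linear(2) Lp_integrable[OF _ p1(1)] that by blast
    ultimately show ?case
      unfolding dual_space_def
      by (auto simp: distrib_left intro!: exI[of _ "haar_norm p k * C"])
  next
    case (7 F \<theta> f)
    have "(\<Sum>k\<in>F. \<theta> k * (haar_norm p k * coef f k) * complex_of_real (haar k x / haar_norm p k))
        = (\<Sum>k\<in>F. \<theta> k * coef f k * haar k x)" for x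
      by (simp only: mult.assoc cancel[unfolded mult.assoc])
    then have "Lp_norm M p (\<lambda>x. \<Sum>k\<in>F. \<theta> k * (haar_norm p k * coef f k) * complex_of_real (haar k x / haar_norm p k))
        \<le> (3 / (p - 1)) powr (1 / p) * Lp_norm M p f"
      using haar_multiplier[OF p 7(1,2), of \<theta>] 7(3) by simp
    also have "\<dots> \<le> K * Lp_norm M p f" using K by (intro mult_right_mono) auto
    finally show ?case .
  next
    case (8 F f)
    have "(\<Sum>k\<in>F. (norm (haar_norm p k * coef f k))\<^sup>2) = (\<Sum>k\<in>F. (norm (coef f k))\<^sup>2 * (haar_norm p k)\<^sup>2)"
      by (simp add: norm_mult power_mult_distrib mult.commute)
    also have "\<dots> \<le> ((3 / (p - 1)) powr (1 / p) * Lp_norm M p f)\<^sup>2"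
      by (rule haar_square[OF p 8])
    also have "\<dots> \<le> (K * Lp_norm M p f)\<^sup>2"
      using K by (intro power_mono mult_right_mono) auto
    finally show ?case .
  next
    case (9 F b)
    have "Lp_norm M p (\<lambda>x. \<Sum>k\<in>F. (b k / haar_norm p k) * haar k x)
        \<le> (6 * (\<Sum>k\<in>F. (norm (b k / haar_norm p k) * haar_norm p k) powr p)) powr (1 / p)"
      by (rule haar_type_norm[OF p 9])
    also have "\<dots> \<le> (6 * (\<Sum>k\<in>F. norm (b k) powr p)) powr (1 / p)"
      using p1 nn by (intro powr_mono2 mult_left_mono sum_mono) (auto simp: norm_divide sum_nonneg)
    also have "\<dots> = 6 powr (1 / p) * (\<Sum>k\<in>F. norm (b k) powr p) powr (1 / p)"
      by (simp add: powr_mult sum_nonneg)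
    also have "\<dots> \<le> 6 powr 1 * (\<Sum>k\<in>F. norm (b k) powr p) powr (1 / p)"
      using p by (intro mult_right_mono powr_mono) auto
    also have "\<dots> \<le> K * (\<Sum>k\<in>F. norm (b k) powr p) powr (1 / p)"
      using K by (intro mult_right_mono) auto
    finally show ?case by simp
  next
    case (10 f e)
    have "approximable p f" by (rule adapted_dense[OF p1(1) 10(1) dense])
    then obtain n g where g: "n \<ge> 1" "g \<in> Lp_space M p" "adapted n g" "Lp_norm M p (\<lambda>x. f x - g x) < e"
      using 10(2) unfolding approximable_def by metis
    have "haar_norm p k * coef g k = 0" if "k \<ge> n" for k
    proof (cases "coef g k = 0")
      case False
      then have "haar k x = 0" for x using adapted_coef[OF g(1,3) that, of x] by simp
      then show ?thesis by (simp add: haar_norm_def)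
    qed simp
    moreover have "Lp_norm M p (\<lambda>x. (\<Sum>k<n. haar_norm p k * coef g k * complex_of_real (haar k x / haar_norm p k)) - g x) = 0"
      unfolding cancel using adapted_expectation[OF p1(1) g(1,3,2), of "{..<n}"] by simp
    ultimately show ?case using g(2,4) by (intro exI[of _ n] bexI[of _ g]) auto
  qed (use p K in auto)
qed

end

subsection \<open>Independent signs on a measure without atoms\<close>

locale halvable_measure = finite_measure M for M :: "'a measure" +
  assumes halves: "\<And>E. E \<in> sets M \<Longrightarrow> \<exists>E'\<in>sets M. E' \<subseteq> E \<and> measure M E' = measure M E / 2"
begin

definition half :: "'a set \<Rightarrow> 'a set" where
  "half E = (SOME E'. E' \<in> sets M \<and> E' \<subseteq> E \<and> measure M E' = measure M E / 2)"

lemma half: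
  assumes "E \<in> sets M"
  shows "half E \<in> sets M" "half E \<subseteq> E" "measure M (half E) = measure M E / 2"
  using someI_ex[of "\<lambda>E'. E' \<in> sets M \<and> E' \<subseteq> E \<and> measure M E' = measure M E / 2"] halves[OF assms]
  unfolding half_def by auto

fun block :: "nat \<Rightarrow> 'a set" where
  "block k = (if k < 2 then space M else if even k then half (block (k div 2))
     else block (k div 2) - half (block (k div 2)))"

declare block.simps [simp del]

lemma block_children:
  assumes "k \<ge> 1"
  shows "block (2 * k) = half (block k)" "block (2 * k + 1) = block k - half (block k)"
  using assms by (simp_all add: block.simps[of "2 * k"] block.simps[of "Suc (2 * k)"])

lemma block_sets [measurable]: "block k \<in> sets M"
proof (induction k rule: less_induct)
  case (less k)
  show ?case
  proof (cases "k < 2")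
    case True
    then show ?thesis by (simp add: block.simps)
  next
    case False
    then have "block (k div 2) \<in> sets M" by (intro less) auto
    then show ?thesis using False half(1)[of "block (k div 2)"] by (subst block.simps) auto
  qed
qed

lemma block_child_subset:
  assumes "k \<ge> 1"
  shows "block (2 * k) \<subseteq> block k" "block (2 * k + 1) \<subseteq> block k"
  using block_children[OF assms] half(2)[OF block_sets] by auto

lemma measure_block_children:
  assumes "k \<ge> 1"
  shows "measure M (block (2 * k)) = measure M (block k) / 2"
    "measure M (block (2 * k + 1)) = measure M (block k) / 2"
proof -
  show 1: "measure M (block (2 * k)) = measure M (block k) / 2"
    unfolding block_children[OF assms] by (rule half) simp
  have "measure M (block (2 * k + 1)) = measure M (block k) - measure M (half (block k))"
    unfolding block_children[OF assms] by (intro finite_measure_Diff half block_sets)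
  then show "measure M (block (2 * k + 1)) = measure M (block k) / 2"
    using half(3)[OF block_sets, of k] by simp
qed

lemma depth_children:
  assumes "k \<ge> 1"
  shows "depth (2 * k) = Suc (depth k)" "depth (2 * k + 1) = Suc (depth k)"
  using assms by (simp_all add: depth.simps[of "2 * k"] depth.simps[of "Suc (2 * k)"])

lemma block_disjoint:
  "j \<ge> 1 \<Longrightarrow> k \<ge> 1 \<Longrightarrow> depth j = depth k \<Longrightarrow> j \<noteq> k \<Longrightarrow> block j \<inter> block k = {}"
proof (induction k arbitrary: j rule: less_induct)
  case (less k)
  have d1: "depth n = 0 \<longleftrightarrow> n < 2" for n by (subst depth.simps) auto
  have ge: "k \<ge> 2 \<longleftrightarrow> j \<ge> 2" using less(4) d1[of k] d1[of j] by auto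
  then have jk: "k \<ge> 2" "j \<ge> 2" using less(2,3,5) by auto
  define k' where "k' = k div 2"
  define j' where "j' = j div 2"
  have k': "k' \<ge> 1" "k' < k" "j' \<ge> 1" using jk by (auto simp: k'_def j'_def)
  have kc: "k = 2 * k' \<or> k = 2 * k' + 1" and jc: "j = 2 * j' \<or> j = 2 * j' + 1" by (auto simp: k'_def j'_def)
  have dd: "depth j' = depth k'" using less(4) kc jc depth_children k' by auto
  show ?case
  proof (cases "j' = k'")
    case True
    then show ?thesis using kc jc less(5) block_children[OF k'(1)] by auto
  next
    case False
    then have "block j' \<inter> block k' = {}" using less(1)[OF k'(2,3,1) dd] by simp
    then show ?thesis using kc jc block_child_subset[OF k'(1)] block_child_subset[OF k'(3)] by blast
  qed
qed

text \<open>A \<open>haar_tree\<close> splits all cells of one depth by a single set, whereas halves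
  are chosen block by block. Collecting the halves of one level loses nothing, because blocks of
  equal depth are disjoint.\<close>

definition split_set :: "nat \<Rightarrow> 'a set" where
  "split_set i = (\<Union>k\<in>{k. k \<ge> 1 \<and> depth k = i}. block (2 * k))"

sublocale signs: haar_tree M split_set
  by unfold_locales (simp add: split_set_def)

lemma signs_cell: "k \<ge> 1 \<Longrightarrow> signs.cell k = block k"
proof (induction k rule: less_induct)
  case (less k)
  show ?case
  proof (cases "k = 1")
    case True
    then show ?thesis by (simp add: block.simps)
  next
    case False
    define j where "j = k div 2"
    have j: "j \<ge> 1" "j < k" using False less(2) by (auto simp: j_def)
    have kc: "k = 2 * j \<or> k = 2 * j + 1" by (auto simp: j_def)
    have "block j \<inter> split_set (depth j) = block (2 * j)"
    proof (rule set_eqI, rule iffI)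
      fix x assume x: "x \<in> block j \<inter> split_set (depth j)"
      then obtain i where i: "i \<ge> 1" "depth i = depth j" "x \<in> block (2 * i)" unfolding split_set_def by blast
      then have "i = j" using block_disjoint[OF i(1) j(1) i(2)] block_child_subset(1)[OF i(1)] x by blast
      then show "x \<in> block (2 * j)" using i by simp
    next
      fix x assume "x \<in> block (2 * j)"
      then show "x \<in> block j \<inter> split_set (depth j)"
        using block_child_subset(1)[OF j(1)] j unfolding split_set_def by blast
    qed
    then have "signs.cell (2 * j) = block (2 * j)" "signs.cell (2 * j + 1) = block (2 * j + 1)"
      using signs.cell_children[OF j(1)] less(1)[OF j(2,1)] block_children[OF j(1)] by auto
    then show ?thesis using kc by auto
  qed
qed

text \<open>Rademacher functions of the halving tree.\<close>

definition sign_fun :: "nat \<Rightarrow> 'a \<Rightarrow> real" where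
  "sign_fun i x = (if x \<in> split_set i then 1 else - 1)"

lemma sign_fun_measurable [measurable]: "sign_fun i \<in> borel_measurable M"
  unfolding sign_fun_def using signs.B_sets by measurable

lemma abs_sign_fun: "\<bar>sign_fun i x\<bar> = 1"
  by (simp add: sign_fun_def)

lemma depth_level: "v \<in> {2 ^ m..<2 * 2 ^ m} \<Longrightarrow> depth v = m"
proof (induction m arbitrary: v)
  case 0
  then show ?case by (subst depth.simps) auto
next
  case (Suc m)
  then have "v div 2 \<in> {2 ^ m..<2 * 2 ^ m}" by auto
  moreover have "(2::nat) ^ m \<ge> 1" by simp
  then have "v \<ge> 2" using Suc(2) unfolding power_Suc atLeastLessThan_iff by linarith
  ultimately show ?case using Suc(1) by (subst depth.simps) auto
qed

text \<open>On a cell of depth m the earlier sign is constant, while the sign of level m takes its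
  two values on halves of equal measure.\<close>

lemma sign_fun_orthogonal:
  assumes "i < m"
  shows "(LINT x|M. sign_fun i x * sign_fun m x) = 0"
proof -
  have bnd: "integrable M (\<lambda>x. sign_fun i x * sign_fun m x)"
    by (rule integrable_const_bound[of _ 1]) (auto simp: abs_mult abs_sign_fun)
  have "(LINT x|M. sign_fun i x * sign_fun m x)
     = (\<Sum>v\<in>{2 ^ m..<2 * 2 ^ m}. (LINT x|M. indicator (signs.cell v) x * (sign_fun i x * sign_fun m x)))"
    by (rule signs.sum_integral_leaves[symmetric, OF _ bnd]) simp
  also have "\<dots> = 0"
  proof (rule sum.neutral, rule ballI)
    fix v :: nat assume v: "v \<in> {2 ^ m..<2 * 2 ^ m}"
    have d: "depth v = m" using depth_level[OF v] .
    have "(1::nat) \<le> 2 ^ m" by simp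
    then have v1: "v \<ge> 1" using v by (auto simp del: one_le_power)
    have "\<exists>c. \<forall>x\<in>signs.cell v. sign_fun i x = c"
      using signs.cell_decides[of i v] assms d by (auto simp: sign_fun_def)
    then obtain c where c: "\<And>x. x \<in> signs.cell v \<Longrightarrow> sign_fun i x = c" by blast
    have ch: "signs.cell (2 * v) = signs.cell v \<inter> split_set m" "signs.cell (2 * v + 1) = signs.cell v - split_set m"
      using signs.cell_children[OF v1] d by auto
    have "(LINT x|M. indicator (signs.cell v) x * (sign_fun i x * sign_fun m x))
      = (LINT x|M. c * (indicator (signs.cell (2 * v)) x - indicator (signs.cell (2 * v + 1)) x))"
      unfolding ch using c by (intro Bochner_Integration.integral_cong) (auto simp: indicator_def sign_fun_def)
    also have "\<dots> = c * (measure M (block (2 * v)) - measure M (block (2 * v + 1)))"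
      using signs_cell[of "2 * v"] signs_cell[of "2 * v + 1"] v1 by (simp add: emeasure_eq_measure)
    also have "\<dots> = 0" using measure_block_children[OF v1] by simp
    finally show "(LINT x|M. indicator (signs.cell v) x * (sign_fun i x * sign_fun m x)) = 0" .
  qed
  finally show ?thesis .
qed

text \<open>The right child of the i-th block of the leftmost branch; later pieces lie inside the
  left child, hence disjointness.\<close>

definition piece :: "nat \<Rightarrow> 'a set" where
  "piece i = block (2 * 2 ^ i + 1)"

lemma piece_sets [measurable]: "piece i \<in> sets M"
  by (simp add: piece_def)

lemma measure_block_power: "measure M (block (2 ^ i)) = measure M (space M) / 2 ^ i"
proof (induction i)
  case (Suc i)
  then show ?case using measure_block_children(1)[of "2 ^ i"] by simp
qed (simp add: block.simps)

lemma measure_piece_pos: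
  assumes "measure M (space M) > 0"
  shows "measure M (piece i) > 0"
  using assms measure_block_children(2)[of "2 ^ i"] measure_block_power[of i] by (simp add: piece_def)

lemma disjoint_piece: "disjoint_family piece"
proof -
  have mono: "block (2 ^ j) \<subseteq> block (2 ^ i)" if "i \<le> j" for i j
    using that
  proof (induction j rule: dec_induct)
    case (step n)
    then show ?case using block_child_subset(1)[of "2 ^ n"] by auto
  qed simp
  have "piece i \<inter> piece j = {}" if "i < j" for i j
  proof -
    have "piece j \<subseteq> block (2 ^ j)" unfolding piece_def by (rule block_child_subset) simp
    also have "\<dots> \<subseteq> block (2 ^ Suc i)" using that by (intro mono) simp
    also have "\<dots> = half (block (2 ^ i))" using block_children(1)[of "2 ^ i"] by simp
    finally show ?thesis using block_children(2)[of "2 ^ i"] unfolding piece_def by auto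
  qed
  then show ?thesis unfolding disjoint_family_on_def by (metis Int_commute linorder_neqE_nat)
qed

end

subsection \<open>Frames from convergent nets of finite sums\<close>

text \<open>Convergence along finite subsets does not see the enumeration of the index set, so it
  covers every rearrangement at once, with the same sum.\<close>

lemma unconditional_Schauder_frame_of_net:
  fixes G :: "'i \<Rightarrow> 'a \<Rightarrow> complex" and G' :: "'i \<Rightarrow> ('a \<Rightarrow> complex) \<Rightarrow> complex"
  assumes "bij_betw e (UNIV :: nat set) I"
    and "\<And>i. i \<in> I \<Longrightarrow> G i \<in> X" "\<And>i. i \<in> I \<Longrightarrow> G' i \<in> dual_space X N"
    and nonneg: "\<And>f. N f \<ge> 0"
    and net: "\<And>f \<epsilon>. f \<in> X \<Longrightarrow> \<epsilon> > 0 \<Longrightarrow> \<exists>F0. finite F0 \<and> F0 \<subseteq> I \<and>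
      (\<forall>F. finite F \<longrightarrow> F0 \<subseteq> F \<longrightarrow> F \<subseteq> I \<longrightarrow> N (\<lambda>x. (\<Sum>i\<in>F. G' i f * G i x) - f x) < \<epsilon>)"
  shows "unconditional_Schauder_frame X N (\<lambda>n. G (e n)) (\<lambda>n. G' (e n))"
proof -
  have sums: "sums_in N (\<lambda>n x. G' (e (\<pi> n)) f * G (e (\<pi> n)) x) f" if f: "f \<in> X" and \<pi>: "bij \<pi>" for f and \<pi> :: "nat \<Rightarrow> nat"
    unfolding sums_in_def
  proof (rule LIMSEQ_I)
    fix \<epsilon> :: real assume \<epsilon>: "\<epsilon> > 0"
    define d where "d n = e (\<pi> n)" for n
    have d: "bij_betw d UNIV I"
    proof -
      have "d = e \<circ> \<pi>" by (simp add: d_def fun_eq_iff)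
      then show ?thesis using bij_betw_trans[OF \<pi> assms(1)] by simp
    qed
    obtain F0 where F0: "finite F0" "F0 \<subseteq> I"
      "\<And>F. finite F \<Longrightarrow> F0 \<subseteq> F \<Longrightarrow> F \<subseteq> I \<Longrightarrow> N (\<lambda>x. (\<Sum>i\<in>F. G' i f * G i x) - f x) < \<epsilon>"
      using net[OF f \<epsilon>] by blast
    \<comment> \<open>From this length on, an initial segment of the rearranged enumeration contains
      \<open>F0\<close>.\<close>
    define k0 where "k0 = Suc (Max (insert 0 (inv_into UNIV d ` F0)))"
    show "\<exists>k0. \<forall>k\<ge>k0. norm (N (\<lambda>x. (\<Sum>n<k. G' (e (\<pi> n)) f * G (e (\<pi> n)) x) - f x) - 0) < \<epsilon>"
    proof (intro exI[of _ k0] allI impI)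
      fix k assume k: "k \<ge> k0"
      have "F0 \<subseteq> d ` {..<k}"
      proof
        fix i assume i: "i \<in> F0"
        have "inv_into UNIV d i \<le> Max (insert 0 (inv_into UNIV d ` F0))" using F0(1) i by (intro Max_ge) auto
        then have "inv_into UNIV d i < k" using k by (simp add: k0_def)
        moreover have "d (inv_into UNIV d i) = i"
          using d i F0(2) by (intro f_inv_into_f) (auto simp: bij_betw_def)
        ultimately show "i \<in> d ` {..<k}" by (metis imageI lessThan_iff)
      qed
      moreover have "d ` {..<k} \<subseteq> I" using d by (auto simp: bij_betw_def)
      ultimately have "N (\<lambda>x. (\<Sum>i\<in>d ` {..<k}. G' i f * G i x) - f x) < \<epsilon>" by (intro F0(3)) auto
      moreover have "(\<Sum>i\<in>d ` {..<k}. G' i f * G i x) = (\<Sum>n<k. G' (d n) f * G (d n) x)" for x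
        using d by (intro sum.reindex[THEN trans]) (auto simp: bij_betw_def intro: inj_on_subset)
      ultimately show "norm (N (\<lambda>x. (\<Sum>n<k. G' (e (\<pi> n)) f * G (e (\<pi> n)) x) - f x) - 0) < \<epsilon>"
        using nonneg by (simp add: d_def)
    qed
  qed
  have eI: "e n \<in> I" for n using assms(1) by (auto simp: bij_betw_def)
  show ?thesis
    unfolding unconditional_Schauder_frame_def converges_unconditionally_def
    using sums assms(2,3) eI sums[OF _ bij_id] by auto
qed

subsection \<open>Unimodular functions with small functionals\<close>

locale unimodular_construction = unconditional_system M p h hs K
  for M :: "'a measure" and p h hs K +
  fixes s :: "nat \<Rightarrow> 'a \<Rightarrow> real"
  assumes s_measurable [measurable]: "\<And>i. s i \<in> borel_measurable M"
    and abs_s: "\<And>i x. \<bar>s i x\<bar> = 1"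
    and s_orthogonal: "\<And>i j. i \<noteq> j \<Longrightarrow> (LINT x|M. s i x * s j x) = 0"
begin

text \<open>The lower bound K keeps the functionals \<alpha> at norm at most 1/2, and the factor 2^j
  makes the scaled functions decay geometrically. It is an integer because its square counts
  copies.\<close>

definition height :: "nat \<Rightarrow> nat" where
  "height j = (SOME n. real n \<ge> K \<and> (\<forall>x. 2 ^ j * \<bar>h j x\<bar> \<le> real n))"

lemma height: "K \<le> real (height j)" "2 ^ j * \<bar>h j x\<bar> \<le> real (height j)" "height j \<ge> 1"
proof -
  obtain b where b: "\<And>x. \<bar>h j x\<bar> \<le> b" using h_bounded by blast
  obtain n :: nat where n: "real n \<ge> max K (2 ^ j * b)" using real_arch_simple by blast
  have "2 ^ j * \<bar>h j x\<bar> \<le> real n" for x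
  proof -
    have "2 ^ j * \<bar>h j x\<bar> \<le> 2 ^ j * b" by (intro mult_left_mono b) auto
    also have "\<dots> \<le> real n" using n by simp
    finally show ?thesis .
  qed
  then have "\<exists>n. real n \<ge> K \<and> (\<forall>x. 2 ^ j * \<bar>h j x\<bar> \<le> real n)" using n by (intro exI[of _ n]) auto
  from someI_ex[OF this] show 1: "K \<le> real (height j)" and "2 ^ j * \<bar>h j x\<bar> \<le> real (height j)"
    unfolding height_def by auto
  show "height j \<ge> 1" using 1 K by linarith
qed

definition u :: "nat \<Rightarrow> 'a \<Rightarrow> real" where "u j x = h j x / height j"
definition w :: "nat \<Rightarrow> 'a \<Rightarrow> real" where "w j x = sqrt (1 - (u j x)\<^sup>2)"

lemma u_measurable [measurable]: "u j \<in> borel_measurable M" unfolding u_def by measurable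
lemma w_measurable [measurable]: "w j \<in> borel_measurable M" unfolding w_def by measurable

lemma abs_u: "\<bar>u j x\<bar> \<le> (1 / 2) ^ j"
  using height(2)[of j x] height(3)[of j] by (simp add: u_def abs_divide field_simps power_divide)

lemma abs_u_le_1: "\<bar>u j x\<bar> \<le> 1"
  using abs_u[of j x] power_le_one[of "1 / 2 :: real" j] by linarith

lemma u_square_le_1: "(u j x)\<^sup>2 \<le> 1"
  using abs_u_le_1[of j x] by (simp add: abs_square_le_1)

text \<open>1 - w <= 1 - w^2 = u^2 <= |u|; the decay in j makes the deviations of the weights from 1
  summable.\<close>

lemma w_bounds: "0 \<le> w j x" "w j x \<le> 1" "1 - w j x \<le> (1 / 2) ^ j"
proof -
  show 0: "0 \<le> w j x" using u_square_le_1 by (simp add: w_def)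
  show 1: "w j x \<le> 1" by (simp add: w_def)
  have "1 - w j x \<le> 1 - (w j x)\<^sup>2"
    using 0 1 by (simp add: power2_eq_square mult_left_le)
  also have "\<dots> = (u j x)\<^sup>2" using u_square_le_1[of j x] by (simp add: w_def)
  also have "\<dots> \<le> \<bar>u j x\<bar>" using abs_u_le_1[of j x] mult_left_le[of "\<bar>u j x\<bar>" "\<bar>u j x\<bar>"]
    by (simp add: power2_eq_square abs_mult_self_eq)
  also have "\<dots> \<le> (1 / 2) ^ j" by (rule abs_u)
  finally show "1 - w j x \<le> (1 / 2) ^ j" .
qed

definition idx :: "(nat \<times> nat \<times> bool) set" where
  "idx = {(j, n, \<sigma>). n < (height j)\<^sup>2}"

definition turn :: "bool \<Rightarrow> complex" where "turn \<sigma> = (if \<sigma> then \<i> else - \<i>)"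

text \<open>The pair (j, n) selects the sign function and \<sigma> its orientation; the two
  functions of a pair are complex conjugates with sum 2 u.\<close>

definition g :: "nat \<times> nat \<times> bool \<Rightarrow> 'a \<Rightarrow> complex" where
  "g i x = (case i of (j, n, \<sigma>) \<Rightarrow> u j x + turn \<sigma> * (s (prod_encode (j, n)) x * w j x))"

text \<open>One share of a coefficient: 2 H^2 copies, each containing h / H, times hs / (2 H) give
  back hs times h.\<close>

definition \<alpha> :: "nat \<times> nat \<times> bool \<Rightarrow> ('a \<Rightarrow> complex) \<Rightarrow> complex" where
  "\<alpha> i f = hs (fst i) f / (2 * height (fst i))"

lemma g_measurable [measurable]: "g i \<in> borel_measurable M"
  unfolding g_def by (cases i) simp

lemma norm_g: "norm (g i x) = 1"
proof -
  obtain j n \<sigma> where i: "i = (j, n, \<sigma>)" by (cases i)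
  define c where "c = s (prod_encode (j, n)) x * w j x"
  have "c\<^sup>2 = (w j x)\<^sup>2" using abs_s[of "prod_encode (j, n)" x] by (metis c_def abs_mult mult_1 power2_abs)
  also have "\<dots> = 1 - (u j x)\<^sup>2" using u_square_le_1[of j x] by (simp add: w_def)
  finally have "(u j x)\<^sup>2 + c\<^sup>2 = 1" by simp
  moreover have "(norm (g i x))\<^sup>2 = (u j x)\<^sup>2 + c\<^sup>2"
    unfolding i g_def c_def by (cases \<sigma>) (simp_all add: turn_def cmod_power2)
  ultimately show ?thesis by (metis norm_ge_zero power2_eq_1_iff one_neq_neg_one le_minus_one_simps(1) order_less_le_trans power2_eq_iff_nonneg zero_le_one one_power2)
qed

lemma g_Lp: "q > 0 \<Longrightarrow> g i \<in> Lp_space M q"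
  by (rule Lp_space_bounded[OF finite_measure_axioms, of _ 1]) (auto simp: norm_g)

lemma L2_square: "(Lp_norm M 2 f)\<^sup>2 = (LINT x|M. (norm (f x))\<^sup>2)"
  using Lp_norm_powr[of 2 M f] by simp

lemma s_Lp: "q > 0 \<Longrightarrow> (\<lambda>x. complex_of_real (s i x)) \<in> Lp_space M q"
  by (rule Lp_space_bounded[OF finite_measure_axioms, of _ 1]) (auto simp: abs_s)

lemma L2_sign_sum:
  fixes d :: "'i \<Rightarrow> complex" and e :: "'i \<Rightarrow> nat"
  assumes "finite F" "inj_on e F"
  shows "Lp_norm M 2 (\<lambda>x. \<Sum>i\<in>F. d i * s (e i) x) = sqrt (measure M (space M) * (\<Sum>i\<in>F. (norm (d i))\<^sup>2))"
proof -
  have int: "integrable M (\<lambda>x. s i x * s j x)" for i j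
    by (rule integrable_const_bound[of _ 1]) (auto simp: abs_mult abs_s)
  have ss: "(LINT x|M. s (e i) x * s (e j) x) = (if i = j then measure M (space M) else 0)" if "i \<in> F" "j \<in> F" for i j
  proof (cases "i = j")
    case True
    have "s (e j) x * s (e j) x = 1" for x
      using abs_s[of "e j" x] by (metis abs_mult_self_eq mult_1)
    then show ?thesis using True by simp
  next
    case False
    then have "e i \<noteq> e j" using assms(2) that by (auto dest: inj_onD)
    then show ?thesis using s_orthogonal False by simp
  qed
  have "complex_of_real ((Lp_norm M 2 (\<lambda>x. \<Sum>i\<in>F. d i * s (e i) x))\<^sup>2)
      = (LINT x|M. complex_of_real ((norm (\<Sum>i\<in>F. d i * s (e i) x))\<^sup>2))"
    unfolding L2_square by (rule integral_complex_of_real[symmetric])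
  also have "\<dots> = (LINT x|M. (\<Sum>i\<in>F. \<Sum>j\<in>F. d i * cnj (d j) * complex_of_real (s (e i) x * s (e j) x)))"
    unfolding complex_norm_square by (simp add: sum_product mult_ac)
  also have "\<dots> = (\<Sum>i\<in>F. \<Sum>j\<in>F. d i * cnj (d j) * complex_of_real (LINT x|M. s (e i) x * s (e j) x))"
  proof -
    have "integrable M (\<lambda>x. complex_of_real (s i x * s j x))" for i j using int by (rule integrable_of_real)
    then show ?thesis
      by (simp add: Bochner_Integration.integral_sum integral_complex_of_real del: of_real_mult)
  qed
  also have "\<dots> = (\<Sum>i\<in>F. \<Sum>j\<in>F. if i = j then d i * cnj (d j) * measure M (space M) else 0)"
    by (intro sum.cong refl) (simp add: ss)
  also have "\<dots> = (\<Sum>i\<in>F. d i * cnj (d i) * measure M (space M))"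
    using assms(1) by (simp add: sum.delta')
  also have "\<dots> = complex_of_real (measure M (space M) * (\<Sum>i\<in>F. (norm (d i))\<^sup>2))"
    unfolding of_real_mult of_real_sum complex_norm_square sum_distrib_left by (simp add: mult_ac)
  finally have "(Lp_norm M 2 (\<lambda>x. \<Sum>i\<in>F. d i * s (e i) x))\<^sup>2 = measure M (space M) * (\<Sum>i\<in>F. (norm (d i))\<^sup>2)"
    using of_real_eq_iff by blast
  from real_sqrt_unique[OF this Lp_norm_nonneg] show ?thesis by simp
qed

text \<open>The weights \<open>w\<close> destroy orthogonality, but they are summably close to 1.\<close>

lemma L2_weighted_sign_sum:
  fixes d :: "'i \<Rightarrow> complex" and e l :: "'i \<Rightarrow> nat"
  assumes F: "finite F" and e: "inj_on e F"
  shows "Lp_norm M 2 (\<lambda>x. \<Sum>i\<in>F. d i * (s (e i) x * w (l i) x))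
    \<le> 3 * sqrt (measure M (space M) * (\<Sum>i\<in>F. (norm (d i))\<^sup>2))"
proof -
  let ?R = "sqrt (measure M (space M) * (\<Sum>i\<in>F. (norm (d i))\<^sup>2))"
  let ?e = "\<lambda>j x. \<Sum>i\<in>{i\<in>F. l i = j}. d i * s (e i) x"
  have eL: "(\<lambda>x. \<Sum>i\<in>G. d i * s (e i) x) \<in> Lp_space M 2" for G
    by (intro Lp_space_sum Lp_space_scale s_Lp) auto
  have eN: "Lp_norm M 2 (\<lambda>x. \<Sum>i\<in>G. d i * s (e i) x) \<le> ?R" if G: "G \<subseteq> F" for G
  proof -
    have "Lp_norm M 2 (\<lambda>x. \<Sum>i\<in>G. d i * s (e i) x) = sqrt (measure M (space M) * (\<Sum>i\<in>G. (norm (d i))\<^sup>2))"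
      using finite_subset[OF G F] by (intro L2_sign_sum) (auto intro: inj_on_subset[OF e G])
    also have "\<dots> \<le> ?R" using F G by (intro real_sqrt_le_mono mult_left_mono sum_mono2) auto
    finally show ?thesis .
  qed
  \<comment> \<open>The deviations are grouped by j: the j-th group loses the factor 2^-j against
    ?R, so all of them cost 2 ?R in addition to the orthogonal sum.\<close>
  define v where "v j x = 1 - w j x" for j x
  have v: "0 \<le> v j x" "v j x \<le> (1 / 2) ^ j" for j x using w_bounds by (auto simp: v_def)
  have [measurable]: "v j \<in> borel_measurable M" for j unfolding v_def by measurable
  have veL: "(\<lambda>x. v j x * ?e j x) \<in> Lp_space M 2" "Lp_norm M 2 (\<lambda>x. v j x * ?e j x) \<le> (1 / 2) ^ j * ?R" for j
  proof -
    have le: "AE x in M. norm (complex_of_real (v j x) * ?e j x) \<le> norm (complex_of_real ((1 / 2) ^ j) * ?e j x)"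
      using v by (intro AE_I2) (auto simp: norm_mult norm_power norm_divide intro!: mult_right_mono)
    have meas: "(\<lambda>x. complex_of_real (v j x) * ?e j x) \<in> borel_measurable M" by measurable
    show "(\<lambda>x. v j x * ?e j x) \<in> Lp_space M 2"
      by (rule Lp_norm_mono(1)[OF _ Lp_space_scale[OF eL] meas le]) simp
    have "Lp_norm M 2 (\<lambda>x. v j x * ?e j x) \<le> Lp_norm M 2 (\<lambda>x. complex_of_real ((1 / 2) ^ j) * ?e j x)"
      by (rule Lp_norm_mono(2)[OF _ Lp_space_scale[OF eL] meas le]) simp
    also have "\<dots> = (1 / 2) ^ j * Lp_norm M 2 (?e j)"
      by (subst Lp_norm_scale) (auto simp: norm_power norm_divide)
    also have "\<dots> \<le> (1 / 2) ^ j * ?R" by (intro mult_left_mono eN) auto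
    finally show "Lp_norm M 2 (\<lambda>x. v j x * ?e j x) \<le> (1 / 2) ^ j * ?R" .
  qed
  have split: "(\<Sum>i\<in>F. d i * (s (e i) x * w (l i) x))
      = (\<Sum>i\<in>F. d i * s (e i) x) - (\<Sum>j\<in>l ` F. v j x * ?e j x)" for x
  proof -
    have "(\<Sum>j\<in>l ` F. v j x * ?e j x) = (\<Sum>j\<in>l ` F. \<Sum>i\<in>{i\<in>F. l i = j}. v (l i) x * (d i * s (e i) x))"
      by (intro sum.cong refl) (simp add: sum_distrib_left)
    also have "\<dots> = (\<Sum>i\<in>F. v (l i) x * (d i * s (e i) x))"
      using F by (intro sum.image_gen[symmetric])
    finally show ?thesis by (simp add: v_def algebra_simps sum_subtractf)
  qed
  have "Lp_norm M 2 (\<lambda>x. \<Sum>i\<in>F. d i * (s (e i) x * w (l i) x))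
      \<le> Lp_norm M 2 (\<lambda>x. \<Sum>i\<in>F. d i * s (e i) x) + Lp_norm M 2 (\<lambda>x. \<Sum>j\<in>l ` F. v j x * ?e j x)"
    unfolding split by (intro Lp_norm_triangle_diff eL Lp_space_sum veL) auto
  also have "Lp_norm M 2 (\<lambda>x. \<Sum>j\<in>l ` F. v j x * ?e j x) \<le> (\<Sum>j\<in>l ` F. Lp_norm M 2 (\<lambda>x. v j x * ?e j x))"
    by (intro Lp_norm_sum veL) auto
  also have "\<dots> \<le> (\<Sum>j\<in>l ` F. (1 / 2) ^ j * ?R)" by (intro sum_mono veL)
  also have "\<dots> = (\<Sum>j\<in>l ` F. (1 / 2) ^ j) * ?R" by (simp add: sum_distrib_right)
  also have "\<dots> \<le> 2 * ?R"
  proof (rule mult_right_mono)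
    have "(\<Sum>j\<in>l ` F. (1 / 2 :: real) ^ j) \<le> (\<Sum>j. (1 / 2) ^ j)"
      using F by (intro sum_le_suminf) (auto simp: summable_geometric)
    also have "\<dots> = 2" by (simp add: suminf_geometric)
    finally show "(\<Sum>j\<in>l ` F. (1 / 2 :: real) ^ j) \<le> 2" .
  qed (simp add: sum_nonneg)
  also have "Lp_norm M 2 (\<lambda>x. \<Sum>i\<in>F. d i * s (e i) x) + 2 * ?R \<le> 3 * ?R"
    using eN[of F] by simp
  finally show ?thesis by simp
qed

end

lemma l2_le_lp:
  fixes c :: "'i \<Rightarrow> complex"
  assumes "finite F" "0 < p" "p \<le> 2"
  shows "sqrt (\<Sum>i\<in>F. (norm (c i))\<^sup>2) \<le> (\<Sum>i\<in>F. norm (c i) powr p) powr (1 / p)"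
proof (rule powr_le_powrD[of _ p])
  have "sqrt (\<Sum>i\<in>F. (norm (c i))\<^sup>2) powr p = (\<Sum>i\<in>F. (norm (c i))\<^sup>2) powr (p / 2)"
    using norm_square_powr_half[of "complex_of_real (sqrt (\<Sum>i\<in>F. (norm (c i))\<^sup>2))" p] by (simp add: sum_nonneg)
  also have "\<dots> \<le> (\<Sum>i\<in>F. (norm (c i))\<^sup>2 powr (p / 2))"
    using assms by (intro sum_powr_le) auto
  also have "\<dots> = ((\<Sum>i\<in>F. norm (c i) powr p) powr (1 / p)) powr p"
    using assms by (simp add: norm_square_powr_half powr_powr sum_nonneg)
  finally show "sqrt (\<Sum>i\<in>F. (norm (c i))\<^sup>2) powr p \<le> ((\<Sum>i\<in>F. norm (c i) powr p) powr (1 / p)) powr p" .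
qed (use assms in auto)

context unimodular_construction
begin

text \<open>The factor 6 counts two orientations with constant 3 each; the power of the total
  measure converts L^2 norms into L^p norms.\<close>

definition noise :: real where
  "noise = measure M (space M) powr (1 / p - 1 / 2) * (6 * sqrt (measure M (space M)))"

lemma noise_nonneg: "noise \<ge> 0"
  by (simp add: noise_def)

abbreviation sec :: "(nat \<times> nat \<times> bool) set \<Rightarrow> nat \<Rightarrow> (nat \<times> nat \<times> bool) set" where
  "sec F j \<equiv> {i\<in>F. fst i = j}"

lemma sum_sec:
  fixes f :: "nat \<times> nat \<times> bool \<Rightarrow> 'c::comm_monoid_add"
  assumes "finite F"
  shows "(\<Sum>i\<in>F. f i) = (\<Sum>j\<in>fst ` F. \<Sum>i\<in>sec F j. f i)"
  using assms by (rule sum.image_gen)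

lemma h_Lp: "(\<lambda>x. complex_of_real (h j x)) \<in> Lp_space M p"
proof -
  obtain b where "\<And>x. \<bar>h j x\<bar> \<le> b" using h_bounded by blast
  then show ?thesis using p by (intro Lp_space_bounded[OF finite_measure_axioms]) auto
qed

text \<open>Copies of one j act on \<open>h j\<close> only through the sum of their coefficients;
  whatever else they contribute is a sign sum, controlled by the square sum of the
  coefficients.\<close>

lemma g_sum_bound:
  fixes c :: "nat \<times> nat \<times> bool \<Rightarrow> complex"
  assumes F: "finite F"
  shows "Lp_norm M p (\<lambda>x. \<Sum>i\<in>F. c i * g i x)
    \<le> Lp_norm M p (\<lambda>x. \<Sum>j\<in>fst ` F. ((\<Sum>i\<in>sec F j. c i) / height j) * h j x)
      + noise * sqrt (\<Sum>i\<in>F. (norm (c i))\<^sup>2)"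
proof -
  define e where "e i = prod_encode (fst i, fst (snd i))" for i :: "nat \<times> nat \<times> bool"
  \<comment> \<open>Both orientations share a sign function, so the indices of the signs are
    distinct only after the orientation is fixed.\<close>
  define F' where "F' \<sigma> = {i\<in>F. snd (snd i) = \<sigma>}" for \<sigma>
  have F': "finite (F' \<sigma>)" "inj_on e (F' \<sigma>)" for \<sigma>
    using F by (auto simp: F'_def e_def inj_on_def)
  define T where "T \<sigma> x = (\<Sum>i\<in>F' \<sigma>. c i * (s (e i) x * w (fst i) x))" for \<sigma> x
  have gi: "g i x = u (fst i) x + turn (snd (snd i)) * (s (e i) x * w (fst i) x)" for i x
    by (cases i) (simp add: g_def e_def)
  have FF: "F = F' True \<union> F' False" "F' True \<inter> F' False = {}" by (auto simp: F'_def)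
  have split: "(\<Sum>i\<in>F. c i * g i x) = (\<Sum>j\<in>fst ` F. ((\<Sum>i\<in>sec F j. c i) / height j) * h j x)
      + (\<i> * T True x - \<i> * T False x)" for x
  proof -
    have "(\<Sum>i\<in>F. c i * g i x) = (\<Sum>i\<in>F. c i * u (fst i) x) + (\<Sum>i\<in>F. turn (snd (snd i)) * (c i * (s (e i) x * w (fst i) x)))"
      unfolding gi by (simp add: distrib_left sum.distrib mult_ac)
    also have "(\<Sum>i\<in>F. c i * u (fst i) x) = (\<Sum>j\<in>fst ` F. ((\<Sum>i\<in>sec F j. c i) / height j) * h j x)"
      unfolding sum_sec[OF F]
    proof (rule sum.cong[OF refl])
      fix j
      have "(\<Sum>i\<in>sec F j. c i * u (fst i) x) = (\<Sum>i\<in>sec F j. c i * u j x)" by (intro sum.cong) auto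
      also have "\<dots> = (\<Sum>i\<in>sec F j. c i) * u j x" by (rule sum_distrib_right[symmetric])
      finally show "(\<Sum>i\<in>sec F j. c i * u (fst i) x) = ((\<Sum>i\<in>sec F j. c i) / height j) * h j x"
        by (simp add: u_def)
    qed
    also have "(\<Sum>i\<in>F. turn (snd (snd i)) * (c i * (s (e i) x * w (fst i) x)))
       = (\<Sum>i\<in>F' True. turn (snd (snd i)) * (c i * (s (e i) x * w (fst i) x)))
       + (\<Sum>i\<in>F' False. turn (snd (snd i)) * (c i * (s (e i) x * w (fst i) x)))"
      by (subst FF(1)) (intro sum.union_disjoint F' FF(2))
    also have "(\<Sum>i\<in>F' True. turn (snd (snd i)) * (c i * (s (e i) x * w (fst i) x))) = \<i> * T True x"
      unfolding T_def sum_distrib_left by (intro sum.cong) (auto simp: F'_def turn_def)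
    also have "(\<Sum>i\<in>F' False. turn (snd (snd i)) * (c i * (s (e i) x * w (fst i) x))) = - \<i> * T False x"
      unfolding T_def sum_distrib_left by (intro sum.cong) (auto simp: F'_def turn_def)
    finally show ?thesis by simp
  qed
  have T2: "T \<sigma> \<in> Lp_space M 2" for \<sigma>
  proof -
    have "\<bar>s i x * w j x\<bar> \<le> 1" for i j x using w_bounds[of j x] abs_s[of i x] by (simp add: abs_mult)
    then have "(\<lambda>x. complex_of_real (s i x * w j x)) \<in> Lp_space M 2" for i j
      by (intro Lp_space_bounded[OF finite_measure_axioms, of _ 1]) (auto simp del: of_real_mult)
    then show ?thesis unfolding T_def by (intro Lp_space_sum Lp_space_scale) auto
  qed
  have Tp: "T \<sigma> \<in> Lp_space M p" for \<sigma>
    using Lp_norm_exponent_mono(1)[OF finite_measure_axioms T2] p by simp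
  have TN: "Lp_norm M p (T \<sigma>) \<le> noise / 2 * sqrt (\<Sum>i\<in>F. (norm (c i))\<^sup>2)" for \<sigma>
  proof -
    let ?m = "measure M (space M)"
    have "Lp_norm M p (T \<sigma>) \<le> ?m powr (1 / p - 1 / 2) * Lp_norm M 2 (T \<sigma>)"
      using p by (intro Lp_norm_exponent_mono(2)[OF finite_measure_axioms T2]) auto
    also have "\<dots> \<le> ?m powr (1 / p - 1 / 2) * (3 * sqrt (?m * (\<Sum>i\<in>F. (norm (c i))\<^sup>2)))"
    proof (rule mult_left_mono)
      have "Lp_norm M 2 (T \<sigma>) \<le> 3 * sqrt (?m * (\<Sum>i\<in>F' \<sigma>. (norm (c i))\<^sup>2))"
        unfolding T_def by (rule L2_weighted_sign_sum[OF F'])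
      also have "\<dots> \<le> 3 * sqrt (?m * (\<Sum>i\<in>F. (norm (c i))\<^sup>2))"
        using F by (intro mult_left_mono real_sqrt_le_mono sum_mono2) (auto simp: F'_def)
      finally show "Lp_norm M 2 (T \<sigma>) \<le> 3 * sqrt (?m * (\<Sum>i\<in>F. (norm (c i))\<^sup>2))" .
    qed simp
    finally show ?thesis by (simp add: noise_def real_sqrt_mult mult_ac)
  qed
  have hL: "(\<lambda>x. \<Sum>j\<in>fst ` F. ((\<Sum>i\<in>sec F j. c i) / height j) * h j x) \<in> Lp_space M p"
    using p by (intro Lp_space_sum Lp_space_scale h_Lp) auto
  have iT: "(\<lambda>x. \<i> * T True x - \<i> * T False x) \<in> Lp_space M p"
    using p by (intro Lp_space_diff Lp_space_scale Tp) auto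
  have "Lp_norm M p (\<lambda>x. \<Sum>i\<in>F. c i * g i x)
      \<le> Lp_norm M p (\<lambda>x. \<Sum>j\<in>fst ` F. ((\<Sum>i\<in>sec F j. c i) / height j) * h j x)
        + Lp_norm M p (\<lambda>x. \<i> * T True x - \<i> * T False x)"
    unfolding split using p by (intro Lp_norm_triangle hL iT) auto
  also have "Lp_norm M p (\<lambda>x. \<i> * T True x - \<i> * T False x) \<le> Lp_norm M p (\<lambda>x. \<i> * T True x) + Lp_norm M p (\<lambda>x. \<i> * T False x)"
    using p by (intro Lp_norm_triangle_diff Lp_space_scale Tp) auto
  also have "\<dots> \<le> noise * sqrt (\<Sum>i\<in>F. (norm (c i))\<^sup>2)"
    using TN[of True] TN[of False] p by (simp add: Lp_norm_scale)
  finally show ?thesis by simp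
qed

lemma card_sec_real:
  assumes "F \<subseteq> idx"
  shows "real (card (sec F j)) \<le> 2 * (real (height j))\<^sup>2"
proof -
  have "sec F j \<subseteq> {j} \<times> {..<(height j)\<^sup>2} \<times> (UNIV :: bool set)"
    using assms by (auto simp: idx_def)
  then have "card (sec F j) \<le> card ({j} \<times> {..<(height j)\<^sup>2} \<times> (UNIV :: bool set))"
    by (intro card_mono) auto
  then have "card (sec F j) \<le> 2 * (height j)\<^sup>2" by (simp add: card_cartesian_product mult.commute)
  from of_nat_mono[OF this, where 'a = real] show ?thesis by simp
qed

text \<open>Any part of the copies of j, with any multipliers, amounts to multiplying the j-th term
  by \<eta>_j of modulus at most 1, since there are only 2 H^2 copies. Their coefficients have
  square sum at most |hs|^2 / 2.\<close>

lemma alpha_bound: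
  fixes \<theta> :: "nat \<times> nat \<times> bool \<Rightarrow> complex"
  assumes F: "finite F" "F \<subseteq> idx" and f: "f \<in> Lp_space M p" and \<theta>: "\<And>i. norm (\<theta> i) \<le> 1"
  shows "Lp_norm M p (\<lambda>x. \<Sum>i\<in>F. \<theta> i * \<alpha> i f * g i x) \<le> (K + noise * K) * Lp_norm M p f"
proof -
  define \<eta> where "\<eta> j = (\<Sum>i\<in>sec F j. \<theta> i) / (2 * (height j)\<^sup>2)" for j
  have H: "real (height j) > 0" for j using height(3)[of j] by simp
  have \<eta>: "norm (\<eta> j) \<le> 1" for j
  proof -
    have "norm (\<Sum>i\<in>sec F j. \<theta> i) \<le> real (card (sec F j)) * 1"
      using \<theta> by (intro order_trans[OF norm_sum] sum_bounded_above)
    also have "\<dots> \<le> 2 * (real (height j))\<^sup>2"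
      using card_sec_real[OF F(2), of j] by simp
    finally show ?thesis using H[of j] by (simp add: \<eta>_def norm_divide norm_mult norm_power)
  qed
  have "(\<Sum>i\<in>sec F j. \<theta> i * \<alpha> i f) / height j = \<eta> j * hs j f" for j
  proof -
    have "(\<Sum>i\<in>sec F j. \<theta> i * \<alpha> i f) = (\<Sum>i\<in>sec F j. \<theta> i * (hs j f / (2 * height j)))"
      by (intro sum.cong) (auto simp: \<alpha>_def)
    also have "\<dots> = (\<Sum>i\<in>sec F j. \<theta> i) * (hs j f / (2 * height j))" by (rule sum_distrib_right[symmetric])
    finally show ?thesis by (simp add: \<eta>_def power2_eq_square)
  qed
  then have 1: "Lp_norm M p (\<lambda>x. \<Sum>j\<in>fst ` F. ((\<Sum>i\<in>sec F j. \<theta> i * \<alpha> i f) / height j) * h j x) \<le> K * Lp_norm M p f"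
    using multiplier[of "fst ` F" f \<eta>] F f \<eta> by simp
  have "(\<Sum>i\<in>F. (norm (\<theta> i * \<alpha> i f))\<^sup>2) \<le> (\<Sum>i\<in>F. (norm (\<alpha> i f))\<^sup>2)"
    using \<theta> by (intro sum_mono power_mono) (auto simp: norm_mult mult_left_le_one_le)
  also have "\<dots> = (\<Sum>j\<in>fst ` F. \<Sum>i\<in>sec F j. (norm (\<alpha> i f))\<^sup>2)" by (rule sum_sec[OF F(1)])
  also have "\<dots> \<le> (\<Sum>j\<in>fst ` F. (norm (hs j f))\<^sup>2)"
  proof (rule sum_mono)
    fix j
    have "(\<Sum>i\<in>sec F j. (norm (\<alpha> i f))\<^sup>2) = (\<Sum>i\<in>sec F j. (norm (hs j f) / (2 * height j))\<^sup>2)"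
      by (intro sum.cong) (auto simp: \<alpha>_def norm_divide norm_mult)
    also have "\<dots> = real (card (sec F j)) * (norm (hs j f) / (2 * height j))\<^sup>2" by simp
    also have "\<dots> \<le> (2 * (real (height j))\<^sup>2) * (norm (hs j f) / (2 * height j))\<^sup>2"
      by (intro mult_right_mono card_sec_real[OF F(2)]) simp
    also have "\<dots> = (norm (hs j f))\<^sup>2 / 2" using H[of j] by (simp add: power_divide power_mult_distrib)
    also have "\<dots> \<le> (norm (hs j f))\<^sup>2" by simp
    finally show "(\<Sum>i\<in>sec F j. (norm (\<alpha> i f))\<^sup>2) \<le> (norm (hs j f))\<^sup>2" .
  qed
  also have "\<dots> \<le> (K * Lp_norm M p f)\<^sup>2" using F f by (intro square) auto
  finally have "sqrt (\<Sum>i\<in>F. (norm (\<theta> i * \<alpha> i f))\<^sup>2) \<le> K * Lp_norm M p f"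
    using K by (intro real_le_lsqrt) (auto simp: sum_nonneg)
  then have 2: "noise * sqrt (\<Sum>i\<in>F. (norm (\<theta> i * \<alpha> i f))\<^sup>2) \<le> noise * (K * Lp_norm M p f)"
    using noise_nonneg by (intro mult_left_mono)
  show ?thesis
    using g_sum_bound[OF F(1), of "\<lambda>i. \<theta> i * \<alpha> i f"] 1 2 by (simp add: distrib_right mult.assoc)
qed

text \<open>Cauchy-Schwarz over at most 2 H^2 copies loses the factor sqrt 2 H, which the division
  by H repairs up to sqrt 2. So each section has a merged coefficient bounded by its l^p norm, and
  type p of the system applies.\<close>

lemma lp_coefficient_bound:
  fixes c :: "nat \<times> nat \<times> bool \<Rightarrow> complex"
  assumes F: "finite F" "F \<subseteq> idx"
  shows "Lp_norm M p (\<lambda>x. \<Sum>i\<in>F. c i * g i x) \<le> (2 * K + noise) * (\<Sum>i\<in>F. norm (c i) powr p) powr (1 / p)"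
proof -
  let ?S = "(\<Sum>i\<in>F. norm (c i) powr p)"
  have p0: "0 < p" using p by simp
  have H: "real (height j) > 0" for j using height(3)[of j] by simp
  have b: "norm ((\<Sum>i\<in>sec F j. c i) / height j) powr p \<le> 2 * (\<Sum>i\<in>sec F j. norm (c i) powr p)" for j
  proof -
    let ?Q = "\<Sum>i\<in>sec F j. (norm (c i))\<^sup>2" and ?P = "\<Sum>i\<in>sec F j. norm (c i) powr p"
    have "(norm (\<Sum>i\<in>sec F j. c i))\<^sup>2 \<le> (\<Sum>i\<in>sec F j. 1 * norm (c i))\<^sup>2"
      using norm_sum[of c "sec F j"] by (intro power_mono) auto
    also have "\<dots> \<le> (\<Sum>i\<in>sec F j. 1\<^sup>2) * ?Q" by (rule Cauchy_Schwarz_ineq_sum)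
    also have "\<dots> \<le> (2 * (real (height j))\<^sup>2) * ?Q"
    proof (rule mult_right_mono)
      show "(\<Sum>i\<in>sec F j. 1\<^sup>2) \<le> 2 * (real (height j))\<^sup>2"
        using card_sec_real[OF F(2), of j] by simp
    qed (simp add: sum_nonneg)
    finally have "(norm ((\<Sum>i\<in>sec F j. c i) / height j))\<^sup>2 \<le> 2 * ?Q"
      using H[of j] by (simp add: norm_divide power_divide divide_le_eq mult_ac)
    then have "((norm ((\<Sum>i\<in>sec F j. c i) / height j))\<^sup>2) powr (p / 2) \<le> (2 * ?Q) powr (p / 2)"
      using p by (intro powr_mono2) auto
    also have "\<dots> = 2 powr (p / 2) * ?Q powr (p / 2)" by (simp add: powr_mult sum_nonneg)
    also have "\<dots> \<le> 2 powr 1 * ?P"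
    proof (rule mult_mono)
      show "2 powr (p / 2) \<le> (2 :: real) powr 1" using p by (intro powr_mono) auto
      have "?Q powr (p / 2) \<le> (\<Sum>i\<in>sec F j. (norm (c i))\<^sup>2 powr (p / 2))"
        using F p by (intro sum_powr_le) auto
      then show "?Q powr (p / 2) \<le> ?P" by (simp add: norm_square_powr_half)
    qed (auto simp: sum_nonneg)
    finally show ?thesis by (simp add: norm_square_powr_half)
  qed
  have "Lp_norm M p (\<lambda>x. \<Sum>j\<in>fst ` F. ((\<Sum>i\<in>sec F j. c i) / height j) * h j x)
      \<le> K * (\<Sum>j\<in>fst ` F. norm ((\<Sum>i\<in>sec F j. c i) / height j) powr p) powr (1 / p)"
    using F by (intro type_p) auto
  also have "\<dots> \<le> K * (2 * ?S) powr (1 / p)"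
  proof (intro mult_left_mono powr_mono2)
    have "(\<Sum>j\<in>fst ` F. norm ((\<Sum>i\<in>sec F j. c i) / height j) powr p)
        \<le> (\<Sum>j\<in>fst ` F. 2 * (\<Sum>i\<in>sec F j. norm (c i) powr p))"
      by (intro sum_mono b)
    also have "\<dots> = 2 * ?S" unfolding sum_sec[OF F(1)] by (rule sum_distrib_left[symmetric])
    finally show "(\<Sum>j\<in>fst ` F. norm ((\<Sum>i\<in>sec F j. c i) / height j) powr p) \<le> 2 * ?S" .
  qed (use K p in \<open>auto simp: sum_nonneg\<close>)
  also have "(2 * ?S) powr (1 / p) = 2 powr (1 / p) * ?S powr (1 / p)" by (simp add: powr_mult sum_nonneg)
  also have "\<dots> \<le> 2 powr 1 * ?S powr (1 / p)"
    using p by (intro mult_right_mono powr_mono) auto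
  finally have 1: "Lp_norm M p (\<lambda>x. \<Sum>j\<in>fst ` F. ((\<Sum>i\<in>sec F j. c i) / height j) * h j x) \<le> K * (2 * ?S powr (1 / p))"
    using K by (simp add: mult_left_mono)
  have "noise * sqrt (\<Sum>i\<in>F. (norm (c i))\<^sup>2) \<le> noise * ?S powr (1 / p)"
    using noise_nonneg l2_le_lp[OF F(1) p0 p(2)] by (intro mult_left_mono)
  with 1 show ?thesis using g_sum_bound[OF F(1), of c] by (simp add: distrib_right mult_ac)
qed

lemma hs_linear:
  assumes "f \<in> Lp_space M p" "f' \<in> Lp_space M p"
  shows "hs k (\<lambda>x. f x + f' x) = hs k f + hs k f'" "hs k (\<lambda>x. c * f x) = c * hs k f"
  using hs_dual[of k] assms unfolding dual_space_def by auto

text \<open>The multipliers are fixed to 1 only on \<open>F0\<close> because a finite set of doubled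
  indices may contain one of the two listings of an index elsewhere. An approximant with finitely
  many nonzero coefficients does not notice this, and the bound for arbitrary multipliers handles
  the difference.\<close>

lemma alpha_net:
  assumes f: "f \<in> Lp_space M p" and \<epsilon>: "\<epsilon> > 0"
  obtains F0 where "finite F0" "F0 \<subseteq> idx"
    "\<And>F (\<theta> :: nat \<times> nat \<times> bool \<Rightarrow> complex). finite F \<Longrightarrow> F0 \<subseteq> F \<Longrightarrow> F \<subseteq> idx \<Longrightarrow>
      (\<And>i. norm (\<theta> i) \<le> 1) \<Longrightarrow> (\<And>i. i \<in> F0 \<Longrightarrow> \<theta> i = 1) \<Longrightarrow>
      Lp_norm M p (\<lambda>x. (\<Sum>i\<in>F. \<theta> i * \<alpha> i f * g i x) - f x) < \<epsilon>"
proof -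
  define C where "C = K + noise * K"
  have C: "C \<ge> 0" using K noise_nonneg by (simp add: C_def)
  have p1: "p \<ge> 1" "p \<ge> 0" using p by auto
  \<comment> \<open>The expansion of f - f' costs a factor C and f - f' itself a factor 1.\<close>
  have e1: "\<epsilon> / (C + 1) > 0" using \<epsilon> C by simp
  obtain n f' where f': "f' \<in> Lp_space M p" "Lp_norm M p (\<lambda>x. f x - f' x) < \<epsilon> / (C + 1)"
    "\<And>k. k \<ge> n \<Longrightarrow> hs k f' = 0" "Lp_norm M p (\<lambda>x. (\<Sum>k<n. hs k f' * h k x) - f' x) = 0"
    using dense[OF f e1] by blast
  define F0 where "F0 = (SIGMA j:{..<n}. {..<(height j)\<^sup>2} \<times> (UNIV :: bool set))"
  have F0: "finite F0" "F0 \<subseteq> idx" by (auto simp: F0_def idx_def)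
  \<comment> \<open>With all copies present the two orientations cancel the sign parts.\<close>
  have exact: "(\<Sum>i\<in>F0. \<alpha> i f' * g i x) = (\<Sum>k<n. hs k f' * h k x)" for x
  proof -
    have "(\<Sum>i\<in>F0. \<alpha> i f' * g i x) = (\<Sum>j<n. \<Sum>i\<in>{..<(height j)\<^sup>2} \<times> (UNIV :: bool set). \<alpha> (j, i) f' * g (j, i) x)"
      unfolding F0_def by (subst sum.Sigma) (auto simp: case_prod_beta')
    also have "\<dots> = (\<Sum>j<n. hs j f' * h j x)"
    proof (rule sum.cong[OF refl])
      fix j
      have H: "height j \<noteq> 0" using height(3)[of j] by simp
      have "(\<Sum>i\<in>{..<(height j)\<^sup>2} \<times> (UNIV :: bool set). \<alpha> (j, i) f' * g (j, i) x)
          = (\<Sum>n<(height j)\<^sup>2. \<Sum>\<sigma>\<in>UNIV. \<alpha> (j, n, \<sigma>) f' * g (j, n, \<sigma>) x)"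
        by (subst sum.cartesian_product) (auto simp: case_prod_beta')
      also have "\<dots> = (\<Sum>n<(height j)\<^sup>2. hs j f' / height j * u j x)"
        by (intro sum.cong refl) (simp add: UNIV_bool \<alpha>_def g_def turn_def algebra_simps)
      also have "\<dots> = hs j f' * h j x"
        using H by (simp add: u_def power2_eq_square)
      finally show "(\<Sum>i\<in>{..<(height j)\<^sup>2} \<times> (UNIV :: bool set). \<alpha> (j, i) f' * g (j, i) x) = hs j f' * h j x" .
    qed
    finally show ?thesis .
  qed
  have "Lp_norm M p (\<lambda>x. (\<Sum>i\<in>F. \<theta> i * \<alpha> i f * g i x) - f x) < \<epsilon>"
    if F: "finite F" "F0 \<subseteq> F" "F \<subseteq> idx" and \<theta>: "\<And>i. norm (\<theta> i) \<le> 1" "\<And>i. i \<in> F0 \<Longrightarrow> \<theta> i = 1"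
    for F and \<theta> :: "nat \<times> nat \<times> bool \<Rightarrow> complex"
  proof -
    let ?d = "\<lambda>x. f x - f' x"
    have d: "?d \<in> Lp_space M p" using f f' p1 by (intro Lp_space_diff) auto
    have \<alpha>d: "\<alpha> i f = \<alpha> i ?d + \<alpha> i f'" for i
      using hs_linear(1)[OF d f'(1), of "fst i"] by (simp add: \<alpha>_def add_divide_distrib)
    have tail: "(\<Sum>i\<in>F. \<theta> i * \<alpha> i f' * g i x) = (\<Sum>k<n. hs k f' * h k x)" for x
    proof -
      have z: "\<alpha> i f' = 0" if "i \<in> F - F0" for i
      proof -
        have "fst i \<ge> n" using that F(3) by (auto simp: F0_def idx_def)
        then show ?thesis using f'(3) by (simp add: \<alpha>_def)
      qed
      have "(\<Sum>i\<in>F. \<theta> i * \<alpha> i f' * g i x) = (\<Sum>i\<in>F0. \<theta> i * \<alpha> i f' * g i x)"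
        using F z by (intro sum.mono_neutral_right) auto
      also have "\<dots> = (\<Sum>i\<in>F0. \<alpha> i f' * g i x)" using \<theta>(2) by (intro sum.cong) auto
      finally show ?thesis using exact by simp
    qed
    have gL: "g i \<in> Lp_space M p" for i using p by (intro g_Lp) simp
    have L1: "(\<lambda>x. \<Sum>i\<in>F. \<theta> i * \<alpha> i ?d * g i x) \<in> Lp_space M p"
      using p1 by (intro Lp_space_sum Lp_space_scale gL) auto
    have L2: "(\<lambda>x. (\<Sum>k<n. hs k f' * h k x) - f' x) \<in> Lp_space M p"
      using p1 f' by (intro Lp_space_diff Lp_space_sum Lp_space_scale h_Lp) auto
    have "(\<Sum>i\<in>F. \<theta> i * \<alpha> i f * g i x) - f x
       = ((\<Sum>i\<in>F. \<theta> i * \<alpha> i ?d * g i x) + ((\<Sum>k<n. hs k f' * h k x) - f' x)) - ?d x" for x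
      unfolding tail[symmetric] \<alpha>d by (simp add: algebra_simps sum.distrib)
    then have "Lp_norm M p (\<lambda>x. (\<Sum>i\<in>F. \<theta> i * \<alpha> i f * g i x) - f x)
       \<le> Lp_norm M p (\<lambda>x. (\<Sum>i\<in>F. \<theta> i * \<alpha> i ?d * g i x) + ((\<Sum>k<n. hs k f' * h k x) - f' x)) + Lp_norm M p ?d"
      using p1 d by (simp only:) (intro Lp_norm_triangle_diff Lp_space_add L1 L2; simp)
    also have "Lp_norm M p (\<lambda>x. (\<Sum>i\<in>F. \<theta> i * \<alpha> i ?d * g i x) + ((\<Sum>k<n. hs k f' * h k x) - f' x))
       \<le> Lp_norm M p (\<lambda>x. \<Sum>i\<in>F. \<theta> i * \<alpha> i ?d * g i x) + 0"
      using Lp_norm_triangle[OF p1(1) L1 L2] f'(4) by simp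
    also have "Lp_norm M p (\<lambda>x. \<Sum>i\<in>F. \<theta> i * \<alpha> i ?d * g i x) \<le> C * Lp_norm M p ?d"
      unfolding C_def by (rule alpha_bound[OF F(1,3) d \<theta>(1)])
    also have "C * Lp_norm M p ?d + 0 + Lp_norm M p ?d = (C + 1) * Lp_norm M p ?d" by (simp add: algebra_simps)
    also have "\<dots> < \<epsilon>" using f'(2) C by (simp add: pos_less_divide_eq mult.commute)
    finally show ?thesis by simp
  qed
  then show thesis by (rule that[OF F0])
qed

end

subsection \<open>Normalizing the coefficient functionals\<close>

locale unimodular_frame = unimodular_construction M p h hs K s
  for M :: "'a measure" and p h hs K s +
  fixes J :: "nat \<Rightarrow> 'a set"
  assumes J_sets [measurable]: "\<And>i. J i \<in> sets M"
    and J_disjoint: "disjoint_family J"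
    and J_pos: "\<And>i. measure M (J i) > 0"
begin

text \<open>The injection \<open>to_nat\<close> gives every index a piece of its own.\<close>

definition pc :: "nat \<times> nat \<times> bool \<Rightarrow> 'a set" where "pc i = J (to_nat i)"

lemma pc_sets [measurable]: "pc i \<in> sets M" by (simp add: pc_def)
lemma pc_pos: "measure M (pc i) > 0" by (simp add: pc_def J_pos)
lemma pc_disjoint: "i \<noteq> j \<Longrightarrow> pc i \<inter> pc j = {}"
  using J_disjoint unfolding pc_def disjoint_family_on_def by simp

text \<open>The power of the measure makes this functional have value 1 at the L^p-normalized
  indicator of the piece.\<close>

definition \<rho> :: "nat \<times> nat \<times> bool \<Rightarrow> ('a \<Rightarrow> complex) \<Rightarrow> complex" where
  "\<rho> i f = complex_of_real (measure M (pc i) powr (1 / p - 1)) * (CLINT x|M. indicator (pc i) x * f x)"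

lemma rho_linear:
  assumes "f \<in> Lp_space M p" "f' \<in> Lp_space M p"
  shows "\<rho> i (\<lambda>x. f x + f' x) = \<rho> i f + \<rho> i f'" "\<rho> i (\<lambda>x. c * f x) = c * \<rho> i f"
proof -
  have ig: "integrable M (\<lambda>x. indicator (pc i) x * f x)" if "f \<in> Lp_space M p" for f :: "'a \<Rightarrow> complex"
  proof -
    have "integrable M f" using p by (intro norm_integral_indicator_le(1)[OF finite_measure_axioms pc_sets that]) auto
    from integrable_mult_indicator[OF pc_sets this] show ?thesis
      by (rule Bochner_Integration.integrable_cong[THEN iffD1, rotated 2]) (auto simp: indicator_def)
  qed
  show "\<rho> i (\<lambda>x. f x + f' x) = \<rho> i f + \<rho> i f'"
    using ig[OF assms(1)] ig[OF assms(2)] by (simp add: \<rho>_def distrib_left)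
  show "\<rho> i (\<lambda>x. c * f x) = c * \<rho> i f"
    by (simp add: \<rho>_def mult.left_commute[of _ c])
qed

text \<open>Hoelder's inequality on each piece cancels the normalizing power exactly, and
  disjointness bounds the sum of the local integrals by the whole.\<close>

lemma rho_sum:
  assumes F: "finite F" and f: "f \<in> Lp_space M p"
  shows "(\<Sum>i\<in>F. norm (\<rho> i f) powr p) \<le> Lp_norm M p f powr p"
proof -
  have p1: "p \<ge> 1" "p > 0" using p by auto
  have int: "integrable M (\<lambda>x. norm (f x) powr p)" using Lp_spaceD[OF f] by simp
  have inti: "integrable M (\<lambda>x. indicator (pc i) x * norm (f x) powr p)" for i
    using integrable_mult_indicator[OF pc_sets int] by simp
  have "norm (\<rho> i f) powr p \<le> (LINT x|M. indicator (pc i) x * norm (f x) powr p)" for i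
  proof -
    let ?m = "measure M (pc i)"
    have "norm (\<rho> i f) powr p = ?m powr (1 - p) * norm (LINT x|M. indicator (pc i) x * f x) powr p"
      using p1 by (simp add: \<rho>_def norm_mult powr_mult powr_powr left_diff_distrib)
    also have "\<dots> \<le> ?m powr (1 - p) * (?m powr (p - 1) * (LINT x|M. indicator (pc i) x * norm (f x) powr p))"
      by (intro mult_left_mono norm_integral_indicator_le(2)[OF finite_measure_axioms pc_sets f p1(1)]) auto
    also have "\<dots> = (LINT x|M. indicator (pc i) x * norm (f x) powr p)"
      using pc_pos[of i] by (simp flip: mult.assoc powr_add)
    finally show ?thesis .
  qed
  then have "(\<Sum>i\<in>F. norm (\<rho> i f) powr p) \<le> (\<Sum>i\<in>F. (LINT x|M. indicator (pc i) x * norm (f x) powr p))"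
    by (intro sum_mono)
  also have "\<dots> = (LINT x|M. (\<Sum>i\<in>F. indicator (pc i) x * norm (f x) powr p))"
    by (rule Bochner_Integration.integral_sum[OF inti, symmetric])
  also have "\<dots> \<le> (LINT x|M. norm (f x) powr p)"
  proof (intro integral_mono Bochner_Integration.integrable_sum inti int)
    fix x
    show "(\<Sum>i\<in>F. indicator (pc i) x * norm (f x) powr p) \<le> norm (f x) powr p"
    proof (cases "\<exists>i\<in>F. x \<in> pc i")
      case True
      then obtain i where i: "i \<in> F" "x \<in> pc i" by blast
      have "x \<notin> pc j" if "j \<noteq> i" for j using pc_disjoint[OF that] i(2) by blast
      then have "(\<Sum>j\<in>F. indicator (pc j) x * norm (f x) powr p) = (\<Sum>j\<in>{i}. indicator (pc j) x * norm (f x) powr p)"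
        using i F by (intro sum.mono_neutral_right) auto
      then show ?thesis using i by simp
    next
      case False
      then have "(\<Sum>i\<in>F. indicator (pc i) x * norm (f x) powr p) = 0" by (intro sum.neutral) auto
      then show ?thesis by simp
    qed
  qed
  also have "\<dots> = Lp_norm M p f powr p" using p1 by (simp add: Lp_norm_powr)
  finally show ?thesis .
qed

lemma rho_le: "f \<in> Lp_space M p \<Longrightarrow> norm (\<rho> i f) \<le> Lp_norm M p f"
  using rho_sum[of "{i}" f] p powr_le_powrD[of "norm (\<rho> i f)" p "Lp_norm M p f"] by simp

text \<open>A finite set whose sum comes within \<epsilon> of the supremum leaves less than
  \<epsilon> to any set disjoint from it.\<close>

lemma rho_tail:
  assumes f: "f \<in> Lp_space M p" and \<epsilon>: "\<epsilon> > 0"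
  shows "\<exists>F0. finite F0 \<and> F0 \<subseteq> idx \<and> (\<forall>F. finite F \<longrightarrow> F \<subseteq> idx \<longrightarrow> F \<inter> F0 = {} \<longrightarrow>
    (\<Sum>i\<in>F. norm (\<rho> i f) powr p) < \<epsilon>)"
proof -
  define \<F> where "\<F> = {F. finite F \<and> F \<subseteq> idx}"
  define S where "S = (SUP F\<in>\<F>. \<Sum>i\<in>F. norm (\<rho> i f) powr p)"
  have bdd: "bdd_above ((\<lambda>F. \<Sum>i\<in>F. norm (\<rho> i f) powr p) ` \<F>)"
    using rho_sum[OF _ f] by (intro bdd_aboveI[of _ "Lp_norm M p f powr p"]) (auto simp: \<F>_def)
  have ne: "\<F> \<noteq> {}" by (auto simp: \<F>_def)
  have "S - \<epsilon> < S" using \<epsilon> by simp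
  then obtain F0 where F0: "F0 \<in> \<F>" "S - \<epsilon> < (\<Sum>i\<in>F0. norm (\<rho> i f) powr p)"
    unfolding S_def using less_cSUP_iff[OF ne bdd] by blast
  have "(\<Sum>i\<in>F. norm (\<rho> i f) powr p) < \<epsilon>" if F: "finite F" "F \<subseteq> idx" "F \<inter> F0 = {}" for F
  proof -
    have "F0 \<union> F \<in> \<F>" using F F0 by (auto simp: \<F>_def)
    then have "(\<Sum>i\<in>F0 \<union> F. norm (\<rho> i f) powr p) \<le> S"
      unfolding S_def by (intro cSUP_upper bdd)
    moreover have "(\<Sum>i\<in>F0 \<union> F. norm (\<rho> i f) powr p) = (\<Sum>i\<in>F0. norm (\<rho> i f) powr p) + (\<Sum>i\<in>F. norm (\<rho> i f) powr p)"
      using F F0 by (intro sum.union_disjoint) (auto simp: \<F>_def)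
    ultimately show ?thesis using F0(2) by linarith
  qed
  then show ?thesis using F0(1) by (intro exI[of _ F0]) (auto simp: \<F>_def)
qed

definition sgn2 :: "bool \<Rightarrow> complex" where "sgn2 t = (if t then 1 else - 1)"

text \<open>When both listings of an index are present, the \<rho> parts cancel and the \<alpha>
  parts add up to \<alpha>.\<close>

definition g' :: "(nat \<times> nat \<times> bool) \<times> bool \<Rightarrow> ('a \<Rightarrow> complex) \<Rightarrow> complex" where
  "g' i f = (\<alpha> (fst i) f + sgn2 (snd i) * \<rho> (fst i) f) / 2"

lemma alpha_le:
  assumes f: "f \<in> Lp_space M p"
  shows "norm (\<alpha> i f) \<le> Lp_norm M p f / 2"
proof -
  have H: "real (height (fst i)) > 0" using height(3)[of "fst i"] by simp
  have "(norm (hs (fst i) f))\<^sup>2 \<le> (K * Lp_norm M p f)\<^sup>2" using square[of "{fst i}" f] f by simp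
  then have "norm (hs (fst i) f) \<le> K * Lp_norm M p f"
    by (rule power2_le_imp_le) (use K in simp)
  also have "\<dots> \<le> height (fst i) * Lp_norm M p f" using height(1) by (intro mult_right_mono) auto
  finally show ?thesis using H by (simp add: \<alpha>_def norm_divide norm_mult field_simps)
qed

lemma g'_le:
  assumes f: "f \<in> Lp_space M p"
  shows "norm (g' i f) \<le> Lp_norm M p f"
proof -
  have "norm (\<alpha> (fst i) f + sgn2 (snd i) * \<rho> (fst i) f) \<le> norm (\<alpha> (fst i) f) + norm (sgn2 (snd i) * \<rho> (fst i) f)"
    by (rule norm_triangle_ineq)
  also have "\<dots> \<le> Lp_norm M p f / 2 + Lp_norm M p f"
    using alpha_le[OF f, of "fst i"] rho_le[OF f, of "fst i"] by (simp add: norm_mult sgn2_def)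
  finally have "norm (\<alpha> (fst i) f + sgn2 (snd i) * \<rho> (fst i) f) \<le> 3 / 2 * Lp_norm M p f" by simp
  moreover have "norm (g' i f) = norm (\<alpha> (fst i) f + sgn2 (snd i) * \<rho> (fst i) f) / 2"
    by (simp add: g'_def norm_divide)
  ultimately show ?thesis using Lp_norm_nonneg[of M p f] by linarith
qed

lemma g'_dual: "g' i \<in> dual_space (Lp_space M p) (Lp_norm M p)"
proof -
  have "g' i (\<lambda>x. f x + f' x) = g' i f + g' i f'" if "f \<in> Lp_space M p" "f' \<in> Lp_space M p" for f f'
    using hs_linear(1)[OF that, of "fst (fst i)"] rho_linear(1)[OF that, of "fst i"]
    by (simp add: g'_def \<alpha>_def algebra_simps add_divide_distrib)
  moreover have "g' i (\<lambda>x. c * f x) = c * g' i f" if "f \<in> Lp_space M p" for f c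
    using hs_linear(2)[OF that that, of "fst (fst i)"] rho_linear(2)[OF that that, of "fst i"]
    by (simp add: g'_def \<alpha>_def algebra_simps add_divide_distrib)
  ultimately show ?thesis
    unfolding dual_space_def using g'_le[of _ i] by (auto intro!: exI[of _ 1])
qed

text \<open>At the normalized indicator of the piece \<rho> equals 1 and \<alpha> is at most 1/2, so
  half of the difference leaves 1/4.\<close>

lemma dual_norm_g':
  "1 / 4 \<le> dual_norm (Lp_space M p) (Lp_norm M p) (g' i)" "dual_norm (Lp_space M p) (Lp_norm M p) (g' i) \<le> 1"
proof -
  have p0: "p > 0" using p by simp
  let ?U = "{f \<in> Lp_space M p. Lp_norm M p f \<le> 1}"
  have le1: "norm (g' i f) \<le> 1" if "f \<in> ?U" for f using g'_le[of f i] that by auto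
  have "(\<lambda>x. 0) \<in> ?U" by simp
  then have ne: "?U \<noteq> {}" by blast
  show "dual_norm (Lp_space M p) (Lp_norm M p) (g' i) \<le> 1"
    unfolding dual_norm_def using le1 by (rule cSUP_least[OF ne])
  let ?m = "measure M (pc (fst i))"
  have m: "?m > 0" by (rule pc_pos)
  define f where "f x = complex_of_real (?m powr (- 1 / p)) * indicator (pc (fst i)) x" for x
  have f: "f \<in> Lp_space M p"
    unfolding f_def using p0
    by (intro Lp_space_scale Lp_space_bounded[OF finite_measure_axioms, of _ 1]) (auto simp: indicator_def)
  have "(LINT x|M. norm (f x) powr p) = (LINT x|M. ?m powr (- 1) * indicator (pc (fst i)) x)"
    using p0 by (intro Bochner_Integration.integral_cong) (auto simp: f_def indicator_def norm_mult powr_powr)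
  also have "\<dots> = 1" using m by (simp add: powr_minus emeasure_eq_measure)
  finally have fN: "Lp_norm M p f = 1" by (simp add: Lp_norm_def)
  have "(LINT x|M. indicator (pc (fst i)) x * f x) = (LINT x|M. complex_of_real (?m powr (- 1 / p)) * indicator (pc (fst i)) x)"
    by (intro Bochner_Integration.integral_cong) (auto simp: f_def indicator_def)
  also have "\<dots> = complex_of_real (?m powr (- 1 / p) * ?m)"
    using integral_indicator_complex[OF pc_sets] by simp
  finally have "\<rho> (fst i) f = complex_of_real (?m powr (1 / p - 1) * (?m powr (- 1 / p) * ?m))"
    by (simp add: \<rho>_def)
  also have "?m powr (1 / p - 1) * (?m powr (- 1 / p) * ?m) = 1"
  proof -
    have "?m powr (1 / p - 1) * (?m powr (- 1 / p) * ?m powr 1) = ?m powr 0"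
      by (simp only: powr_add[symmetric]) simp
    then show ?thesis using m by simp
  qed
  finally have rho: "\<rho> (fst i) f = 1" by simp
  have "1 / 2 \<le> norm (sgn2 (snd i) * \<rho> (fst i) f) - norm (\<alpha> (fst i) f)"
    using alpha_le[OF f, of "fst i"] fN rho by (simp add: sgn2_def)
  also have "\<dots> \<le> norm (\<alpha> (fst i) f + sgn2 (snd i) * \<rho> (fst i) f)"
    using norm_diff_ineq[of "sgn2 (snd i) * \<rho> (fst i) f" "\<alpha> (fst i) f"] by (simp add: add.commute)
  finally have "1 / 4 \<le> norm (g' i f)" by (simp add: g'_def norm_divide)
  also have "\<dots> \<le> dual_norm (Lp_space M p) (Lp_norm M p) (g' i)"
    unfolding dual_norm_def using f fN le1 by (intro cSUP_upper bdd_aboveI[of _ 1]) auto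
  finally show "1 / 4 \<le> dual_norm (Lp_space M p) (Lp_norm M p) (g' i)" .
qed

lemma frame_net:
  assumes f: "f \<in> Lp_space M p" and \<epsilon>: "\<epsilon> > 0"
  shows "\<exists>F0. finite F0 \<and> F0 \<subseteq> idx \<times> UNIV \<and> (\<forall>F. finite F \<longrightarrow> F0 \<subseteq> F \<longrightarrow> F \<subseteq> idx \<times> UNIV \<longrightarrow>
    Lp_norm M p (\<lambda>x. (\<Sum>i\<in>F. g' i f * g (fst i) x) - f x) < \<epsilon>)"
proof -
  have p1: "p \<ge> 1" "p > 0" using p by auto
  define D where "D = 2 * K + noise"
  have D: "D > 0" using K noise_nonneg by (simp add: D_def add_pos_nonneg)
  have e2: "\<epsilon> / 2 > 0" "(\<epsilon> / 2 / D) powr p > 0" using \<epsilon> D by auto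
  show ?thesis
  proof (rule alpha_net[OF f e2(1)])
    fix A1 assume A1: "finite A1" "A1 \<subseteq> idx"
      "\<And>F (\<theta> :: nat \<times> nat \<times> bool \<Rightarrow> complex). finite F \<Longrightarrow> A1 \<subseteq> F \<Longrightarrow> F \<subseteq> idx \<Longrightarrow> (\<And>i. norm (\<theta> i) \<le> 1) \<Longrightarrow> (\<And>i. i \<in> A1 \<Longrightarrow> \<theta> i = 1) \<Longrightarrow>
        Lp_norm M p (\<lambda>x. (\<Sum>i\<in>F. \<theta> i * \<alpha> i f * g i x) - f x) < \<epsilon> / 2"
    obtain A2 where A2: "finite A2" "A2 \<subseteq> idx"
      "\<And>F. finite F \<Longrightarrow> F \<subseteq> idx \<Longrightarrow> F \<inter> A2 = {} \<Longrightarrow> (\<Sum>i\<in>F. norm (\<rho> i f) powr p) < (\<epsilon> / 2 / D) powr p"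
      using rho_tail[OF f e2(2)] by blast
    have gL: "g i \<in> Lp_space M p" for i using p by (intro g_Lp) simp
    have "Lp_norm M p (\<lambda>x. (\<Sum>i\<in>F. g' i f * g (fst i) x) - f x) < \<epsilon>"
      if F: "finite F" "(A1 \<union> A2) \<times> UNIV \<subseteq> F" "F \<subseteq> idx \<times> UNIV" for F
    proof -
      define E where "E = fst ` F"
      have "i \<in> E" if "i \<in> A1" for i
      proof -
        have "(i, True) \<in> F" using F(2) that by auto
        then show ?thesis unfolding E_def by (metis fst_conv image_eqI)
      qed
      then have "A1 \<subseteq> E" by blast
      moreover have "finite E" "E \<subseteq> idx" using F by (auto simp: E_def)
      ultimately have E: "finite E" "A1 \<subseteq> E" "E \<subseteq> idx" by blast+
      \<comment> \<open>\<theta> is half the number of listings of i in F; \<delta> is 1/2 or -1/2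
        if only one occurs and 0 otherwise. The frame sum thus becomes an \<alpha> sum with
        multiplier \<theta> plus a \<rho> sum with multiplier \<delta>, and F contains both listings
        on \<open>A1\<close> and \<open>A2\<close>.\<close>
      define n where "n t i = (if (i, t) \<in> F then 1 else 0 :: complex)" for t i
      define \<theta> where "\<theta> i = (n True i + n False i) / 2" for i
      define \<delta> where "\<delta> i = (n True i - n False i) / 2" for i
      have \<theta>: "norm (\<theta> i) \<le> 1" "i \<in> A1 \<Longrightarrow> \<theta> i = 1" for i using F(2) by (auto simp: \<theta>_def n_def)
      have \<delta>: "norm (\<delta> i) \<le> 1" "i \<in> A2 \<Longrightarrow> \<delta> i = 0" for i using F(2) by (auto simp: \<delta>_def n_def)
      have split: "(\<Sum>i\<in>F. g' i f * g (fst i) x) = (\<Sum>i\<in>E. \<theta> i * \<alpha> i f * g i x) + (\<Sum>i\<in>E. \<delta> i * \<rho> i f * g i x)" for x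
      proof -
        have "(\<Sum>i\<in>F. g' i f * g (fst i) x) = (\<Sum>i\<in>E \<times> UNIV. if i \<in> F then g' i f * g (fst i) x else 0)"
        proof (rule sum.mono_neutral_cong_left)
          show "F \<subseteq> E \<times> UNIV"
          proof
            fix i assume "i \<in> F"
            then have "fst i \<in> E" unfolding E_def by (rule imageI)
            then show "i \<in> E \<times> UNIV" by (cases i) simp
          qed
        qed (use E(1) in auto)
        also have "\<dots> = (\<Sum>i\<in>E. \<Sum>t\<in>UNIV. if (i, t) \<in> F then g' (i, t) f * g i x else 0)"
          by (subst sum.cartesian_product) (auto simp: case_prod_beta' intro!: sum.cong)
        also have "\<dots> = (\<Sum>i\<in>E. \<theta> i * \<alpha> i f * g i x + \<delta> i * \<rho> i f * g i x)"
        proof (rule sum.cong[OF refl])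
          fix i
          show "(\<Sum>t\<in>UNIV. if (i, t) \<in> F then g' (i, t) f * g i x else 0) = \<theta> i * \<alpha> i f * g i x + \<delta> i * \<rho> i f * g i x"
            by (cases "(i, True) \<in> F"; cases "(i, False) \<in> F")
              (simp_all add: UNIV_bool \<theta>_def \<delta>_def n_def g'_def sgn2_def field_simps)
        qed
        finally show ?thesis by (simp add: sum.distrib)
      qed
      have L: "(\<lambda>x. \<Sum>i\<in>E. \<theta> i * \<alpha> i f * g i x) \<in> Lp_space M p" "(\<lambda>x. \<Sum>i\<in>E. \<delta> i * \<rho> i f * g i x) \<in> Lp_space M p"
        using p1 by (auto intro!: Lp_space_sum Lp_space_scale gL)
      have "(\<Sum>i\<in>F. g' i f * g (fst i) x) - f x = ((\<Sum>i\<in>E. \<theta> i * \<alpha> i f * g i x) - f x) + (\<Sum>i\<in>E. \<delta> i * \<rho> i f * g i x)" for x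
        unfolding split by simp
      then have "Lp_norm M p (\<lambda>x. (\<Sum>i\<in>F. g' i f * g (fst i) x) - f x)
          \<le> Lp_norm M p (\<lambda>x. (\<Sum>i\<in>E. \<theta> i * \<alpha> i f * g i x) - f x) + Lp_norm M p (\<lambda>x. \<Sum>i\<in>E. \<delta> i * \<rho> i f * g i x)"
        using p1 f by (simp only:) (intro Lp_norm_triangle Lp_space_diff L; simp)
      moreover have "Lp_norm M p (\<lambda>x. (\<Sum>i\<in>E. \<theta> i * \<alpha> i f * g i x) - f x) < \<epsilon> / 2"
        by (rule A1(3)[OF E \<theta>])
      moreover have "Lp_norm M p (\<lambda>x. \<Sum>i\<in>E. \<delta> i * \<rho> i f * g i x) \<le> \<epsilon> / 2"
      proof -
        have "Lp_norm M p (\<lambda>x. \<Sum>i\<in>E. \<delta> i * \<rho> i f * g i x) \<le> D * (\<Sum>i\<in>E. norm (\<delta> i * \<rho> i f) powr p) powr (1 / p)"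
          unfolding D_def by (rule lp_coefficient_bound[OF E(1,3)])
        also have "\<dots> \<le> D * (\<epsilon> / 2 / D)"
        proof (rule mult_left_mono)
          \<comment> \<open>\<delta> vanishes on \<open>A2\<close>, so only the small tail of \<rho>
            remains.\<close>
          have "(\<Sum>i\<in>E. norm (\<delta> i * \<rho> i f) powr p) = (\<Sum>i\<in>E - A2. norm (\<delta> i * \<rho> i f) powr p)"
            using E(1) \<delta>(2) by (intro sum.mono_neutral_right) auto
          also have "\<dots> \<le> (\<Sum>i\<in>E - A2. norm (\<rho> i f) powr p)"
            using \<delta>(1) p1 by (intro sum_mono powr_mono2) (auto simp: norm_mult mult_left_le_one_le)
          also have "\<dots> \<le> (\<epsilon> / 2 / D) powr p"
            by (rule less_imp_le[OF A2(3)]) (use E in auto)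
          finally have "(\<Sum>i\<in>E. norm (\<delta> i * \<rho> i f) powr p) powr (1 / p) \<le> ((\<epsilon> / 2 / D) powr p) powr (1 / p)"
            using p1 by (intro powr_mono2) (auto simp: sum_nonneg)
          then show "(\<Sum>i\<in>E. norm (\<delta> i * \<rho> i f) powr p) powr (1 / p) \<le> \<epsilon> / 2 / D"
            using p1 \<epsilon> D by (simp add: powr_powr)
        qed (use D in simp)
        also have "\<dots> = \<epsilon> / 2" using D by simp
        finally show ?thesis .
      qed
      ultimately show ?thesis by linarith
    qed
    then show ?thesis using A1(1,2) A2(1,2)
      by (intro exI[of _ "(A1 \<union> A2) \<times> UNIV"]) auto
  qed
qed

lemma unimodular_frame:
  "\<exists>G G'. unconditional_Schauder_frame (Lp_space M p) (Lp_norm M p) G G' \<and>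
     (\<forall>n. unimodular M (G n)) \<and> seminormalized (dual_norm (Lp_space M p) (Lp_norm M p)) G'"
proof -
  let ?I = "idx \<times> (UNIV :: bool set)"
  have "range (\<lambda>j :: nat. (j, 0 :: nat, True)) \<subseteq> idx"
  proof
    fix i :: "nat \<times> nat \<times> bool" assume "i \<in> range (\<lambda>j. (j, 0, True))"
    then obtain j where "i = (j, 0, True)" by blast
    then show "i \<in> idx" using height(3)[of j] by (auto simp: idx_def)
  qed
  moreover have "infinite (range (\<lambda>j :: nat. (j, 0 :: nat, True)))"
    by (intro range_inj_infinite injI) auto
  ultimately have "infinite idx" using finite_subset by blast
  then have "infinite ?I" by (auto simp: finite_cartesian_product_iff)
  then have e: "bij_betw (from_nat_into ?I) UNIV ?I"
    by (intro bij_betw_from_nat_into) auto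
  have "unconditional_Schauder_frame (Lp_space M p) (Lp_norm M p)
      (\<lambda>n. (\<lambda>i. g (fst i)) (from_nat_into ?I n)) (\<lambda>n. g' (from_nat_into ?I n))"
    using p frame_net by (intro unconditional_Schauder_frame_of_net[OF e]) (auto intro: g_Lp g'_dual)
  moreover have "unimodular M (g i)" for i by (simp add: unimodular_def norm_g)
  moreover have "seminormalized (dual_norm (Lp_space M p) (Lp_norm M p)) (\<lambda>n. g' (from_nat_into ?I n))"
    unfolding seminormalized_def
    by (rule exI[of _ "1 / 4"], rule conjI, simp, rule exI[of _ 1], intro conjI allI dual_norm_g', simp)
  ultimately show ?thesis by blast
qed

end

subsection \<open>Lebesgue measure on a set of positive finite measure\<close>

text \<open>The measure of the part of E below a moving coordinate hyperplane depends continuously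
  on its level and runs from 0 to the measure of E; the intermediate value theorem picks the
  half.\<close>

lemma lebesgue_on_halves:
  fixes \<Omega> :: "(real ^ 'd) set"
  assumes \<Omega>: "\<Omega> \<in> sets lebesgue" and fin: "emeasure lebesgue \<Omega> < \<infinity>" and E: "E \<in> sets (lebesgue_on \<Omega>)"
  shows "\<exists>E'\<in>sets (lebesgue_on \<Omega>). E' \<subseteq> E \<and> measure (lebesgue_on \<Omega>) E' = measure (lebesgue_on \<Omega>) E / 2"
proof -
  let ?M = "lebesgue_on \<Omega>"
  interpret M: finite_measure ?M
    using \<Omega> fin by (intro finite_measureI) (auto simp: emeasure_restrict_space space_restrict_space)
  define i :: 'd where "i = undefined"
  have xm [measurable]: "(\<lambda>x. x $ i) \<in> borel_measurable ?M"
    by (intro measurable_restrict_space1 measurable_completion) simp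
  have [measurable]: "E \<in> sets ?M" by (rule E)
  define \<phi> where "\<phi> t = measure ?M (E \<inter> {x \<in> space ?M. x $ i \<le> t})" for t
  have Esub: "E \<subseteq> space ?M" using E by (rule sets.sets_into_space)
  have \<phi>: "\<phi> t = (LINT x|?M. (indicator E x :: real) * indicator {..t} (x $ i))" for t
  proof -
    have "(LINT x|?M. (indicator E x :: real) * indicator {..t} (x $ i)) = (LINT x|?M. indicator (E \<inter> {x \<in> space ?M. x $ i \<le> t}) x)"
      using Esub by (intro Bochner_Integration.integral_cong) (auto simp: indicator_def)
    also have "\<dots> = \<phi> t"
      by (simp add: \<phi>_def) (rule arg_cong[where f = "measure ?M"], use Esub in auto)
    finally show ?thesis ..
  qed
  have lim: "(\<lambda>n. \<phi> (X n)) \<longlonglongrightarrow> (LINT x|?M. indicator E x * c x)"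
    if c: "c \<in> borel_measurable ?M" "AE x in ?M. (\<lambda>n. indicator {..X n} (x $ i) :: real) \<longlonglongrightarrow> c x" for X c
    unfolding \<phi>
  proof (rule integral_dominated_convergence[where w = "\<lambda>_. 1"])
    show "AE x in ?M. (\<lambda>n. indicator E x * indicator {..X n} (x $ i)) \<longlonglongrightarrow> indicator E x * c x"
      using c(2) by eventually_elim (intro tendsto_mult tendsto_const)
    show "(\<lambda>x. (indicator E x :: real) * c x) \<in> borel_measurable ?M" using c(1) by measurable
    show "(\<lambda>x. (indicator E x :: real) * indicator {..X n} (x $ i)) \<in> borel_measurable ?M" for n by measurable
    show "AE x in ?M. norm (indicator E x * indicator {..X n} (x $ i) :: real) \<le> 1" for n
      by (intro AE_I2) (auto simp: indicator_def)
  qed simp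
  have mE: "(LINT x|?M. indicator E x) = measure ?M E" using Esub by (simp add: Int_absorb2)
  have cont: "isCont \<phi> t" for t
  proof (rule continuous_at_sequentiallyI)
    fix X :: "nat \<Rightarrow> real" assume X: "X \<longlonglongrightarrow> t"
    \<comment> \<open>Continuity holds because the indicators converge off the hyperplane, which is
      a null set.\<close>
    have "negligible {x :: real ^ 'd. x \<bullet> axis i 1 = t}" by (intro negligible_standard_hyperplane) simp
    then have "negligible {x :: real ^ 'd. x $ i = t}" by (simp add: inner_axis)
    then have "{x :: real ^ 'd. x $ i = t} \<in> null_sets lebesgue" by (simp add: negligible_iff_null_sets)
    then have "AE x in lebesgue. x $ i \<noteq> t" using AE_not_in by fastforce
    then have ae: "AE x in ?M. x $ i \<noteq> t"
      using \<Omega> by (subst AE_restrict_space_iff) (auto elim: eventually_mono)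
    have "(\<lambda>n. \<phi> (X n)) \<longlonglongrightarrow> (LINT x|?M. indicator E x * indicator {..t} (x $ i))"
    proof (rule lim)
      show "AE x in ?M. (\<lambda>n. indicator {..X n} (x $ i) :: real) \<longlonglongrightarrow> indicator {..t} (x $ i)"
        using ae
      proof eventually_elim
        case (elim x)
        then consider "x $ i < t" | "x $ i > t" by linarith
        then have "eventually (\<lambda>n. indicator {..t} (x $ i) = (indicator {..X n} (x $ i) :: real)) sequentially"
        proof cases
          case 1
          have "eventually (\<lambda>n. X n > x $ i) sequentially" using X 1 by (rule order_tendstoD)
          then show ?thesis by eventually_elim (use 1 in \<open>auto simp: indicator_def\<close>)
        next
          case 2
          have "eventually (\<lambda>n. X n < x $ i) sequentially" using X 2 by (rule order_tendstoD)
          then show ?thesis by eventually_elim (use 2 in \<open>auto simp: indicator_def\<close>)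
        qed
        then show ?case by (intro Lim_transform_eventually[OF tendsto_const])
      qed
    qed measurable
    then show "(\<lambda>n. \<phi> (X n)) \<longlonglongrightarrow> \<phi> t" by (simp add: \<phi>)
  qed
  have top: "(\<lambda>n. \<phi> (real n)) \<longlonglongrightarrow> measure ?M E"
  proof -
    have "(\<lambda>n. \<phi> (real n)) \<longlonglongrightarrow> (LINT x|?M. indicator E x * 1)"
    proof (rule lim)
      show "AE x in ?M. (\<lambda>n. indicator {..real n} (x $ i) :: real) \<longlonglongrightarrow> 1"
      proof (rule AE_I2)
        fix x :: "real ^ 'd"
        have "eventually (\<lambda>n. real n \<ge> x $ i) sequentially"
          using filterlim_real_sequentially unfolding filterlim_at_top by blast
        then have "eventually (\<lambda>n. 1 = (indicator {..real n} (x $ i) :: real)) sequentially"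
          by eventually_elim (auto simp: indicator_def)
        then show "(\<lambda>n. indicator {..real n} (x $ i) :: real) \<longlonglongrightarrow> 1" by (intro Lim_transform_eventually[OF tendsto_const])
      qed
    qed simp
    then show ?thesis using mE by simp
  qed
  have bot: "(\<lambda>n. \<phi> (- real n)) \<longlonglongrightarrow> 0"
  proof -
    have "(\<lambda>n. \<phi> (- real n)) \<longlonglongrightarrow> (LINT x|?M. indicator E x * 0)"
    proof (rule lim)
      show "AE x in ?M. (\<lambda>n. indicator {..- real n} (x $ i) :: real) \<longlonglongrightarrow> 0"
      proof (rule AE_I2)
        fix x :: "real ^ 'd"
        have "eventually (\<lambda>n. real n \<ge> 1 - x $ i) sequentially"
          using filterlim_real_sequentially unfolding filterlim_at_top by blast
        then have "eventually (\<lambda>n. 0 = (indicator {..- real n} (x $ i) :: real)) sequentially"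
          by eventually_elim (auto simp: indicator_def)
        then show "(\<lambda>n. indicator {..- real n} (x $ i) :: real) \<longlonglongrightarrow> 0" by (intro Lim_transform_eventually[OF tendsto_const])
      qed
    qed simp
    then show ?thesis by simp
  qed
  show ?thesis
  proof (cases "measure ?M E = 0")
    case True
    then show ?thesis by (intro bexI[of _ "{}"]) auto
  next
    case False
    then have m: "measure ?M E > 0" by (simp add: less_le)
    from order_tendstoD(1)[OF top, of "measure ?M E / 2"] m obtain a where a: "\<phi> (real a) > measure ?M E / 2"
      by (auto simp: eventually_sequentially)
    from order_tendstoD(2)[OF bot, of "measure ?M E / 2"] m obtain b where b: "\<phi> (- real b) < measure ?M E / 2"
      by (auto simp: eventually_sequentially)
    have "\<exists>t. - real b \<le> t \<and> t \<le> real a \<and> \<phi> t = measure ?M E / 2"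
      using a b cont by (intro IVT) auto
    then obtain t where "\<phi> t = measure ?M E / 2" by blast
    moreover have "E \<inter> {x \<in> space ?M. x $ i \<le> t} \<in> sets ?M" by measurable
    ultimately show ?thesis unfolding \<phi>_def
      by (intro bexI[of _ "E \<inter> {x \<in> space ?M. x $ i \<le> t}"]) auto
  qed
qed

text \<open>Outer regularity replaces S by an open T with error e / 2, and the members of a
  countable basis inside T exhaust it, so finitely many suffice up to another e / 2.\<close>

lemma lebesgue_on_countably_generated:
  fixes \<Omega> :: "'a::euclidean_space set"
  assumes \<Omega>: "\<Omega> \<in> sets lebesgue" and fin: "emeasure lebesgue \<Omega> < \<infinity>"
  shows "\<exists>B :: nat \<Rightarrow> 'a set. (\<forall>n. B n \<in> sets (lebesgue_on \<Omega>)) \<and>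
    (\<forall>S\<in>sets (lebesgue_on \<Omega>). \<forall>e>0. \<exists>I. finite I \<and>
       measure (lebesgue_on \<Omega>) ((S - (\<Union>i\<in>I. B i)) \<union> ((\<Union>i\<in>I. B i) - S)) < e)"
proof -
  let ?M = "lebesgue_on \<Omega>"
  interpret M: finite_measure ?M
    using \<Omega> fin by (intro finite_measureI) (auto simp: emeasure_restrict_space space_restrict_space)
  obtain \<B> :: "'a set set" where \<B>: "countable \<B>" "topological_basis \<B>" using ex_countable_basis by auto
  have ne: "\<B> \<noteq> {}"
    using topological_basisE[OF \<B>(2) open_UNIV UNIV_I, of undefined] by blast
  define Ob where "Ob n = from_nat_into \<B> n" for n
  have Ob: "Ob n \<in> \<B>" for n unfolding Ob_def using ne by (rule from_nat_into)
  have Ob_open: "open (Ob n)" for n using Ob \<B>(2) by (rule topological_basis_open[rotated])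
  define B where "B n = Ob n \<inter> \<Omega>" for n
  have Bs: "B n \<in> sets ?M" for n
    unfolding B_def sets_restrict_space Int_commute[of _ \<Omega>] by (rule imageI) (use Ob_open[of n] borel_open in auto)
  have "\<exists>I. finite I \<and> measure ?M ((S - (\<Union>i\<in>I. B i)) \<union> ((\<Union>i\<in>I. B i) - S)) < e"
    if S: "S \<in> sets ?M" and e: "e > 0" for S e
  proof -
    have SL: "S \<in> sets lebesgue" and SO: "S \<subseteq> \<Omega>" using S \<Omega> by (auto simp: sets_restrict_space)
    have e2: "e / 2 > 0" using e by simp
    obtain T where T: "open T" "S \<subseteq> T" "(T - S) \<in> lmeasurable" "emeasure lebesgue (T - S) < ennreal (e / 2)"
      using sets_lebesgue_outer_open[OF SL e2] by metis
    have TS: "(T - S) \<inter> \<Omega> \<in> sets ?M" using T \<Omega> by (auto simp: sets_restrict_space fmeasurable_def)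
    have "emeasure ?M ((T - S) \<inter> \<Omega>) = emeasure lebesgue ((T - S) \<inter> \<Omega>)"
      using \<Omega> by (intro emeasure_restrict_space) auto
    also have "\<dots> \<le> emeasure lebesgue (T - S)" using T(3) by (intro emeasure_mono) (auto simp: fmeasurable_def)
    also note T(4)
    finally have TSm: "measure ?M ((T - S) \<inter> \<Omega>) < e / 2"
      using e by (simp add: M.emeasure_eq_measure ennreal_less_iff)
    define I where "I N = {n. n < N \<and> Ob n \<subseteq> T}" for N
    \<comment> \<open>Truncating the basis sets contained in T at N gives an increasing sequence
      with union T within \<Omega>.\<close>
    define U where "U N = (\<Union>n\<in>I N. B n)" for N
    have U: "U N \<in> sets ?M" for N unfolding U_def using Bs by (intro sets.finite_UN) (auto simp: I_def)
    have "(\<Union>N. U N) = T \<inter> \<Omega>"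
    proof (rule set_eqI, rule iffI)
      fix x assume "x \<in> (\<Union>N. U N)"
      then show "x \<in> T \<inter> \<Omega>" by (auto simp: U_def I_def B_def)
    next
      fix x assume x: "x \<in> T \<inter> \<Omega>"
      obtain b where b: "b \<in> \<B>" "x \<in> b" "b \<subseteq> T" using topological_basisE[OF \<B>(2) T(1), of x] x by blast
      obtain n where "Ob n = b" using from_nat_into_surj[OF \<B>(1) b(1)] by (auto simp: Ob_def)
      then have "x \<in> U (Suc n)" using b x by (auto simp: U_def I_def B_def)
      then show "x \<in> (\<Union>N. U N)" by blast
    qed
    moreover have "U m \<subseteq> U n" if "m \<le> n" for m n
      unfolding U_def using that by (intro UN_mono) (auto simp: I_def)
    then have "(\<lambda>N. measure ?M (U N)) \<longlonglongrightarrow> measure ?M (\<Union>N. U N)"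
      using U by (intro M.finite_Lim_measure_incseq) (auto simp: incseq_def)
    ultimately have "(\<lambda>N. measure ?M (U N)) \<longlonglongrightarrow> measure ?M (T \<inter> \<Omega>)" by simp
    from order_tendstoD(1)[OF this, of "measure ?M (T \<inter> \<Omega>) - e / 2"] e
    obtain N where N: "measure ?M (T \<inter> \<Omega>) - e / 2 < measure ?M (U N)" by (auto simp: eventually_sequentially)
    have UT: "U N \<subseteq> T \<inter> \<Omega>" by (auto simp: U_def I_def B_def)
    have TO: "T \<inter> \<Omega> \<in> sets ?M"
      unfolding sets_restrict_space Int_commute[of _ \<Omega>] by (rule imageI) (use T(1) borel_open in auto)
    have "measure ?M ((S - U N) \<union> (U N - S)) \<le> measure ?M ((T \<inter> \<Omega> - U N) \<union> ((T - S) \<inter> \<Omega>))"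
    proof (rule M.finite_measure_mono)
      show "(S - U N) \<union> (U N - S) \<subseteq> (T \<inter> \<Omega> - U N) \<union> ((T - S) \<inter> \<Omega>)"
        using T(2) SO UT by blast
    qed (use U[of N] TO TS in blast)
    also have "\<dots> \<le> measure ?M (T \<inter> \<Omega> - U N) + measure ?M ((T - S) \<inter> \<Omega>)"
      using U TO TS by (intro measure_Un_le) auto
    also have "measure ?M (T \<inter> \<Omega> - U N) = measure ?M (T \<inter> \<Omega>) - measure ?M (U N)"
      using U TO UT by (intro M.finite_measure_Diff) auto
    finally have "measure ?M ((S - U N) \<union> (U N - S)) < e" using N TSm by linarith
    then show ?thesis unfolding U_def by (intro exI[of _ "I N"]) (auto simp: I_def)
  qed
  then show ?thesis using Bs by (intro exI[of _ B]) blast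
qed

theorem theorem1p3:
  fixes \<Omega> :: "(real ^ 'd) set"
  assumes "\<Omega> \<in> sets lebesgue" and "0 < emeasure lebesgue \<Omega>" and "emeasure lebesgue \<Omega> < \<infinity>"
  shows
    "(\<forall>p::real. 1 < p \<and> p \<le> 2 \<longrightarrow>
       (\<exists>g g'. unconditional_Schauder_frame
                 (Lp_space (lebesgue_on \<Omega>) p) (Lp_norm (lebesgue_on \<Omega>) p) g g' \<and>
               (\<forall>n. unimodular (lebesgue_on \<Omega>) (g n)) \<and>
               seminormalized
                 (dual_norm (Lp_space (lebesgue_on \<Omega>) p) (Lp_norm (lebesgue_on \<Omega>) p)) g')) \<and>
     (\<forall>p::real. 2 < p \<longrightarrow>
       \<not> (\<exists>g g'. unconditional_Schauder_frame
                 (Lp_space (lebesgue_on \<Omega>) p) (Lp_norm (lebesgue_on \<Omega>) p) g g' \<and>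
               uniformly_bounded (lebesgue_on \<Omega>) g \<and>
               seminormalized (Lp_norm (lebesgue_on \<Omega>) p) g \<and>
               seminormalized
                 (dual_norm (Lp_space (lebesgue_on \<Omega>) p) (Lp_norm (lebesgue_on \<Omega>) p)) g'))"
proof -
  let ?M = "lebesgue_on \<Omega>"
  interpret finite_measure ?M
    using assms by (intro finite_measureI) (auto simp: emeasure_restrict_space space_restrict_space)
  interpret halvable_measure ?M
    by unfold_locales (rule lebesgue_on_halves[OF assms(1,3)])
  have "emeasure ?M (space ?M) = emeasure lebesgue \<Omega>"
    using assms(1) by (simp add: emeasure_restrict_space space_restrict_space)
  then have "emeasure ?M (space ?M) \<noteq> 0" using assms(2) by simp
  then have pos: "measure ?M (space ?M) > 0"
    unfolding zero_less_measure_iff emeasure_eq_measure by simp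
  have piece_pos: "measure ?M (piece i) > 0" for i by (rule measure_piece_pos[OF pos])
  obtain B :: "nat \<Rightarrow> (real ^ 'd) set" where B: "(\<forall>n. B n \<in> sets ?M) \<and> (\<forall>S\<in>sets ?M. \<forall>e>0. \<exists>I. finite I \<and>
       measure ?M ((S - (\<Union>i\<in>I. B i)) \<union> ((\<Union>i\<in>I. B i) - S)) < e)"
    using lebesgue_on_countably_generated[OF assms(1,3)] by (rule exE)
  \<comment> \<open>A second tree on the same space. The halving tree supplies signs and disjoint
    pieces, but nothing forces its cells to approximate every measurable set; the splittings
    \<open>B\<close> do that, with children of arbitrary sizes.\<close>
  interpret tree: haar_tree ?M B by unfold_locales (rule B[THEN conjunct1, rule_format])
  show ?thesis
  proof (intro conjI allI impI notI)
    fix p :: real assume p: "1 < p \<and> p \<le> 2"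
    interpret unconditional_system ?M p "\<lambda>k x. tree.haar k x / tree.haar_norm p k"
      "\<lambda>k f. tree.haar_norm p k * tree.coef f k" "max 6 ((3 / (p - 1)) powr (1 / p))"
      by (rule tree.haar_unconditional_system[OF _ _ pos B[THEN conjunct2, rule_format]]) (use p in auto)
    interpret unimodular_frame ?M p "\<lambda>k x. tree.haar k x / tree.haar_norm p k"
      "\<lambda>k f. tree.haar_norm p k * tree.coef f k" "max 6 ((3 / (p - 1)) powr (1 / p))" sign_fun piece
    proof unfold_locales
      show "(LINT x|?M. sign_fun i x * sign_fun j x) = 0" if "i \<noteq> j" for i j
      proof (cases "i < j")
        case True
        then show ?thesis by (rule sign_fun_orthogonal)
      next
        case False
        then have "j < i" using that by simp
        then show ?thesis using sign_fun_orthogonal[of j i] by (simp add: mult.commute)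
      qed
    qed (auto simp: abs_sign_fun piece_pos disjoint_piece)
    show "\<exists>g g'. unconditional_Schauder_frame (Lp_space ?M p) (Lp_norm ?M p) g g' \<and>
       (\<forall>n. unimodular ?M (g n)) \<and> seminormalized (dual_norm (Lp_space ?M p) (Lp_norm ?M p)) g'"
      by (rule unimodular_frame)
  next
    fix p :: real assume p: "2 < p"
    assume "\<exists>g g'. unconditional_Schauder_frame (Lp_space ?M p) (Lp_norm ?M p) g g' \<and>
       uniformly_bounded ?M g \<and> seminormalized (Lp_norm ?M p) g \<and>
       seminormalized (dual_norm (Lp_space ?M p) (Lp_norm ?M p)) g'"
    then show False
      using no_unconditional_Schauder_frame_bounded[OF finite_measure_axioms p disjoint_piece piece_sets piece_pos]
      by blast
  qed
qed

end
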